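(* Let $p, q_1, q_2$ be distinct primes with $p\equiv -q_1\equiv -q_2\equiv 1\pmod 4$. Let $k=\mathbb{Q}(\sqrt{pq_1q_2},i)$, $K_1=\mathbb{Q}(\sqrt p,\sqrt{q_1q_2},i)$, and write $\epsilon_{pq_1q_2}=x+y\sqrt{pq_1q_2}$. Write $p=e^2+4f^2=\pi_1\pi_2$ with $e,f\in\mathbb{N}$, $\pi_1=e+2if$, $\pi_2=e-2if$, and let $\mathcal{H}_j$ (resp. $\mathcal{Q}_j$) be the prime ideal of $k$ above $\pi_j$ (resp. $q_j$), $j=1,2$. Then: 1. If $2p(x+1)$ or $2p(x-1)$ is a square in $\mathbb{N}$, then $\kappa_{K_1}=\langle[\mathcal{H}_1],[\mathcal{Q}_1]\rangle$. 2. Otherwise, $\kappa_{K_1}=\langle[\mathcal{H}_1],[\mathcal{H}_2]\rangle$.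
   Context: $i=\sqrt{-1}$. $\epsilon_{pq_1q_2}>1$ is the fundamental unit of $\mathbb{Q}(\sqrt{pq_1q_2})$, where $x,y$ are integers or half-integers (halves of odd integers). $[\mathcal{A}]$ is the class of the ideal $\mathcal{A}$ in the ideal class group of $k$. For an unramified extension $K/k$, $\kappa_K$ is the capitulation kernel, i.e. the kernel of the homomorphism from the ideal class group of $k$ to that of $K$ induced by extension of ideals. *)

theory Defs
  imports
    "HOL-Algebra.Algebra"
    "HOL-Algebra.Algebraic_Closure_Type"
    "HOL-Number_Theory.Cong"
begin

text \<open>All number fields are subfields of the complex numbers.\<close>

definition adjoin :: "complex set \<Rightarrow> complex set"
  where "adjoin S = generate_field (ring_of_type_algebra :: complex ring) S"

definition sqrtC :: "nat \<Rightarrow> complex"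
  where "sqrtC n = complex_of_real (sqrt (real n))"

definition ring_of_integers :: "complex set \<Rightarrow> complex ring"
  where "ring_of_integers K =
    (ring_of_type_algebra :: complex ring)\<lparr>carrier := {z \<in> K. algebraic_int z}\<rparr>"

definition nonzero_ideals :: "complex set \<Rightarrow> complex set set"
  where "nonzero_ideals K = {I. ideal I (ring_of_integers K) \<and> I \<noteq> {0}}"

text \<open>
  The ideal class group consists of the classes of nonzero integral ideals, where \<open>I\<close> and \<open>J\<close> are
  equivalent iff \<open>(a) I = (b) J\<close> for some nonzero integers \<open>a\<close>, \<open>b\<close> of the field. Every class of
  fractional ideals modulo principal ones contains an integral ideal, so this is the usual group.
\<close>

definition ideal_equiv :: "complex set \<Rightarrow> (complex set \<times> complex set) set"
  where "ideal_equiv K = {(I, J). I \<in> nonzero_ideals K \<and> J \<in> nonzero_ideals K \<and>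
    (\<exists>a \<in> carrier (ring_of_integers K) - {0}. \<exists>b \<in> carrier (ring_of_integers K) - {0}.
      ideal_prod (ring_of_integers K) (PIdl\<^bsub>ring_of_integers K\<^esub> a) I =
      ideal_prod (ring_of_integers K) (PIdl\<^bsub>ring_of_integers K\<^esub> b) J)}"

definition ideal_class :: "complex set \<Rightarrow> complex set \<Rightarrow> complex set set"
  where "ideal_class K I = ideal_equiv K `` {I}"

text \<open>
  The unions below, and in \<open>class_extension\<close>, range over all representatives of the classes
  involved; as the resulting class does not depend on the representatives, the union is that class.
\<close>

definition class_group :: "complex set \<Rightarrow> complex set set monoid"
  where "class_group K =
    \<lparr>carrier = nonzero_ideals K // ideal_equiv K,
     monoid.mult = (\<lambda>C D. \<Union>I \<in> C. \<Union>J \<in> D. ideal_class K (ideal_prod (ring_of_integers K) I J)),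
     one = ideal_class K (carrier (ring_of_integers K))\<rparr>"

definition class_extension :: "complex set \<Rightarrow> complex set set \<Rightarrow> complex set set"
  where "class_extension L C = (\<Union>I \<in> C. ideal_class L (Idl\<^bsub>ring_of_integers L\<^esub> I))"

definition capitulation_kernel :: "complex set \<Rightarrow> complex set \<Rightarrow> complex set set set"
  where "capitulation_kernel K L = kernel (class_group K) (class_group L) (class_extension L)"

text \<open>
  The prime ideal \<open>P\<close> divides \<open>(a)\<close>, i.e. contains \<open>a\<close>. For a nonzero prime element \<open>a\<close> of a subring
  that is a principal ideal domain, this says that \<open>P\<close> lies above \<open>a\<close>.
\<close>

definition prime_ideal_above :: "complex set \<Rightarrow> complex \<Rightarrow> complex set \<Rightarrow> bool"
  where "prime_ideal_above K a P \<longleftrightarrow> primeideal P (ring_of_integers K) \<and> a \<in> P"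

text \<open>For \<open>K\<close> a real quadratic field.\<close>

definition fundamental_unit :: "complex set \<Rightarrow> real \<Rightarrow> bool"
  where "fundamental_unit K \<epsilon> \<longleftrightarrow> \<epsilon> > 1 \<and>
    Units (ring_of_integers K) =
      {s * complex_of_real \<epsilon> powi n | s n. s \<in> {1, -1} \<and> n \<in> (UNIV :: int set)}"

end

theory Submission
  imports Defs "HOL-Analysis.Kronecker_Approximation_Theorem" "Jordan_Normal_Form.Char_Poly"
begin

text \<open>
  Let $\tau$ generate the Galois group of $k$ over $\mathbb{Q}(i)$. Since $\mathbb{Z}[i]$ is
  principal, $I \cdot \tau I$ is generated by a Gaussian integer $c$ for every ideal $I$ of $k$.
  If $I$ becomes principal in $K_1$, generated by $\alpha$, then relative norms of $\alpha$ show that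
  $I^2$ is generated by an element $n$ of $k$ whose norm is $w c^2$, where $w$ is the norm of a unit of
  $\mathbb{Q}(\sqrt{q_1q_2}, i)$; a congruence modulo $4$ gives $w = \pm 1$. Multiplying $n/c$ by
  $i$ if necessary, Hilbert 90 replaces $I$ by a $\tau$-invariant ideal of the same class, whose class is
  a product of classes of the ramified primes $\mathcal{H}_1, \mathcal{H}_2, \mathcal{Q}_1, \mathcal{Q}_2$.

  Conversely these primes capitulate: solutions of $a^2 - pb^2 = -1$ and of $q_1a^2 - q_2b^2 = \pm 1$
  make $\pi_j$ and $q_j$ squares in $K_1$ up to units. Finally
  $(\epsilon \pm 1)^2 = 2(x \pm 1)\epsilon$, and $2(x+1)$ or $2(x-1)$ is $p$, $q_1$ or $q_2$ times a
  square; this gives the one relation between the four classes besides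
  $[\mathcal{H}_1][\mathcal{H}_2][\mathcal{Q}_1][\mathcal{Q}_2] = 1$.
\<close>

section \<open>Sums and products of algebraic integers\<close>

text \<open>The relation I * tau I = (c) is the engine: it supplies inverses of ideals up to
  scalars, and from it follow cancellation, the contraction of an extended ideal and the injectivity
  of extension. It rests on an explicit integrality test: as d is squarefree in Z[i] and d = 1 mod
  4, an element with trace and norm in Z[i] is integral, and 1, (1 + sqrt d)/2 form a basis. The
  relative discriminant is d, so 1 + i does not ramify and only the four primes dividing d do. The
  obstacle is the unit w. A unit of Z[i] changes the norm of n/c only by a sign, so w = i or -i
  would block Hilbert 90. The congruence excluding it applies only after an identity for the squared
  modulus of A^2 - m B^2, with m = q1 q2, has produced a real equation a^2 - m r^2 = 2 or -2. The
  Pell equations come from the minimal solution of x^2 = D y^2 + 1: it yields t (t + 1) = D w^2 with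
  coprime factors, minimality excludes one distribution of the primes of D, and q1 = 3 mod 4
  excludes another.\<close>

lemma algebraic_int_of_eigenvector:
  fixes z :: complex and b :: "nat \<Rightarrow> complex"
  assumes "\<And>i. i < n \<Longrightarrow> z * b i = (\<Sum>j<n. of_int (A i j) * b j)" and "k < n" "b k \<noteq> 0"
  shows "algebraic_int z"
proof -
  define M :: "int mat" where "M = Matrix.mat n n (\<lambda>(i,j). A i j)"
  define C :: "complex mat" where "C = map_mat of_int M"
  define v where "v = Matrix.vec n b"
  have M: "M \<in> carrier_mat n n" and C: "C \<in> carrier_mat n n" by (auto simp: M_def C_def)
  \<comment> \<open>The family \<open>b\<close> itself, not identically zero, is an eigenvector, so
    \<open>z\<close> is a root of the characteristic polynomial of an integer matrix, which is monic
    with integer coefficients.\<close>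
  have "C *\<^sub>v v = z \<cdot>\<^sub>v v"
    by (rule eq_vecI) (auto simp: C_def M_def v_def scalar_prod_def assms(1) atLeast0LessThan)
  moreover have "v \<noteq> 0\<^sub>v n"
  proof
    assume "v = 0\<^sub>v n"
    then have "vec_index v k = 0" using assms by simp
    then show False using assms by (simp add: v_def)
  qed
  ultimately have "eigenvalue C z" unfolding eigenvalue_def eigenvector_def using C
    by (intro exI[of _ v]) (auto simp: v_def)
  then have "poly (char_poly C) z = 0" using eigenvalue_root_char_poly[OF C] by simp
  moreover have "char_poly C = map_poly of_int (char_poly M)"
    unfolding C_def by (rule of_int_hom.char_poly_hom[OF M])
  moreover have "lead_coeff (char_poly M) = 1" using degree_monic_char_poly[OF M] by simp
  ultimately show ?thesis unfolding algebraic_int_altdef_ipoly by auto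
qed

lemma algebraic_int_of_eigenvector':
  fixes z :: complex and b :: "'i \<Rightarrow> complex"
  assumes "finite I" and "\<And>i. i \<in> I \<Longrightarrow> z * b i = (\<Sum>j\<in>I. of_int (A i j) * b j)" and "k \<in> I" "b k \<noteq> 0"
  shows "algebraic_int z"
proof -
  obtain h where h: "bij_betw h {..<card I} I"
    using ex_bij_betw_nat_finite[OF assms(1)] by (auto simp: atLeast0LessThan)
  obtain k' where k': "k' < card I" "h k' = k"
    using h assms(3) by (metis bij_betw_iff_bijections lessThan_iff)
  show ?thesis
  proof (rule algebraic_int_of_eigenvector[where b = "b \<circ> h" and A = "\<lambda>i j. A (h i) (h j)"])
    fix i assume "i < card I"
    then have "h i \<in> I" using h by (auto simp: bij_betw_def)
    then have "z * b (h i) = (\<Sum>j\<in>I. of_int (A (h i) j) * b j)" by (rule assms(2))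
    also have "\<dots> = (\<Sum>j<card I. of_int (A (h i) (h j)) * b (h j))"
      using sum.reindex_bij_betw[OF h, of "\<lambda>j. of_int (A (h i) j) * b j"] by simp
    finally show "z * (b \<circ> h) i = (\<Sum>j<card I. of_int (A (h i) (h j)) * (b \<circ> h) j)" by simp
  qed (use k' assms(4) in auto)
qed

text \<open>For finite \<open>I\<close>, multiplication by \<open>z\<close> maps the additive span
  of the family into itself. The family may be linearly dependent, so \<open>A\<close> is a witness
  and not determined by \<open>z\<close>.\<close>

definition int_matrix_on :: "'i set \<Rightarrow> ('i \<Rightarrow> complex) \<Rightarrow> complex \<Rightarrow> ('i \<Rightarrow> 'i \<Rightarrow> int) \<Rightarrow> bool"
  where "int_matrix_on I b z A \<longleftrightarrow> (\<forall>i\<in>I. z * b i = (\<Sum>j\<in>I. of_int (A i j) * b j))"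

lemma int_matrix_on_add:
  "int_matrix_on I b z A \<Longrightarrow> int_matrix_on I b w B \<Longrightarrow> int_matrix_on I b (z + w) (\<lambda>i j. A i j + B i j)"
  by (simp add: int_matrix_on_def ring_distribs sum.distrib)

text \<open>The factor \<open>w\<close> is expanded first, hence the order: the matrix of
  \<open>w\<close> times that of \<open>z\<close>.\<close>

lemma int_matrix_on_mult:
  assumes "int_matrix_on I b z A" "int_matrix_on I b w B"
  shows "int_matrix_on I b (z * w) (\<lambda>i j. \<Sum>l\<in>I. B i l * A l j)"
  unfolding int_matrix_on_def
proof
  fix i assume i: "i \<in> I"
  have "z * w * b i = z * (\<Sum>l\<in>I. of_int (B i l) * b l)"
    using assms(2) i by (simp add: int_matrix_on_def mult.assoc)
  also have "\<dots> = (\<Sum>l\<in>I. of_int (B i l) * (z * b l))"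
    by (simp add: sum_distrib_left mult_ac)
  also have "\<dots> = (\<Sum>l\<in>I. \<Sum>j\<in>I. of_int (B i l) * (of_int (A l j) * b j))"
    using assms(1) by (intro sum.cong refl) (simp add: int_matrix_on_def sum_distrib_left)
  also have "\<dots> = (\<Sum>j\<in>I. \<Sum>l\<in>I. of_int (B i l) * (of_int (A l j) * b j))"
    by (rule sum.swap)
  also have "\<dots> = (\<Sum>j\<in>I. of_int (\<Sum>l\<in>I. B i l * A l j) * b j)"
    by (simp add: sum_distrib_right mult.assoc)
  finally show "z * w * b i = (\<Sum>j\<in>I. of_int (\<Sum>l\<in>I. B i l * A l j) * b j)" .
qed

lemma algebraic_int_power_relation:
  fixes x :: complex
  assumes "algebraic_int x"
  obtains n :: nat and c :: "nat \<Rightarrow> int" where "n > 0" "x ^ n = (\<Sum>i<n. of_int (c i) * x ^ i)"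
proof -
  obtain P :: "int poly" where P: "poly (map_poly of_int P) x = 0" "lead_coeff P = 1"
    using assms unfolding algebraic_int_altdef_ipoly by auto
  define n where "n = Polynomial.degree P"
  have "n > 0" using P by (intro Nat.gr0I) (auto simp: n_def elim!: degree_eq_zeroE)
  have "0 = (\<Sum>i\<le>n. of_int (Polynomial.coeff P i) * x ^ i)"
    using P by (simp add: poly_altdef n_def coeff_map_poly degree_map_poly)
  also have "\<dots> = (\<Sum>i<n. of_int (Polynomial.coeff P i) * x ^ i) + x ^ n"
    using P by (simp add: lessThan_Suc_atMost[symmetric] n_def)
  finally have "x ^ n = (\<Sum>i<n. of_int (- Polynomial.coeff P i) * x ^ i)"
    by (simp add: sum_negf eq_neg_iff_add_eq_0 add.commute)
  then show ?thesis by (rule that[OF \<open>n > 0\<close>])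
qed

text \<open>The companion matrix of the monic relation, acting on the first exponent: lower powers
  shift by one, the top power wraps around through the coefficients \<open>c\<close>.\<close>

lemma int_matrix_on_powers:
  fixes x y :: complex
  assumes "x ^ n = (\<Sum>i<n. of_int (c i) * x ^ i)"
  shows "\<exists>A. int_matrix_on ({..<n} \<times> {..<m}) (\<lambda>(i, j). x ^ i * y ^ j) x A"
proof
  define A where "A = (\<lambda>(i, j) (i', j'). if j' = (j::nat) then
      (if Suc i = n then c i' else if i' = Suc i then 1 else 0) else 0)"
  show "int_matrix_on ({..<n} \<times> {..<m}) (\<lambda>(i, j). x ^ i * y ^ j) x A"
    unfolding int_matrix_on_def
  proof safe
    fix i j assume ij: "i < n" "j < m"
    have "(\<Sum>l\<in>{..<n} \<times> {..<m}. of_int (A (i, j) l) * (case l of (i', j') \<Rightarrow> x ^ i' * y ^ j'))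
      = (\<Sum>i'<n. \<Sum>j'<m. of_int (A (i, j) (i', j')) * (x ^ i' * y ^ j'))"
      by (subst sum.cartesian_product) (auto intro!: sum.cong)
    also have "\<dots> = (\<Sum>i'<n. of_int (if Suc i = n then c i' else if i' = Suc i then 1 else 0) * (x ^ i' * y ^ j))"
    proof (rule sum.cong[OF refl])
      fix i' assume "i' \<in> {..<n}"
      have "(\<Sum>j'<m. of_int (A (i, j) (i', j')) * (x ^ i' * y ^ j')) =
        (\<Sum>j'<m. if j' = j then of_int (if Suc i = n then c i' else if i' = Suc i then 1 else 0) * (x ^ i' * y ^ j) else 0)"
        by (rule sum.cong) (auto simp: A_def)
      then show "(\<Sum>j'<m. of_int (A (i, j) (i', j')) * (x ^ i' * y ^ j')) =
        of_int (if Suc i = n then c i' else if i' = Suc i then 1 else 0) * (x ^ i' * y ^ j)"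
        using ij by (simp add: sum.delta)
    qed
    also have "\<dots> = x * (x ^ i * y ^ j)"
    proof (cases "Suc i = n")
      case True
      then have "x * (x ^ i * y ^ j) = x ^ n * y ^ j" by auto
      also have "\<dots> = (\<Sum>i'<n. of_int (c i') * (x ^ i' * y ^ j))"
        unfolding assms sum_distrib_right by (simp add: mult.assoc)
      finally show ?thesis using True by simp
    next
      case False
      have "(\<Sum>i'<n. of_int (if Suc i = n then c i' else if i' = Suc i then 1 else 0) * (x ^ i' * y ^ j))
        = (\<Sum>i'<n. if i' = Suc i then x ^ Suc i * y ^ j else 0)"
        using False by (intro sum.cong) auto
      then show ?thesis using False ij by (simp add: sum.delta)
    qed
    finally show "x * (x ^ i * y ^ j) = (\<Sum>l\<in>{..<n} \<times> {..<m}. of_int (A (i, j) l) * (case l of (i', j') \<Rightarrow> x ^ i' * y ^ j'))"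
      by simp
  qed
qed

text \<open>The monomials in \<open>x\<close> and \<open>y\<close> below the two degrees span a
  group stable under both multiplications, so the sum and the product act on it by integer matrices
  as well.\<close>

lemma algebraic_int_add_mult:
  fixes x y :: complex
  assumes "algebraic_int x" "algebraic_int y"
  shows "algebraic_int (x + y) \<and> algebraic_int (x * y)"
proof -
  obtain n c where n: "n > 0" "x ^ n = (\<Sum>i<n. of_int (c i) * x ^ i)"
    using algebraic_int_power_relation[OF assms(1)] .
  obtain m d where m: "m > 0" "y ^ m = (\<Sum>i<m. of_int (d i) * y ^ i)"
    using algebraic_int_power_relation[OF assms(2)] .
  define I where "I = {..<n} \<times> {..<m}"
  define b where "b = (\<lambda>(i, j). x ^ i * y ^ j)"
  obtain A where A: "int_matrix_on I b x A"
    using int_matrix_on_powers[OF n(2)] unfolding I_def b_def by blast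
  obtain B' where B': "int_matrix_on ({..<m} \<times> {..<n}) (\<lambda>(i, j). y ^ i * x ^ j) y B'"
    using int_matrix_on_powers[OF m(2)] by blast
  \<comment> \<open>Exchanging the two exponents turns the companion matrix of \<open>y\<close> into
    a matrix for the same family \<open>b\<close>.\<close>
  have "int_matrix_on I b y (\<lambda>i j. B' (prod.swap i) (prod.swap j))"
    unfolding int_matrix_on_def
  proof
    fix i assume "i \<in> I"
    then have "prod.swap i \<in> {..<m} \<times> {..<n}" by (auto simp: I_def)
    then have "y * (\<lambda>(i, j). y ^ i * x ^ j) (prod.swap i) =
        (\<Sum>l\<in>{..<m} \<times> {..<n}. of_int (B' (prod.swap i) l) * (\<lambda>(i, j). y ^ i * x ^ j) l)"
      by (rule bspec[OF B'[unfolded int_matrix_on_def]])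
    also have "\<dots> = (\<Sum>j\<in>I. of_int (B' (prod.swap i) (prod.swap j)) * (\<lambda>(i, j). y ^ i * x ^ j) (prod.swap j))"
      by (rule sum.reindex_bij_betw[symmetric], rule bij_betwI[of _ _ _ prod.swap]) (auto simp: I_def)
    also have swap: "(\<lambda>l. (\<lambda>(i, j). y ^ i * x ^ j) (prod.swap l)) = b"
      by (auto simp: b_def fun_eq_iff mult.commute)
    finally show "y * b i = (\<Sum>j\<in>I. of_int (B' (prod.swap i) (prod.swap j)) * b j)"
      unfolding fun_cong[OF swap] .
  qed
  note AB = A this
  have I: "finite I" "(0, 0) \<in> I" "b (0, 0) \<noteq> 0" using n m by (auto simp: I_def b_def)
  have *: "algebraic_int z" if "int_matrix_on I b z C" for z C
    by (rule algebraic_int_of_eigenvector'[OF I(1) bspec[OF that[unfolded int_matrix_on_def]] I(2,3)])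
  show ?thesis
    using *[OF int_matrix_on_add[OF AB]] *[OF int_matrix_on_mult[OF AB]] by simp
qed

lemma algebraic_int_plus: "algebraic_int x \<Longrightarrow> algebraic_int y \<Longrightarrow> algebraic_int (x + y)"
  and algebraic_int_times: "algebraic_int x \<Longrightarrow> algebraic_int y \<Longrightarrow> algebraic_int (x * y)" for x y :: complex
  using algebraic_int_add_mult by blast+

lemma algebraic_int_diff: "algebraic_int x \<Longrightarrow> algebraic_int y \<Longrightarrow> algebraic_int (x - y)" for x y :: complex
  using algebraic_int_plus[of x "- y"] by simp

text \<open>A root of X^2 = a with \<open>a\<close> integral is integral. Throughout, square roots
  of units and of quotients of ideals are recognized as integral in this way.\<close>

lemma algebraic_int_power2_iff [simp]: "algebraic_int (x\<^sup>2) \<longleftrightarrow> algebraic_int x" for x :: complex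
proof
  assume "algebraic_int (x\<^sup>2)"
  then show "algebraic_int x"
    by (rule algebraic_int_root[where p = "Polynomial.monom 1 2"])
       (auto simp: poly_monom Polynomial.degree_monom_eq)
qed (simp add: power2_eq_square algebraic_int_times)

section \<open>Quadratic extensions of subfields of the complex numbers\<close>

locale complex_subfield =
  fixes F :: "complex set"
  assumes one [simp]: "1 \<in> F"
    and add [simp]: "a \<in> F \<Longrightarrow> b \<in> F \<Longrightarrow> a + b \<in> F"
    and minus [simp]: "a \<in> F \<Longrightarrow> - a \<in> F"
    and mult [simp]: "a \<in> F \<Longrightarrow> b \<in> F \<Longrightarrow> a * b \<in> F"
    and inverse [simp]: "a \<in> F \<Longrightarrow> inverse a \<in> F"
begin

lemma zero [simp]: "0 \<in> F"
  using add[OF one minus[OF one]] by simp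

lemma diff [simp]: "a \<in> F \<Longrightarrow> b \<in> F \<Longrightarrow> a - b \<in> F"
  using add[OF _ minus, of a b] by simp

lemma divide [simp]: "a \<in> F \<Longrightarrow> b \<in> F \<Longrightarrow> a / b \<in> F"
  by (simp add: divide_inverse)

lemma power [simp]: "a \<in> F \<Longrightarrow> a ^ n \<in> F"
  by (induction n) auto

lemma of_nat [simp]: "of_nat n \<in> F"
  by (induction n) auto

lemma of_int [simp]: "of_int n \<in> F"
  by (cases n) auto

lemma numeral [simp]: "numeral n \<in> F"
  using of_nat[of "numeral n"] by (simp del: of_nat)

lemma Rats_subset: "\<rat> \<subseteq> F"
proof
  fix x :: complex assume "x \<in> \<rat>"
  then obtain a b :: int where "x = of_int a / of_int b" by (auto elim!: Rats_cases')
  then show "x \<in> F" by simp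
qed

lemma of_rat [simp]: "of_rat r \<in> F"
  using Rats_subset by auto

end

lemma complex_subfield_Rats: "complex_subfield \<rat>"
  by unfold_locales auto

definition quad_ext :: "complex set \<Rightarrow> complex \<Rightarrow> complex set"
  where "quad_ext F s = {a + b * s | a b. a \<in> F \<and> b \<in> F}"

text \<open>The field is a set and not a type, so conjugation is a total function on the complex
  numbers, read off from coordinates. It is meaningful on \<open>quad_ext F s\<close> when
  \<open>s \<notin> F\<close>, which makes the coordinates unique.\<close>

definition quad_conj :: "complex set \<Rightarrow> complex \<Rightarrow> complex \<Rightarrow> complex"
  where "quad_conj F s z = (THE w. \<exists>a\<in>F. \<exists>b\<in>F. z = a + b * s \<and> w = a - b * s)"

lemma quad_extI: "a \<in> F \<Longrightarrow> b \<in> F \<Longrightarrow> a + b * s \<in> quad_ext F s"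
  by (auto simp: quad_ext_def)

lemma quad_extE:
  assumes "z \<in> quad_ext F s"
  obtains a b where "a \<in> F" "b \<in> F" "z = a + b * s"
  using assms by (auto simp: quad_ext_def)

locale quadratic_extension = complex_subfield F for F :: "complex set" +
  fixes s :: complex
  assumes notin: "s \<notin> F" and square [simp]: "s * s \<in> F"
begin

abbreviation conj :: "complex \<Rightarrow> complex" where "conj \<equiv> quad_conj F s"

abbreviation L :: "complex set" where "L \<equiv> quad_ext F s"

lemma square2 [simp]: "s\<^sup>2 \<in> F"
  by (simp add: power2_eq_square)

lemma coord_unique:
  assumes "a + b * s = a' + b' * s" "a \<in> F" "b \<in> F" "a' \<in> F" "b' \<in> F"
  shows "a = a'" "b = b'"
proof -
  have *: "(b - b') * s = a' - a" using assms(1) by (simp add: algebra_simps)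
  show "b = b'"
  proof (rule ccontr)
    assume "b \<noteq> b'"
    then have "s = (a' - a) / (b - b')" using * by (simp add: field_simps)
    then show False using notin assms by auto
  qed
  then show "a = a'" using assms(1) by simp
qed

lemma conj_eq [simp]:
  assumes "a \<in> F" "b \<in> F"
  shows "conj (a + b * s) = a - b * s"
  unfolding quad_conj_def
  by (rule the_equality) (use assms coord_unique[of a b] in blast)+

lemma base_subset: "F \<subseteq> L"
  using quad_extI[OF _ zero] by auto

lemma base_in [simp]: "a \<in> F \<Longrightarrow> a \<in> L"
  using base_subset by auto

lemma gen_in [simp]: "s \<in> L"
  using quad_extI[of 0 F 1 s] by simp

lemma conj_base [simp]: "a \<in> F \<Longrightarrow> conj a = a"
  using conj_eq[of a 0] by simp

lemma conj_gen [simp]: "conj s = - s"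
  using conj_eq[of 0 1] by simp

lemma conj_in [simp]: "z \<in> L \<Longrightarrow> conj z \<in> L"
  by (elim quad_extE) (use quad_extI[of _ F "- _" s] in auto)

lemma conj_conj [simp]:
  assumes "z \<in> L" shows "conj (conj z) = z"
proof -
  obtain a b where ab: "a \<in> F" "b \<in> F" "z = a + b * s" using quad_extE[OF assms] .
  then show ?thesis using conj_eq[of a "- b"] by simp
qed

lemma add_form: "(a + b * s) + (c + d * s) = (a + c) + (b + d) * s"
  and mult_form: "(a + b * s) * (c + d * s) = (a * c + b * d * s\<^sup>2) + (a * d + b * c) * s"
  by (simp_all add: algebra_simps power2_eq_square)

lemma L_subfield: "complex_subfield L"
proof
  show "1 \<in> L" by simp
next
  fix x y assume "x \<in> L" "y \<in> L"
  then show "x + y \<in> L" "x * y \<in> L"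
    by (auto elim!: quad_extE simp only: add_form mult_form intro!: quad_extI) auto
next
  fix x assume "x \<in> L"
  then obtain a b where ab: "a \<in> F" "b \<in> F" "x = a + b * s" using quad_extE by metis
  then show "- x \<in> L" using quad_extI[of "-a" F "-b" s] by simp
  show "inverse x \<in> L"
  proof (cases "x = 0")
    case False
    \<comment> \<open>Rationalize by the conjugate \<open>a - b * s\<close>, which vanishes only if
      both coordinates do.\<close>
    define N where "N = a\<^sup>2 - b\<^sup>2 * s\<^sup>2"
    have nz: "a - b * s \<noteq> 0"
    proof
      assume "a - b * s = 0"
      then have "a + (- b) * s = 0 + 0 * s" by simp
      then show False using coord_unique[of a "- b" 0 0] ab False by simp
    qed
    have N: "N = x * (a - b * s)"
      by (simp add: N_def ab(3) power2_eq_square algebra_simps)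
    have "inverse x = (a - b * s) / N"
      using False nz by (simp add: N divide_simps)
    then have "inverse x = a / N + (- b / N) * s"
      by (simp add: diff_divide_distrib)
    moreover have "N \<in> F" using ab by (simp add: N_def)
    ultimately show ?thesis using ab quad_extI[of "a / N" F "- b / N" s] by simp
  qed simp
qed

sublocale ext: complex_subfield L by (rule L_subfield)

lemma conj_add [simp]:
  assumes "x \<in> L" "y \<in> L" shows "conj (x + y) = conj x + conj y"
proof -
  obtain a b where ab: "a \<in> F" "b \<in> F" "x = a + b * s" using quad_extE[OF assms(1)] .
  obtain c d where cd: "c \<in> F" "d \<in> F" "y = c + d * s" using quad_extE[OF assms(2)] .
  show ?thesis using ab cd by (simp only: add_form conj_eq add) (simp add: algebra_simps)
qed

lemma conj_mult [simp]:
  assumes "x \<in> L" "y \<in> L" shows "conj (x * y) = conj x * conj y"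
proof -
  obtain a b where ab: "a \<in> F" "b \<in> F" "x = a + b * s" using quad_extE[OF assms(1)] .
  obtain c d where cd: "c \<in> F" "d \<in> F" "y = c + d * s" using quad_extE[OF assms(2)] .
  show ?thesis using ab cd by (simp only: mult_form conj_eq add mult square2)
      (simp add: algebra_simps power2_eq_square)
qed

lemma conj_minus [simp]: "x \<in> L \<Longrightarrow> conj (- x) = - conj x"
  using conj_mult[of "-1" x] by simp

lemma conj_diff [simp]: "x \<in> L \<Longrightarrow> y \<in> L \<Longrightarrow> conj (x - y) = conj x - conj y"
  using conj_add[of x "- y"] by simp

lemma conj_power [simp]: "x \<in> L \<Longrightarrow> conj (x ^ n) = conj x ^ n"
  by (induction n) auto

lemma conj_eq_0_iff [simp]: "x \<in> L \<Longrightarrow> conj x = 0 \<longleftrightarrow> x = 0"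
  by (metis conj_base conj_conj zero)

lemma conj_inverse [simp]:
  assumes "x \<in> L" shows "conj (inverse x) = inverse (conj x)"
proof (cases "x = 0")
  case False
  then have "conj (x * inverse x) = 1" by simp
  then have "conj x * conj (inverse x) = 1" using assms by (subst (asm) conj_mult) auto
  then show ?thesis using inverse_unique by metis
qed simp

lemma conj_divide [simp]: "x \<in> L \<Longrightarrow> y \<in> L \<Longrightarrow> conj (x / y) = conj x / conj y"
  by (simp add: divide_inverse)

lemma conj_fixed:
  assumes "x \<in> L" "conj x = x" shows "x \<in> F"
proof -
  obtain a b where ab: "a \<in> F" "b \<in> F" "x = a + b * s" using quad_extE[OF assms(1)] .
  then have "a + b * s = a + (- b) * s" using assms(2) by simp
  then have "b = - b" using coord_unique[of a b a "- b"] ab by simp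
  then show ?thesis using ab by simp
qed

lemma trace_in: "x \<in> L \<Longrightarrow> x + conj x \<in> F"
  by (rule conj_fixed) (auto simp: add.commute)

lemma norm_in: "x \<in> L \<Longrightarrow> x * conj x \<in> F"
  by (rule conj_fixed) (auto simp: mult.commute)

lemma conj_sum: "(\<And>i. i \<in> A \<Longrightarrow> f i \<in> L) \<Longrightarrow> (\<Sum>i\<in>A. f i) \<in> L \<and> conj (\<Sum>i\<in>A. f i) = (\<Sum>i\<in>A. conj (f i))"
  by (induction A rule: infinite_finite_induct) auto

text \<open>Conjugation is a ring homomorphism on \<open>L\<close> fixing the integers, so it sends
  a root of a monic integer polynomial to a root of the same polynomial.\<close>

lemma algebraic_int_conj:
  assumes "x \<in> L" "algebraic_int x" shows "algebraic_int (conj x)"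
proof -
  obtain P :: "int poly" where P: "poly (map_poly of_int P) x = 0" "lead_coeff P = 1"
    using assms unfolding algebraic_int_altdef_ipoly by auto
  have eval: "poly (map_poly of_int P) z = (\<Sum>i\<le>Polynomial.degree P. of_int (Polynomial.coeff P i) * z ^ i)" for z :: complex
    by (simp add: poly_altdef coeff_map_poly degree_map_poly)
  have "conj (\<Sum>i\<le>Polynomial.degree P. of_int (Polynomial.coeff P i) * x ^ i) = (\<Sum>i\<le>Polynomial.degree P. conj (of_int (Polynomial.coeff P i) * x ^ i))"
    using assms(1) by (intro conj_sum[THEN conjunct2]) auto
  also have "\<dots> = (\<Sum>i\<le>Polynomial.degree P. of_int (Polynomial.coeff P i) * conj x ^ i)"
    using assms(1) by (intro sum.cong refl) simp
  finally have "poly (map_poly of_int P) (conj x) = 0" using P(1) by (simp add: eval)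
  then show ?thesis using P(2) unfolding algebraic_int_altdef_ipoly by auto
qed

end

section \<open>Fields generated by a set of complex numbers\<close>

lemma ring_of_type_algebra_simps [simp]:
  "carrier (ring_of_type_algebra :: 'a::field ring) = UNIV"
  "\<one>\<^bsub>ring_of_type_algebra\<^esub> = (1 :: 'a)" "\<zero>\<^bsub>ring_of_type_algebra\<^esub> = (0 :: 'a)"
  "x \<otimes>\<^bsub>ring_of_type_algebra\<^esub> y = x * (y :: 'a)" "x \<oplus>\<^bsub>ring_of_type_algebra\<^esub> y = x + (y :: 'a)"
  by (simp_all add: ring_of_type_algebra_def)

lemma a_inv_type_algebra [simp]: "\<ominus>\<^bsub>ring_of_type_algebra\<^esub> x = - (x :: 'a::field)"
proof -
  interpret field "ring_of_type_algebra :: 'a ring" by (rule field_from_type_algebra)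
  show ?thesis using minus_equality[of "- x" x] by simp
qed

lemma m_inv_type_algebra [simp]: "x \<noteq> 0 \<Longrightarrow> inv\<^bsub>ring_of_type_algebra\<^esub> x = inverse (x :: 'a::field)"
proof -
  interpret field "ring_of_type_algebra :: 'a ring" by (rule field_from_type_algebra)
  show "x \<noteq> 0 \<Longrightarrow> ?thesis" using comm_inv_char[of x "inverse x"] by simp
qed

lemma adjoin_subfield: "complex_subfield (adjoin S)"
proof
  show "1 \<in> adjoin S" using generate_field.one[of ring_of_type_algebra S] by (simp add: adjoin_def)
next
  fix a b assume "a \<in> adjoin S" "b \<in> adjoin S"
  then show "a + b \<in> adjoin S" "a * b \<in> adjoin S"
    using generate_field.eng_add[of a ring_of_type_algebra S b] generate_field.eng_mult[of a ring_of_type_algebra S b]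
    by (simp_all add: adjoin_def)
next
  fix a assume a: "a \<in> adjoin S"
  then show uminus: "- a \<in> adjoin S"
    using generate_field.a_inv[of a ring_of_type_algebra S] by (simp add: adjoin_def)
  show "inverse a \<in> adjoin S"
    using a generate_field.m_inv[of a ring_of_type_algebra S] by (cases "a = 0") (simp_all add: adjoin_def)
qed

lemma adjoin_incl: "S \<subseteq> adjoin S"
  by (auto simp: adjoin_def intro: generate_field.incl)

lemma adjoin_minimal:
  assumes "complex_subfield E" "S \<subseteq> E" shows "adjoin S \<subseteq> E"
proof
  interpret complex_subfield E by fact
  fix x assume "x \<in> adjoin S"
  then show "x \<in> E" unfolding adjoin_def
    by (induction rule: generate_field.induct) (use assms(2) in auto)
qed

lemma adjoin_eqI:
  assumes "complex_subfield E" "S \<subseteq> E" "\<And>E'. complex_subfield E' \<Longrightarrow> S \<subseteq> E' \<Longrightarrow> E \<subseteq> E'"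
  shows "adjoin S = E"
  using adjoin_minimal[OF assms(1,2)] assms(3)[OF adjoin_subfield adjoin_incl] by auto

section \<open>Gaussian integers\<close>

definition gauss_rat :: "complex set"
  where "gauss_rat = quad_ext \<rat> \<i>"

definition gauss_int :: "complex set"
  where "gauss_int = {of_int a + of_int b * \<i> | a b. True}"

text \<open>Only the quotient is required to lie in Z[i]; that the operands are Gaussian integers is
  tracked by separate hypotheses.\<close>

definition gdvd :: "complex \<Rightarrow> complex \<Rightarrow> bool" (infix "gdvd" 50)
  where "a gdvd b \<longleftrightarrow> (\<exists>c\<in>gauss_int. b = a * c)"

definition gprime :: "complex \<Rightarrow> bool"
  where "gprime \<pi> \<longleftrightarrow> \<pi> \<in> gauss_int \<and> \<pi> \<noteq> 0 \<and> \<not> \<pi> gdvd 1 \<and>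
    (\<forall>a\<in>gauss_int. \<forall>b\<in>gauss_int. \<pi> gdvd a * b \<longrightarrow> \<pi> gdvd a \<or> \<pi> gdvd b)"

text \<open>Natural values permit choices of minimal norm and divisibility by rational primes; on
  Z[i] the floor is exact.\<close>

definition gnorm :: "complex \<Rightarrow> nat"
  where "gnorm z = nat \<lfloor>(cmod z)\<^sup>2\<rfloor>"

lemma of_rat_in_Reals: "(of_rat r :: complex) \<in> \<real>"
proof -
  obtain a b :: int where "(of_rat r :: complex) = of_int a / of_int b"
    using Rats_cases'[OF Rats_of_rat[of r]] by metis
  then show ?thesis by simp
qed

lemma cnj_of_rat [simp]: "cnj (of_rat r) = of_rat r"
  using of_rat_in_Reals by (simp add: Reals_cnj_iff)

interpretation qi: quadratic_extension \<rat> \<i>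
proof -
  interpret complex_subfield \<rat> by (rule complex_subfield_Rats)
  show "quadratic_extension \<rat> \<i>"
  proof
    show "\<i> \<notin> \<rat>" using of_rat_in_Reals by (metis Rats_cases complex_is_Real_iff imaginary_unit.sel(2) zero_neq_one)
  qed auto
qed

interpretation gq: complex_subfield gauss_rat
  unfolding gauss_rat_def by (rule qi.L_subfield)

lemma imaginary_in_gauss_rat [simp]: "\<i> \<in> gauss_rat"
  by (simp add: gauss_rat_def)

lemma gauss_intI: "of_int a + of_int b * \<i> \<in> gauss_int"
  by (auto simp: gauss_int_def)

lemma gauss_intE:
  assumes "z \<in> gauss_int" obtains a b where "z = of_int a + of_int b * \<i>"
  using assms by (auto simp: gauss_int_def)

lemma gauss_int_iff: "z \<in> gauss_int \<longleftrightarrow> Re z \<in> \<int> \<and> Im z \<in> \<int>"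
proof
  assume "Re z \<in> \<int> \<and> Im z \<in> \<int>"
  then obtain a b where "Re z = of_int a" "Im z = of_int b" by (auto elim!: Ints_cases)
  then have "z = of_int a + of_int b * \<i>" by (simp add: complex_eq_iff)
  then show "z \<in> gauss_int" by (auto simp: gauss_int_def)
qed (auto elim!: gauss_intE)

lemma gauss_int_simps [simp]:
  "0 \<in> gauss_int" "1 \<in> gauss_int" "\<i> \<in> gauss_int" "of_nat n \<in> gauss_int" "of_int k \<in> gauss_int"
  "numeral m \<in> gauss_int"
  "a \<in> gauss_int \<Longrightarrow> b \<in> gauss_int \<Longrightarrow> a + b \<in> gauss_int"
  "a \<in> gauss_int \<Longrightarrow> b \<in> gauss_int \<Longrightarrow> a - b \<in> gauss_int"
  "a \<in> gauss_int \<Longrightarrow> b \<in> gauss_int \<Longrightarrow> a * b \<in> gauss_int"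
  "a \<in> gauss_int \<Longrightarrow> - a \<in> gauss_int"
  "a \<in> gauss_int \<Longrightarrow> cnj a \<in> gauss_int"
  by (auto simp: gauss_int_iff)

lemma gauss_int_power [simp]: "a \<in> gauss_int \<Longrightarrow> a ^ n \<in> gauss_int"
  by (induction n) auto


lemma gauss_int_in_rat [simp]: "z \<in> gauss_int \<Longrightarrow> z \<in> gauss_rat"
  by (auto elim!: gauss_intE)

lemma gauss_ratE:
  assumes "z \<in> gauss_rat"
  obtains a b :: rat where "z = of_rat a + of_rat b * \<i>"
  using assms by (auto simp: gauss_rat_def quad_ext_def Rats_def)

lemma algebraic_int_gauss_int [simp]: "z \<in> gauss_int \<Longrightarrow> algebraic_int z"
  by (auto elim!: gauss_intE intro!: algebraic_int_plus algebraic_int_times)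

text \<open>Sum and difference with the conjugate show that the doubled coordinates are rational
  algebraic integers. The norm makes the sum of their squares divisible by 4, so both are
  even.\<close>

lemma gauss_intI_integral:
  assumes "z \<in> gauss_rat" "algebraic_int z"
  shows "z \<in> gauss_int"
proof -
  obtain a b where z: "z = of_rat a + of_rat b * \<i>" using assms(1) by (rule gauss_ratE)
  have cz: "cnj z = of_rat a - of_rat b * \<i>" using z by simp
  have "algebraic_int (z + cnj z)" "algebraic_int ((z - cnj z) * - \<i>)" "algebraic_int (z * cnj z)"
    using assms(2) by (auto intro!: algebraic_int_plus algebraic_int_times algebraic_int_diff)
  moreover have "z + cnj z = of_rat (2 * a)" "(z - cnj z) * - \<i> = of_rat (2 * b)"
    "z * cnj z = of_rat (a\<^sup>2 + b\<^sup>2)"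
    unfolding cz unfolding z by (simp_all add: of_rat_mult of_rat_add power2_eq_square algebra_simps)
  ultimately have "of_rat (2 * a) \<in> (\<int> :: complex set)" "of_rat (2 * b) \<in> (\<int> :: complex set)"
     "of_rat (a\<^sup>2 + b\<^sup>2) \<in> (\<int> :: complex set)"
    by (simp_all only: rational_algebraic_int_is_int[OF _ Rats_of_rat])
  then obtain A B C where "of_rat (2 * a) = (of_int A :: complex)" "of_rat (2 * b) = (of_int B :: complex)"
     "of_rat (a\<^sup>2 + b\<^sup>2) = (of_int C :: complex)"
    by (auto elim!: Ints_cases)
  then have AB: "2 * a = of_int A" "2 * b = of_int B" "a\<^sup>2 + b\<^sup>2 = of_int C"
    by (simp_all only: of_rat_of_int_eq[symmetric, where 'a = complex] of_rat_eq_iff)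
  have "of_int (A\<^sup>2 + B\<^sup>2) = (of_int (4 * C) :: rat)"
    using AB(3) by (simp add: AB(1,2)[symmetric] power2_eq_square algebra_simps)
  then have "A\<^sup>2 + B\<^sup>2 = 4 * C" by (simp only: of_int_eq_iff)
  then have sum4: "4 dvd A\<^sup>2 + B\<^sup>2" by simp
  have "even A \<longleftrightarrow> even B"
    using dvd_trans[OF _ sum4, of 2] by (simp add: even_add)
  moreover have "\<not> (odd A \<and> odd B)"
  proof
    assume "odd A \<and> odd B"
    then obtain i j where "A = 2 * i + 1" "B = 2 * j + 1" by (auto elim!: oddE)
    then have "A\<^sup>2 + B\<^sup>2 = 4 * (i * i + i + j * j + j) + 2" by (simp add: power2_eq_square algebra_simps)
    then show False using sum4 by presburger
  qed
  ultimately have "even A \<and> even B" by blast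
  then obtain i j where "A = 2 * i" "B = 2 * j" by (auto elim!: evenE)
  then have "a = of_int i" "b = of_int j" using AB by simp_all
  then show ?thesis using z by (auto simp: gauss_int_def)
qed

lemma gnorm_real: "z \<in> gauss_int \<Longrightarrow> real (gnorm z) = (cmod z)\<^sup>2"
proof (elim gauss_intE)
  fix a b assume z: "z = of_int a + of_int b * \<i>"
  have "(cmod z)\<^sup>2 = of_int (a\<^sup>2 + b\<^sup>2)" unfolding cmod_power2 z by simp
  then show ?thesis by (simp add: gnorm_def)
qed

lemma gnorm_of_int_pair: "gnorm (of_int a + of_int b * \<i>) = nat (a\<^sup>2 + b\<^sup>2)"
proof -
  have "(cmod (of_int a + of_int b * \<i>))\<^sup>2 = of_int (a\<^sup>2 + b\<^sup>2)" unfolding cmod_power2 by simp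
  then show ?thesis by (simp only: gnorm_def floor_of_int)
qed

lemma gnorm_mult: "a \<in> gauss_int \<Longrightarrow> b \<in> gauss_int \<Longrightarrow> gnorm (a * b) = gnorm a * gnorm b"
proof -
  assume "a \<in> gauss_int" "b \<in> gauss_int"
  then have "real (gnorm (a * b)) = real (gnorm a * gnorm b)"
    by (simp add: gnorm_real norm_mult power_mult_distrib)
  then show ?thesis by (simp only: of_nat_eq_iff)
qed

lemma gnorm_eq_0_iff: "a \<in> gauss_int \<Longrightarrow> gnorm a = 0 \<longleftrightarrow> a = 0"
  by (metis gnorm_real norm_eq_zero of_nat_0 of_nat_eq_iff zero_eq_power2)

lemma of_nat_gnorm: "a \<in> gauss_int \<Longrightarrow> of_nat (gnorm a) = a * cnj a"
  using gnorm_real[of a] by (metis complex_norm_square of_real_of_nat_eq)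

lemma gnorm_1 [simp]: "gnorm 1 = 1"
  by (simp add: gnorm_def)

lemma gauss_unit_iff: "a \<in> gauss_int \<Longrightarrow> a gdvd 1 \<longleftrightarrow> gnorm a = 1"
proof
  assume a: "a \<in> gauss_int" "a gdvd 1"
  then obtain c where "c \<in> gauss_int" "1 = a * c" by (auto simp: gdvd_def)
  then have "gnorm a * gnorm c = 1" using a gnorm_mult[of a c] by simp
  then show "gnorm a = 1" by simp
next
  assume "a \<in> gauss_int" "gnorm a = 1"
  then show "a gdvd 1" using of_nat_gnorm[of a] by (auto simp: gdvd_def)
qed

lemma gauss_units:
  assumes "a \<in> gauss_int" "a gdvd 1" shows "a = 1 \<or> a = -1 \<or> a = \<i> \<or> a = -\<i>"
proof -
  obtain i j where a: "a = of_int i + of_int j * \<i>" using assms(1) by (rule gauss_intE)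
  have "gnorm a = 1" using gauss_unit_iff[OF assms(1)] assms(2) by blast
  then have "nat (i\<^sup>2 + j\<^sup>2) = 1" unfolding a gnorm_of_int_pair .
  then have eq: "i\<^sup>2 + j\<^sup>2 = 1" by linarith
  have "\<bar>i\<bar> \<le> 1" "\<bar>j\<bar> \<le> 1"
    using eq zero_le_power2[of i] zero_le_power2[of j] abs_square_le_1[of i] abs_square_le_1[of j] by linarith+
  then have "i \<in> {-1, 0, 1}" "j \<in> {-1, 0, 1}" by auto
  then show ?thesis using eq a by auto
qed

lemma gdvdI: "c \<in> gauss_int \<Longrightarrow> b = a * c \<Longrightarrow> a gdvd b"
  unfolding gdvd_def by blast

lemma gdvdE:
  assumes "a gdvd b" obtains c where "c \<in> gauss_int" "b = a * c"
  using assms unfolding gdvd_def by blast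

lemma gdvd_refl [simp]: "a gdvd a"
  by (rule gdvdI[of 1]) auto

lemma gdvd_mult_right [simp]: "c \<in> gauss_int \<Longrightarrow> a gdvd b \<Longrightarrow> a gdvd b * c"
proof -
  assume c: "c \<in> gauss_int" "a gdvd b"
  then obtain e where "e \<in> gauss_int" "b = a * e" by (elim gdvdE)
  then show "a gdvd b * c" using c by (intro gdvdI[of "e * c"]) (simp_all add: mult.assoc)
qed

lemma gdvd_mult_left [simp]: "c \<in> gauss_int \<Longrightarrow> a gdvd b \<Longrightarrow> a gdvd c * b"
  using gdvd_mult_right[of c a b] by (simp add: mult.commute)

lemma gdvd_trans: "a gdvd b \<Longrightarrow> b gdvd c \<Longrightarrow> a gdvd c"
  by (elim gdvdE[of b c]) simp

lemma gdvd_self_mult [simp]: "c \<in> gauss_int \<Longrightarrow> a gdvd a * c" "c \<in> gauss_int \<Longrightarrow> a gdvd c * a"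
  by simp_all

lemma gdvd_add: "a gdvd b \<Longrightarrow> a gdvd c \<Longrightarrow> a gdvd b + c"
proof -
  assume "a gdvd b" "a gdvd c"
  then obtain e g where "e \<in> gauss_int" "b = a * e" "g \<in> gauss_int" "c = a * g" by (elim gdvdE)
  then show "a gdvd b + c" by (intro gdvdI[of "e + g"]) (simp_all add: distrib_left)
qed

lemma gdvd_minus [simp]: "a gdvd - b \<longleftrightarrow> a gdvd b"
  using gdvd_mult_left[of "-1" a b] gdvd_mult_left[of "-1" a "- b"] by auto

lemma gdvd_diff: "a gdvd b \<Longrightarrow> a gdvd c \<Longrightarrow> a gdvd b - c"
  using gdvd_add[of a b "- c"] by simp

lemma gdvd_gnorm:
  assumes "a \<in> gauss_int" "a gdvd b" shows "gnorm a dvd gnorm b"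
  using assms(2) by (rule gdvdE) (simp add: assms(1) gnorm_mult)

section \<open>Principal ideals and greatest common divisors in Z[i]\<close>

lemma gauss_int_pid:
  assumes "I \<subseteq> gauss_int" "I \<noteq> {}" "\<And>a b. a \<in> I \<Longrightarrow> b \<in> I \<Longrightarrow> a + b \<in> I"
    and "\<And>a b. a \<in> gauss_int \<Longrightarrow> b \<in> I \<Longrightarrow> a * b \<in> I"
  obtains c where "c \<in> I" "\<And>a. a \<in> I \<Longrightarrow> c gdvd a"
proof (cases "I \<subseteq> {0}")
  case True
  then show ?thesis using assms(2) by (intro that[of 0]) auto
next
  case False
  then obtain x where x: "x \<in> I \<and> x \<noteq> 0" by auto
  obtain c where c: "c \<in> I" "c \<noteq> 0" and min: "\<And>y. y \<in> I \<Longrightarrow> y \<noteq> 0 \<Longrightarrow> gnorm c \<le> gnorm y"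
    using ex_has_least_nat[of "\<lambda>x. x \<in> I \<and> x \<noteq> 0" x gnorm, OF x] by auto
  show ?thesis
  proof (rule that[OF c(1)])
    fix a assume a: "a \<in> I"
    \<comment> \<open>Euclidean division: rounding moves each coordinate of the quotient by at most
      1/2, so the remainder has smaller norm than \<open>c\<close>, which was chosen with minimal
      norm.\<close>
    define t where "t = a / c"
    define g where "g = of_int (round (Re t)) + of_int (round (Im t)) * \<i>"
    have g: "g \<in> gauss_int" by (simp add: g_def gauss_intI)
    have "\<bar>Re (t - g)\<bar> \<le> 1/2" "\<bar>Im (t - g)\<bar> \<le> 1/2"
      using of_int_round_abs_le[of "Re t"] of_int_round_abs_le[of "Im t"]
      by (simp_all add: g_def abs_minus_commute)
    then have "(Re (t - g))\<^sup>2 \<le> (1/2)\<^sup>2" "(Im (t - g))\<^sup>2 \<le> (1/2)\<^sup>2"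
      using abs_le_square_iff[of "Re (t - g)" "1/2"] abs_le_square_iff[of "Im (t - g)" "1/2"] by simp_all
    then have small: "(cmod (t - g))\<^sup>2 < 1" unfolding cmod_power2 by (simp add: power2_eq_square)
    define r where "r = a - g * c"
    have r: "r \<in> I" using assms(3)[OF a assms(4)[of "- g" c]] g c by (simp add: r_def)
    have "r = c * (t - g)" using c by (simp add: r_def t_def field_simps)
    then have "(cmod r)\<^sup>2 < (cmod c)\<^sup>2" using small c
      by (simp add: norm_mult power_mult_distrib)
    then have "gnorm r < gnorm c"
      using gnorm_real[of r] gnorm_real[of c] r c assms(1) by (metis of_nat_less_iff subsetD)
    then have "r = 0" using min[OF r] by force
    then show "c gdvd a" using g by (auto simp: gdvd_def r_def mult.commute)
  qed
qed

lemma gauss_gcd: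
  assumes "a \<in> gauss_int" "b \<in> gauss_int"
  obtains c s t where "s \<in> gauss_int" "t \<in> gauss_int" "c = s * a + t * b" "c gdvd a" "c gdvd b" "c \<in> gauss_int"
proof -
  define I where "I = {s * a + t * b | s t. s \<in> gauss_int \<and> t \<in> gauss_int}"
  have in_I: "s * a + t * b \<in> I" if "s \<in> gauss_int" "t \<in> gauss_int" for s t
    using that by (auto simp: I_def)
  have sub: "I \<subseteq> gauss_int" using assms by (auto simp: I_def)
  obtain c where c: "c \<in> I" "\<And>a. a \<in> I \<Longrightarrow> c gdvd a"
  proof (rule gauss_int_pid[of I])
    show "I \<noteq> {}" using in_I[of 0 0] by auto
    show "x + y \<in> I" if xy: "x \<in> I" "y \<in> I" for x y
    proof -
      obtain s t s' t' where "s \<in> gauss_int" "t \<in> gauss_int" "s' \<in> gauss_int" "t' \<in> gauss_int"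
        "x = s * a + t * b" "y = s' * a + t' * b" using xy by (auto simp: I_def)
      then show ?thesis using in_I[of "s + s'" "t + t'"] by (simp add: algebra_simps)
    qed
    show "x * y \<in> I" if xy: "x \<in> gauss_int" "y \<in> I" for x y
    proof -
      obtain s t where "s \<in> gauss_int" "t \<in> gauss_int" "y = s * a + t * b" using xy by (auto simp: I_def)
      then show ?thesis using xy in_I[of "x * s" "x * t"] by (simp add: algebra_simps)
    qed
  qed (use sub in auto)
  have "a \<in> I" "b \<in> I" using in_I[of 1 0] in_I[of 0 1] by simp_all
  moreover obtain s t where "s \<in> gauss_int" "t \<in> gauss_int" "c = s * a + t * b"
    using c(1) by (auto simp: I_def)
  ultimately show ?thesis using that c sub by blast
qed

section \<open>Gaussian primes and squarefree Gaussian integers\<close>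

lemma gprime_in [simp]: "gprime p \<Longrightarrow> p \<in> gauss_int"
  and gprime_nz [simp]: "gprime p \<Longrightarrow> p \<noteq> 0"
  and gprime_not_unit: "gprime p \<Longrightarrow> \<not> p gdvd 1"
  and gprime_dvd_mult: "gprime p \<Longrightarrow> a \<in> gauss_int \<Longrightarrow> b \<in> gauss_int \<Longrightarrow> p gdvd a * b \<Longrightarrow> p gdvd a \<or> p gdvd b"
  by (auto simp: gprime_def)

lemma gprime_dvd_power2: "gprime p \<Longrightarrow> a \<in> gauss_int \<Longrightarrow> p gdvd a\<^sup>2 \<Longrightarrow> p gdvd a"
  using gprime_dvd_mult[of p a a] by (auto simp: power2_eq_square)

lemma gprime_bezout:
  assumes "gprime p" "a \<in> gauss_int" "\<not> p gdvd a"
  obtains s t where "s \<in> gauss_int" "t \<in> gauss_int" "s * p + t * a = 1"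
proof -
  have p: "p \<in> gauss_int" using assms(1) by simp
  obtain c s t where c: "s \<in> gauss_int" "t \<in> gauss_int" "c = s * p + t * a" "c gdvd p" "c gdvd a" "c \<in> gauss_int"
    by (rule gauss_gcd[OF p assms(2)])
  obtain u where u: "u \<in> gauss_int" "p = c * u" using c(4) unfolding gdvd_def by blast
  have "\<not> p gdvd c" using assms(3) gdvd_trans[OF _ c(5)] by blast
  moreover have "p gdvd c * u" unfolding u(2)[symmetric] by simp
  ultimately have "p gdvd u" using gprime_dvd_mult[OF assms(1) c(6) u(1)] by blast
  then obtain v where v: "v \<in> gauss_int" "u = p * v" unfolding gdvd_def by blast
  have "p * (c * v) = c * u" unfolding v(2) by (simp add: mult_ac)
  also have "\<dots> = p * 1" using u(2) by simp
  finally have cv: "c * v = 1" using assms gprime_nz by (metis mult_left_cancel)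
  have "(v * s) * p + (v * t) * a = 1" using c(3) cv by (simp add: algebra_simps)
  then show ?thesis using that[of "v * s" "v * t"] c v by simp
qed

text \<open>Irreducible implies prime through Bezout: the greatest common divisor of
  \<open>p\<close> and \<open>a\<close> is a unit or an associate of \<open>p\<close>.\<close>

lemma gprimeI:
  assumes "p \<in> gauss_int" "p \<noteq> 0" "\<not> p gdvd 1"
    and irred: "\<And>a b. a \<in> gauss_int \<Longrightarrow> b \<in> gauss_int \<Longrightarrow> p = a * b \<Longrightarrow> a gdvd 1 \<or> b gdvd 1"
  shows "gprime p"
  unfolding gprime_def
proof (intro conjI assms ballI impI)
  fix a b assume ab: "a \<in> gauss_int" "b \<in> gauss_int" "p gdvd a * b"
  have p: "p \<in> gauss_int" using assms(1) by simp
  obtain c s t where c: "s \<in> gauss_int" "t \<in> gauss_int" "c = s * p + t * a" "c gdvd p" "c gdvd a" "c \<in> gauss_int"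
    by (rule gauss_gcd[OF p ab(1)])
  obtain u where u: "u \<in> gauss_int" "p = c * u" using c(4) unfolding gdvd_def by blast
  consider "c gdvd 1" | "u gdvd 1" using irred[OF c(6) u] by blast
  then show "p gdvd a \<or> p gdvd b"
  proof cases
    case 1
    then obtain v where v: "v \<in> gauss_int" "1 = c * v" unfolding gdvd_def by blast
    have "b = (c * v) * b" using v by simp
    also have "\<dots> = p * (v * s * b) + (a * b) * (v * t)" unfolding c(3) by (simp add: algebra_simps)
    finally have "b = p * (v * s * b) + (a * b) * (v * t)" .
    moreover have "p gdvd p * (v * s * b) + (a * b) * (v * t)"
      using ab v c by (intro gdvd_add) auto
    ultimately show ?thesis by simp
  next
    case 2
    then obtain v where v: "v \<in> gauss_int" "1 = u * v" unfolding gdvd_def by blast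
    then have "c = p * v" using u(2) by (metis mult.assoc mult.right_neutral)
    then have "p gdvd c" using v by (auto simp: gdvd_def)
    then show ?thesis using gdvd_trans[OF _ c(5)] by blast
  qed
qed

lemma gprime_of_prime_gnorm:
  assumes "p \<in> gauss_int" "Factorial_Ring.prime (gnorm p)"
  shows "gprime p"
proof (rule gprimeI)
  show "p \<noteq> 0" using assms gnorm_eq_0_iff[of p] by auto
  show "\<not> p gdvd 1" using assms gauss_unit_iff[of p] by (metis not_prime_1)
  fix a b assume "a \<in> gauss_int" "b \<in> gauss_int" "p = a * b"
  then show "a gdvd 1 \<or> b gdvd 1"
    using assms(2) prime_product[of "gnorm a" "gnorm b"] by (simp add: gauss_unit_iff gnorm_mult)
qed fact

text \<open>A proper factor would have norm \<open>q\<close>; but norms are sums of two squares, and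
  these are never 3 modulo 4.\<close>

lemma gprime_inert:
  fixes q :: nat
  assumes "Factorial_Ring.prime q" "q mod 4 = 3"
  shows "gprime (of_nat q)"
proof (rule gprimeI)
  have nq: "gnorm (of_nat q) = q * q" using gnorm_of_int_pair[of "int q" 0]
    by (simp add: power2_eq_square nat_mult_distrib)
  show "(of_nat q :: complex) \<noteq> 0" using assms by (auto simp: prime_gt_0_nat)
  show "\<not> of_nat q gdvd 1" using assms(1) nq by (simp add: gauss_unit_iff) (auto simp: prime_gt_1_nat)
  fix a b assume ab: "a \<in> gauss_int" "b \<in> gauss_int" "of_nat q = a * b"
  then have eq: "gnorm a * gnorm b = q\<^sup>2" using nq gnorm_mult[of a b] by (simp add: power2_eq_square)
  have ne: "gnorm c \<noteq> q" if "c \<in> gauss_int" for c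
  proof -
    obtain i j where c: "c = of_int i + of_int j * \<i>" using \<open>c \<in> gauss_int\<close> by (rule gauss_intE)
    have *: "x\<^sup>2 mod 4 = 0 \<or> x\<^sup>2 mod 4 = 1" for x :: int
    proof (cases "even x")
      case False
      then obtain y where "x = 2 * y + 1" by (auto elim!: oddE)
      then have "x\<^sup>2 = 1 + 4 * (y * y + y)" by (simp add: power2_eq_square algebra_simps)
      then show ?thesis by (simp only: mod_mult_self2) simp
    qed (auto elim!: evenE simp: power2_eq_square)
    show ?thesis
    proof
      assume "gnorm c = q"
      then have "int q = i\<^sup>2 + j\<^sup>2" unfolding c gnorm_of_int_pair by auto
      moreover have "int q mod 4 = 3" using assms(2) by presburger
      ultimately show False using *[of i] *[of j] by presburger
    qed
  qed
  obtain i where i: "i \<le> 2" "gnorm a = q ^ i"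
    using divides_primepow_nat[OF assms(1), of "gnorm a" 2] eq by (metis dvd_triv_left)
  moreover have "i \<noteq> 1" using ne[OF ab(1)] i by auto
  ultimately consider "i = 0" | "i = 2" by linarith
  then have "gnorm a = 1 \<or> gnorm b = 1"
  proof cases
    case 2
    moreover have "q \<noteq> 0" using assms(1) by auto
    ultimately show ?thesis using eq i by simp
  qed (use i in simp)
  then show "a gdvd 1 \<or> b gdvd 1" using ab by (simp add: gauss_unit_iff)
qed simp

text \<open>A non-unit divisor of least norm cannot split further.\<close>

lemma gprime_factor_exists:
  assumes "c \<in> gauss_int" "c \<noteq> 0" "\<not> c gdvd 1"
  obtains p where "gprime p" "p gdvd c"
proof -
  let ?P = "\<lambda>x. x \<in> gauss_int \<and> \<not> x gdvd 1 \<and> x gdvd c"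
  obtain p where p: "?P p" "\<And>y. ?P y \<Longrightarrow> gnorm p \<le> gnorm y"
    using ex_has_least_nat[of ?P c gnorm] assms by auto
  have p0: "p \<noteq> 0" using p(1) assms(2) by (auto simp: gdvd_def)
  have "gprime p"
  proof (rule gprimeI)
    fix a b assume ab: "a \<in> gauss_int" "b \<in> gauss_int" "p = a * b"
    have "a gdvd c" using p(1) ab gdvd_trans[of a p c] gdvd_self_mult(1)[of b a] by blast
    show "a gdvd 1 \<or> b gdvd 1"
    proof (rule ccontr)
      assume *: "\<not> ?thesis"
      then have "gnorm a * gnorm b \<le> gnorm a" using p(2)[of a] ab \<open>a gdvd c\<close> by (simp add: gnorm_mult)
      moreover have "gnorm a > 0" using ab p0 gnorm_eq_0_iff[of a] by auto
      moreover have "gnorm b > 0" using ab p0 gnorm_eq_0_iff[of b] by auto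
      ultimately have "gnorm b = 1" by simp
      then show False using * ab gauss_unit_iff by blast
    qed
  qed (use p p0 in auto)
  then show ?thesis using that p by blast
qed

lemma gprime_associated:
  assumes "gprime p" "gprime q" "p gdvd q"
  obtains u where "u \<in> gauss_int" "u gdvd 1" "q = p * u"
proof -
  obtain u where u: "u \<in> gauss_int" "q = p * u" using assms(3) by (rule gdvdE)
  have "q gdvd p * u" unfolding u(2)[symmetric] by simp
  then have "q gdvd u \<or> q gdvd p"
    using gprime_dvd_mult[OF assms(2) gprime_in[OF assms(1)] u(1)] by blast
  moreover have "\<not> q gdvd u"
  proof
    assume "q gdvd u"
    then obtain v where v: "v \<in> gauss_int" "u = q * v" by (rule gdvdE)
    have "q * (p * v) = p * u" unfolding v(2) by (simp add: mult_ac)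
    also have "\<dots> = q * 1" using u(2) by simp
    finally have "1 = p * v" using gprime_nz[OF assms(2)] by (metis mult_left_cancel)
    then show False using v(1) gprime_not_unit[OF assms(1)] gdvdI by blast
  qed
  ultimately have "q gdvd p" by blast
  then obtain v where v: "v \<in> gauss_int" "p = q * v" by (rule gdvdE)
  have "q * (u * v) = p * u" unfolding v(2) by (simp add: mult_ac)
  also have "\<dots> = q * 1" using u(2) by simp
  finally have "1 = u * v" using gprime_nz[OF assms(2)] by (metis mult_left_cancel)
  then show ?thesis using that[OF u(1) gdvdI[OF v(1)] u(2)] by blast
qed

text \<open>Squarefreeness encoded as radicality of the ideal (r), the form in which it is
  applied.\<close>

definition gsquarefree :: "complex \<Rightarrow> bool"
  where "gsquarefree r \<longleftrightarrow> r \<in> gauss_int \<and> r \<noteq> 0 \<and> (\<forall>x\<in>gauss_int. r gdvd x\<^sup>2 \<longrightarrow> r gdvd x)"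

lemma gsquarefree_prime: "gprime p \<Longrightarrow> gsquarefree p"
  unfolding gsquarefree_def by (blast intro: gprime_dvd_power2 gprime_in dest: gprime_nz)

lemma gsquarefree_mult:
  assumes "gprime p" "gsquarefree r" "\<not> p gdvd r"
  shows "gsquarefree (p * r)"
  unfolding gsquarefree_def
proof (intro conjI ballI impI)
  fix x assume x: "x \<in> gauss_int" "p * r gdvd x\<^sup>2"
  have r: "r \<in> gauss_int" using assms(2) by (simp add: gsquarefree_def)
  have "r gdvd p * r" "p gdvd p * r" using r assms(1) by auto
  then have "r gdvd x\<^sup>2" "p gdvd x\<^sup>2" using x(2) gdvd_trans by blast+
  then have "r gdvd x" "p gdvd x" using x assms gprime_dvd_power2[OF assms(1), of x] by (auto simp: gsquarefree_def)
  then obtain y where y: "y \<in> gauss_int" "x = r * y" by (auto simp: gdvd_def)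
  then have "p gdvd y" using gprime_dvd_mult[OF assms(1) r, of y] assms(3) \<open>p gdvd x\<close> by auto
  then show "p * r gdvd x" using y by (auto simp: gdvd_def mult_ac)
qed (use assms in \<open>auto simp: gsquarefree_def\<close>)

text \<open>\<open>b * r\<close> is integral because its square is \<open>r\<close> times a Gaussian
  integer; radicality then cancels \<open>r\<close>.\<close>

lemma gsquarefree_coeff:
  assumes "gsquarefree r" "b \<in> gauss_rat" "b\<^sup>2 * r \<in> gauss_int"
  shows "b \<in> gauss_int"
proof -
  have r: "r \<in> gauss_int" "r \<noteq> 0" using assms(1) by (auto simp: gsquarefree_def)
  have eq: "(b * r)\<^sup>2 = r * (b\<^sup>2 * r)" by (simp add: power2_eq_square)
  then have "algebraic_int ((b * r)\<^sup>2)" using assms r by (metis algebraic_int_gauss_int gauss_int_simps(9))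
  then have br: "b * r \<in> gauss_int" using assms r by (intro gauss_intI_integral) auto
  have "r gdvd (b * r)\<^sup>2" using eq assms(3) by (auto simp: gdvd_def)
  then have "r gdvd b * r" using assms(1) br by (auto simp: gsquarefree_def)
  then show ?thesis using r by (auto simp: gdvd_def)
qed

section \<open>Ideals as sets of complex numbers\<close>

definition integers_of :: "complex set \<Rightarrow> complex set"
  where "integers_of K = {z \<in> K. algebraic_int z}"

text \<open>The ambient ring does not enter, so the same operation multiplies ideals of k and of K1
  and also extends an ideal from k to K1. Subtraction comes for free once a factor is closed under
  negation.\<close>

inductive_set set_prod :: "complex set \<Rightarrow> complex set \<Rightarrow> complex set" for I J where
  prod: "i \<in> I \<Longrightarrow> j \<in> J \<Longrightarrow> i * j \<in> set_prod I J"
| sum: "x \<in> set_prod I J \<Longrightarrow> y \<in> set_prod I J \<Longrightarrow> x + y \<in> set_prod I J"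

definition set_ideal :: "complex set \<Rightarrow> complex set \<Rightarrow> bool"
  where "set_ideal R I \<longleftrightarrow> I \<subseteq> R \<and> 0 \<in> I \<and> (\<forall>x\<in>I. \<forall>y\<in>I. x + y \<in> I) \<and> (\<forall>r\<in>R. \<forall>x\<in>I. r * x \<in> I)"

text \<open>Applied to a ring with a field element as factor this gives principal fractional ideals,
  so dividing an ideal by a generator stays within plain sets.\<close>

definition scale :: "complex \<Rightarrow> complex set \<Rightarrow> complex set"
  where "scale a I = (*) a ` I"

lemma scale_scale [simp]: "scale a (scale b I) = scale (a * b) I"
  by (auto simp: scale_def image_image mult.assoc)

lemma scale_1 [simp]: "scale 1 I = I"
  by (simp add: scale_def)

lemma in_scale_iff: "a \<noteq> 0 \<Longrightarrow> x \<in> scale a I \<longleftrightarrow> x / a \<in> I"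
  by (auto simp: scale_def image_iff field_simps intro!: bexI[of _ "x / a"])

lemma scale_eq_iff: "a \<noteq> 0 \<Longrightarrow> scale a I = scale b J \<longleftrightarrow> I = scale (b / a) J"
  by (metis divide_self_if left_inverse mult.commute nonzero_mult_div_cancel_left scale_1 scale_scale times_divide_eq_right)

lemma set_prod_subsetI:
  assumes "\<And>i j. i \<in> I \<Longrightarrow> j \<in> J \<Longrightarrow> i * j \<in> T" "\<And>x y. x \<in> T \<Longrightarrow> y \<in> T \<Longrightarrow> x + y \<in> T"
  shows "set_prod I J \<subseteq> T"
proof
  fix x assume "x \<in> set_prod I J"
  then show "x \<in> T" by induction (use assms in auto)
qed

lemma set_prod_mono: "I \<subseteq> I' \<Longrightarrow> J \<subseteq> J' \<Longrightarrow> set_prod I J \<subseteq> set_prod I' J'"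
  by (rule set_prod_subsetI) (auto intro: set_prod.intros)

lemma set_prod_commute: "set_prod I J = set_prod J I"
proof -
  have "set_prod I J \<subseteq> set_prod J I" for I J
  proof (rule set_prod_subsetI)
    fix i j assume "i \<in> I" "j \<in> J"
    then show "i * j \<in> set_prod J I" using set_prod.prod[of j J i I] by (simp add: mult.commute)
  qed (rule set_prod.sum)
  then show ?thesis by blast
qed

lemma set_prod_assoc: "set_prod (set_prod I J) K = set_prod I (set_prod J K)"
proof -
  have *: "set_prod I (set_prod J K) \<subseteq> set_prod (set_prod I J) K" for I J K
  proof (rule set_prod_subsetI)
    fix i x assume i: "i \<in> I" and x: "x \<in> set_prod J K"
    from x show "i * x \<in> set_prod (set_prod I J) K"
    proof induction
      case (prod j k)
      then have "(i * j) * k \<in> set_prod (set_prod I J) K" using i by (intro set_prod.prod)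
      then show ?case by (simp add: mult.assoc)
    next
      case (sum x y)
      then show ?case using set_prod.sum by (simp add: distrib_left)
    qed
  qed (rule set_prod.sum)
  have "set_prod (set_prod I J) K \<subseteq> set_prod I (set_prod J K)"
    using *[of K J I] by (simp add: set_prod_commute)
  then show ?thesis using *[of I J K] by blast
qed

lemma set_prod_left_commute: "set_prod I (set_prod J K) = set_prod J (set_prod I K)"
  by (metis set_prod_assoc set_prod_commute)

lemmas set_prod_ac = set_prod_assoc set_prod_commute set_prod_left_commute

text \<open>Two instances are intended: conjugation, with all three maps equal, and scaling, with
  \<open>f = g\<close> and \<open>h\<close> the identity.\<close>

lemma set_prod_image:
  assumes "\<And>x y. x \<in> S \<Longrightarrow> y \<in> S \<Longrightarrow> f (x + y) = f x + f y"
    and "\<And>x y. x \<in> S \<Longrightarrow> y \<in> S \<Longrightarrow> g x * h y = f (x * y)"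
    and "\<And>x y. x \<in> S \<Longrightarrow> y \<in> S \<Longrightarrow> x + y \<in> S" "\<And>x y. x \<in> S \<Longrightarrow> y \<in> S \<Longrightarrow> x * y \<in> S"
    and "I \<subseteq> S" "J \<subseteq> S"
  shows "f ` set_prod I J = set_prod (g ` I) (h ` J)"
proof
  have S: "set_prod I J \<subseteq> S"
    by (rule set_prod_subsetI) (use assms(3-6) in blast)+
  show "f ` set_prod I J \<subseteq> set_prod (g ` I) (h ` J)"
  proof
    fix y assume "y \<in> f ` set_prod I J"
    then obtain x where x: "x \<in> set_prod I J" "y = f x" by auto
    from x(1) have "f x \<in> set_prod (g ` I) (h ` J)"
    proof induction
      case (prod i j)
      then have "f (i * j) = g i * h j" using assms(2)[of i j, symmetric] assms(5,6) by blast
      then show ?case using prod by (auto intro: set_prod.prod)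
    next
      case (sum x y)
      then have "f (x + y) = f x + f y" using assms(1) S by blast
      then show ?case using sum by (auto intro: set_prod.sum)
    qed
    then show "y \<in> set_prod (g ` I) (h ` J)" using x by simp
  qed
  show "set_prod (g ` I) (h ` J) \<subseteq> f ` set_prod I J"
  proof (rule set_prod_subsetI)
    fix i j assume "i \<in> g ` I" "j \<in> h ` J"
    then obtain i' j' where "i' \<in> I" "j' \<in> J" "i = g i'" "j = h j'" by auto
    moreover have "g i' * h j' = f (i' * j')" using assms(2)[of i' j'] assms(5,6) \<open>i' \<in> I\<close> \<open>j' \<in> J\<close> by blast
    ultimately show "i * j \<in> f ` set_prod I J" by (auto intro: set_prod.prod)
  next
    fix x y assume "x \<in> f ` set_prod I J" "y \<in> f ` set_prod I J"
    then obtain x' y' where "x' \<in> set_prod I J" "y' \<in> set_prod I J" "x = f x'" "y = f y'" by auto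
    moreover have "f (x' + y') = f x' + f y'" using assms(1) S calculation by blast
    ultimately show "x + y \<in> f ` set_prod I J" by (metis image_eqI set_prod.sum)
  qed
qed

lemma set_prod_scale_left [simp]: "set_prod (scale a I) J = scale a (set_prod I J)"
  using set_prod_image[of UNIV "(*) a" "(*) a" "\<lambda>x. x" I J]
  by (simp add: scale_def distrib_left mult.assoc)

lemma set_prod_scale_right [simp]: "set_prod I (scale a J) = scale a (set_prod I J)"
  by (metis set_prod_commute set_prod_scale_left)

locale complex_subring =
  fixes R :: "complex set"
  assumes one [simp]: "1 \<in> R"
    and add [simp]: "a \<in> R \<Longrightarrow> b \<in> R \<Longrightarrow> a + b \<in> R"
    and minus [simp]: "a \<in> R \<Longrightarrow> - a \<in> R"
    and mult [simp]: "a \<in> R \<Longrightarrow> b \<in> R \<Longrightarrow> a * b \<in> R"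
begin

lemma zero [simp]: "0 \<in> R"
  using add[OF one minus[OF one]] by simp

lemma diff [simp]: "a \<in> R \<Longrightarrow> b \<in> R \<Longrightarrow> a - b \<in> R"
  using add[OF _ minus, of a b] by simp

lemma set_ideal_self [simp]: "set_ideal R R"
  by (simp add: set_ideal_def)

lemma set_prod_ideal [simp]: "set_ideal R I \<Longrightarrow> set_prod R I = I"
proof
  assume I: "set_ideal R I"
  show "set_prod R I \<subseteq> I" by (rule set_prod_subsetI) (use I in \<open>auto simp: set_ideal_def\<close>)
  show "I \<subseteq> set_prod R I" using set_prod.prod[of 1 R _ I] by auto
qed

lemma set_prod_ideal2 [simp]: "set_ideal R I \<Longrightarrow> set_prod I R = I"
  using set_prod_ideal[of I] by (simp add: set_prod_commute)

lemma set_prod_self [simp]: "set_prod R R = R"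
  by simp

lemma set_ideal_prod:
  assumes "set_ideal R I" "set_ideal R J" shows "set_ideal R (set_prod I J)"
  unfolding set_ideal_def
proof (intro conjI ballI)
  show "set_prod I J \<subseteq> R"
    by (rule set_prod_subsetI) (use assms mult add in \<open>unfold set_ideal_def, blast+\<close>)
  show "0 \<in> set_prod I J" using set_prod.prod[of 0 I 0 J] assms by (simp add: set_ideal_def)
  fix r x assume r: "r \<in> R" and "x \<in> set_prod I J"
  from this(2) show "r * x \<in> set_prod I J"
  proof induction
    case (prod i j)
    then have "(r * i) * j \<in> set_prod I J" using r assms by (intro set_prod.prod) (auto simp: set_ideal_def)
    then show ?case by (simp add: mult.assoc)
  qed (simp add: distrib_left set_prod.sum)
qed (rule set_prod.sum)

lemma set_ideal_scale:
  assumes "set_ideal R I" "scale a I \<subseteq> R" shows "set_ideal R (scale a I)"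
  unfolding set_ideal_def
proof (intro conjI ballI assms(2))
  show "0 \<in> scale a I" using assms by (auto simp: set_ideal_def scale_def intro!: image_eqI[of _ _ 0])
next
  fix x y assume "x \<in> scale a I" "y \<in> scale a I"
  then obtain x' y' where "x' \<in> I" "y' \<in> I" "x = a * x'" "y = a * y'" by (auto simp: scale_def)
  moreover have "x' + y' \<in> I" using assms calculation by (auto simp: set_ideal_def)
  ultimately show "x + y \<in> scale a I" by (auto simp: scale_def distrib_left intro!: image_eqI[of _ _ "x' + y'"])
next
  fix r x assume "r \<in> R" "x \<in> scale a I"
  then obtain x' where "x' \<in> I" "x = a * x'" by (auto simp: scale_def)
  moreover have "r * x' \<in> I" using assms calculation \<open>r \<in> R\<close> by (auto simp: set_ideal_def)
  ultimately show "r * x \<in> scale a I" by (auto simp: scale_def intro!: image_eqI[of _ _ "r * x'"])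
qed

lemma scale_subset: "a \<in> R \<Longrightarrow> set_ideal R I \<Longrightarrow> scale a I \<subseteq> I"
  by (auto simp: set_ideal_def scale_def)

lemma set_ideal_scale_in: "a \<in> R \<Longrightarrow> set_ideal R I \<Longrightarrow> set_ideal R (scale a I)"
  using set_ideal_scale[of I a] scale_subset[of a I] unfolding set_ideal_def[of R I] by blast

lemma set_ideal_eq_top: "set_ideal R I \<Longrightarrow> 1 \<in> I \<Longrightarrow> I = R"
  unfolding set_ideal_def by (metis mult.right_neutral subsetI subset_antisym)

lemma set_ideal_prod_subset: "set_ideal R I \<Longrightarrow> set_ideal R J \<Longrightarrow> set_prod I J \<subseteq> I"
  by (subst set_prod_commute, rule set_prod_subsetI) (auto simp: set_ideal_def subset_eq)

lemma scale_unit: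
  assumes "u \<noteq> 0" "u \<in> R" "inverse u \<in> R" "set_ideal R I" shows "scale u I = I"
proof
  show "scale u I \<subseteq> I" using scale_subset assms by blast
  show "I \<subseteq> scale u I"
  proof
    fix x assume "x \<in> I"
    then have "inverse u * x \<in> I" using assms unfolding set_ideal_def by blast
    then show "x \<in> scale u I" using assms(1) by (simp add: in_scale_iff divide_inverse mult.commute)
  qed
qed

end

section \<open>The ideal class group\<close>

lemma ring_of_integers_simps [simp]:
  "carrier (ring_of_integers K) = integers_of K"
  "\<one>\<^bsub>ring_of_integers K\<^esub> = 1" "\<zero>\<^bsub>ring_of_integers K\<^esub> = 0"
  "x \<otimes>\<^bsub>ring_of_integers K\<^esub> y = x * y" "x \<oplus>\<^bsub>ring_of_integers K\<^esub> y = x + y"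
  by (simp_all add: ring_of_integers_def ring_of_type_algebra_def integers_of_def)

lemma ideal_prod_ring_of_integers [simp]: "ideal_prod (ring_of_integers K) I J = set_prod I J"
proof
  show "ideal_prod (ring_of_integers K) I J \<subseteq> set_prod I J"
  proof
    fix x assume "x \<in> ideal_prod (ring_of_integers K) I J"
    then show "x \<in> set_prod I J" by induction (auto intro: set_prod.intros)
  qed
  show "set_prod I J \<subseteq> ideal_prod (ring_of_integers K) I J"
    using ideal_prod.prod[of _ I _ J "ring_of_integers K"] ideal_prod.sum[of _ "ring_of_integers K" I J]
    by (intro set_prod_subsetI) simp_all
qed

lemma cgenideal_ring_of_integers [simp]: "PIdl\<^bsub>ring_of_integers K\<^esub> a = scale a (integers_of K)"
  by (auto simp: cgenideal_def scale_def mult.commute)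

locale number_field = complex_subfield K for K :: "complex set"
begin

abbreviation ints where "ints \<equiv> integers_of K"

sublocale ints: complex_subring ints
  by unfold_locales (auto simp: integers_of_def intro: algebraic_int_plus algebraic_int_times)

lemma ints_cring: "cring (ring_of_integers K)"
proof (rule cringI)
  show "abelian_group (ring_of_integers K)"
  proof (rule abelian_groupI)
    fix x assume "x \<in> carrier (ring_of_integers K)"
    then show "\<exists>y\<in>carrier (ring_of_integers K). y \<oplus>\<^bsub>ring_of_integers K\<^esub> x = \<zero>\<^bsub>ring_of_integers K\<^esub>"
      by (intro bexI[of _ "- x"]) simp_all
  qed (simp_all add: add_ac)
  show "comm_monoid (ring_of_integers K)"
    by (rule comm_monoidI) (auto simp: mult_ac)
qed (simp add: distrib_right)

lemma ideal_iff: "ideal I (ring_of_integers K) \<longleftrightarrow> set_ideal ints I"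
proof
  assume "ideal I (ring_of_integers K)"
  then interpret ideal I "ring_of_integers K" .
  have add: "additive_subgroup I (ring_of_integers K)" by unfold_locales
  have "I \<subseteq> ints" "0 \<in> I"
    using a_subset additive_subgroup.zero_closed[OF add] by (simp_all only: ring_of_integers_simps)
  note h = this
  have add: "x + y \<in> I" if "x \<in> I" "y \<in> I" for x y
    using additive_subgroup.a_closed[OF add that] by (simp only: ring_of_integers_simps)
  have mult: "r * x \<in> I" if "r \<in> ints" "x \<in> I" for r x
    using I_l_closed[OF that(2), of r] that(1) by (simp only: ring_of_integers_simps)
  show "set_ideal ints I" unfolding set_ideal_def by (intro conjI ballI h add mult)
next
  assume I: "set_ideal ints I"
  interpret R: cring "ring_of_integers K" by (rule ints_cring)
  have sub: "I \<subseteq> ints" and zero: "0 \<in> I" and add: "\<And>x y. x \<in> I \<Longrightarrow> y \<in> I \<Longrightarrow> x + y \<in> I"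
    and mult: "\<And>r x. r \<in> ints \<Longrightarrow> x \<in> I \<Longrightarrow> r * x \<in> I"
    using I unfolding set_ideal_def by blast+
  show "ideal I (ring_of_integers K)"
  proof (rule idealI)
    show "ring (ring_of_integers K)" by (rule R.ring_axioms)
    show "subgroup I (add_monoid (ring_of_integers K))"
    proof (rule subgroup.intro)
      fix x assume x: "x \<in> I"
      have "\<ominus>\<^bsub>ring_of_integers K\<^esub> x = - x"
        by (rule R.minus_equality) (use x sub in \<open>simp_all add: subset_eq\<close>)
      moreover have "- x \<in> I" using mult[of "- 1" x] x by simp
      ultimately show "inv\<^bsub>add_monoid (ring_of_integers K)\<^esub> x \<in> I" by (simp only: a_inv_def)
    qed (use sub zero add in simp_all)
    fix a x assume "a \<in> I" "x \<in> carrier (ring_of_integers K)"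
    then have "x * a \<in> I" by (simp add: mult)
    then show "x \<otimes>\<^bsub>ring_of_integers K\<^esub> a \<in> I" "a \<otimes>\<^bsub>ring_of_integers K\<^esub> x \<in> I"
      by (simp_all add: mult.commute)
  qed
qed

lemma nonzero_ideals_eq: "nonzero_ideals K = {I. set_ideal ints I \<and> I \<noteq> {0}}"
  by (simp add: nonzero_ideals_def ideal_iff)

lemma nonzero_idealsD: "I \<in> nonzero_ideals K \<Longrightarrow> set_ideal ints I"
  by (simp add: nonzero_ideals_eq)

lemma nonzero_idealE:
  assumes "I \<in> nonzero_ideals K" obtains x where "x \<in> I" "x \<noteq> 0" "x \<in> ints"
  using assms unfolding nonzero_ideals_eq set_ideal_def by blast

lemma nonzero_idealsI: "set_ideal ints I \<Longrightarrow> x \<in> I \<Longrightarrow> x \<noteq> 0 \<Longrightarrow> I \<in> nonzero_ideals K"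
  by (auto simp: nonzero_ideals_eq)

lemma ints_nonzero [simp]: "ints \<in> nonzero_ideals K"
  by (rule nonzero_idealsI[of _ 1]) auto

lemma nonzero_ideals_prod [simp]:
  assumes "I \<in> nonzero_ideals K" "J \<in> nonzero_ideals K" shows "set_prod I J \<in> nonzero_ideals K"
proof -
  obtain x where x: "x \<in> I" "x \<noteq> 0" using assms(1) by (rule nonzero_idealE)
  obtain y where y: "y \<in> J" "y \<noteq> 0" using assms(2) by (rule nonzero_idealE)
  show ?thesis
    using nonzero_idealsI[of _ "x * y", OF ints.set_ideal_prod[OF assms[THEN nonzero_idealsD]] set_prod.prod] x y by simp
qed

lemma nonzero_ideals_scale:
  assumes "I \<in> nonzero_ideals K" "a \<noteq> 0" "scale a I \<subseteq> ints" shows "scale a I \<in> nonzero_ideals K"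
proof -
  obtain x where x: "x \<in> I" "x \<noteq> 0" using assms(1) by (rule nonzero_idealE)
  show ?thesis
    using nonzero_idealsI[OF ints.set_ideal_scale[OF nonzero_idealsD[OF assms(1)] assms(3)], of "a * x"] x assms(2)
    by (simp add: scale_def)
qed

lemma ideal_equiv_iff:
  "(I, J) \<in> ideal_equiv K \<longleftrightarrow> I \<in> nonzero_ideals K \<and> J \<in> nonzero_ideals K \<and>
    (\<exists>a\<in>ints - {0}. \<exists>b\<in>ints - {0}. scale a I = scale b J)"
proof -
  have "set_prod (scale a ints) I = scale a I" if "I \<in> nonzero_ideals K" for a I
    using nonzero_idealsD[OF that] by simp
  then show ?thesis
    unfolding ideal_equiv_def ideal_prod_ring_of_integers cgenideal_ring_of_integers ring_of_integers_simps
    by (simp cong: conj_cong)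
qed

lemma ideal_equivI:
  "I \<in> nonzero_ideals K \<Longrightarrow> J \<in> nonzero_ideals K \<Longrightarrow> a \<in> ints \<Longrightarrow> a \<noteq> 0 \<Longrightarrow> b \<in> ints \<Longrightarrow> b \<noteq> 0 \<Longrightarrow>
    scale a I = scale b J \<Longrightarrow> (I, J) \<in> ideal_equiv K"
  unfolding ideal_equiv_iff by blast

lemma ideal_equivE:
  assumes "(I, J) \<in> ideal_equiv K"
  obtains a b where "a \<in> ints" "a \<noteq> 0" "b \<in> ints" "b \<noteq> 0" "scale a I = scale b J"
    "I \<in> nonzero_ideals K" "J \<in> nonzero_ideals K"
  using assms unfolding ideal_equiv_iff by blast

lemma equiv_ideal_equiv: "equiv (nonzero_ideals K) (ideal_equiv K)"
proof (rule equivI)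
  show "ideal_equiv K \<subseteq> nonzero_ideals K \<times> nonzero_ideals K" by (auto simp: ideal_equiv_iff)
  show "refl_on (nonzero_ideals K) (ideal_equiv K)"
    by (intro refl_onI ideal_equivI[of _ _ 1 1]) simp_all
  show "sym (ideal_equiv K)"
  proof (rule symI)
    fix I J assume "(I, J) \<in> ideal_equiv K"
    then obtain a b where "a \<in> ints" "a \<noteq> 0" "b \<in> ints" "b \<noteq> 0" "scale a I = scale b J"
      "I \<in> nonzero_ideals K" "J \<in> nonzero_ideals K" by (rule ideal_equivE)
    then show "(J, I) \<in> ideal_equiv K" by (intro ideal_equivI[of J I b a]) simp_all
  qed
  show "trans (ideal_equiv K)"
  proof (rule transI)
    fix I J L assume "(I, J) \<in> ideal_equiv K" "(J, L) \<in> ideal_equiv K"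
    then obtain a b c d where *: "a \<in> ints" "a \<noteq> 0" "b \<in> ints" "b \<noteq> 0" "scale a I = scale b J"
      "c \<in> ints" "c \<noteq> 0" "d \<in> ints" "d \<noteq> 0" "scale c J = scale d L"
      "I \<in> nonzero_ideals K" "L \<in> nonzero_ideals K"
      by (elim ideal_equivE)
    have "scale (c * a) I = scale c (scale b J)" unfolding *(5)[symmetric] by simp
    also have "\<dots> = scale b (scale c J)" by (simp add: mult.commute)
    also have "\<dots> = scale (b * d) L" unfolding *(10) by simp
    finally show "(I, L) \<in> ideal_equiv K" using * by (intro ideal_equivI) auto
  qed
qed

abbreviation cls where "cls \<equiv> ideal_class K"

lemma cls_eq_iff: "I \<in> nonzero_ideals K \<Longrightarrow> J \<in> nonzero_ideals K \<Longrightarrow> cls I = cls J \<longleftrightarrow> (I, J) \<in> ideal_equiv K"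
  using eq_equiv_class_iff[OF equiv_ideal_equiv] unfolding ideal_class_def by blast

lemma ideal_equiv_prod:
  assumes "(I, I') \<in> ideal_equiv K" "(J, J') \<in> ideal_equiv K"
  shows "(set_prod I J, set_prod I' J') \<in> ideal_equiv K"
proof -
  obtain a b where *: "a \<in> ints" "a \<noteq> 0" "b \<in> ints" "b \<noteq> 0" "scale a I = scale b I'"
    "I \<in> nonzero_ideals K" "I' \<in> nonzero_ideals K"
    using assms(1) by (rule ideal_equivE)
  obtain c d where **: "c \<in> ints" "c \<noteq> 0" "d \<in> ints" "d \<noteq> 0" "scale c J = scale d J'"
    "J \<in> nonzero_ideals K" "J' \<in> nonzero_ideals K"
    using assms(2) by (rule ideal_equivE)
  have "scale (c * a) (set_prod I J) = set_prod (scale a I) (scale c J)" by simp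
  also have "\<dots> = scale (d * b) (set_prod I' J')" unfolding *(5) **(5) by simp
  finally show ?thesis using * ** by (intro ideal_equivI) auto
qed

lemma class_group_carrier: "carrier (class_group K) = cls ` nonzero_ideals K"
  by (auto simp: class_group_def quotient_def ideal_class_def)

lemma class_group_one: "\<one>\<^bsub>class_group K\<^esub> = cls ints"
  by (simp add: class_group_def)

lemma class_group_mult:
  assumes "I \<in> nonzero_ideals K" "J \<in> nonzero_ideals K"
  shows "cls I \<otimes>\<^bsub>class_group K\<^esub> cls J = cls (set_prod I J)"
proof -
  have "cls I \<otimes>\<^bsub>class_group K\<^esub> cls J =
      (\<Union>I' \<in> ideal_equiv K `` {I}. \<Union>J' \<in> ideal_equiv K `` {J}. cls (set_prod I' J'))"
    by (simp add: class_group_def ideal_class_def)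
  also have "\<dots> = cls (set_prod I J)"
  proof (rule UN_equiv_class2[OF equiv_ideal_equiv equiv_ideal_equiv _ assms])
    show "(\<lambda>I J. cls (set_prod I J)) respects2 ideal_equiv K"
    proof (rule congruent2I')
      fix I I' J J' assume "(I, I') \<in> ideal_equiv K" "(J, J') \<in> ideal_equiv K"
      then have "(set_prod I J, set_prod I' J') \<in> ideal_equiv K" by (rule ideal_equiv_prod)
      then show "cls (set_prod I J) = cls (set_prod I' J')"
        unfolding ideal_class_def by (rule equiv_class_eq[OF equiv_ideal_equiv])
    qed
  qed
  finally show ?thesis .
qed

lemma class_group_comm_monoid: "comm_monoid (class_group K)"
proof (rule comm_monoidI)
  show "x \<otimes>\<^bsub>class_group K\<^esub> y \<in> carrier (class_group K)"
    if "x \<in> carrier (class_group K)" "y \<in> carrier (class_group K)" for x y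
    using that by (auto simp: class_group_carrier class_group_mult)
  show "\<one>\<^bsub>class_group K\<^esub> \<in> carrier (class_group K)"
    by (auto simp: class_group_carrier class_group_one)
  show "(x \<otimes>\<^bsub>class_group K\<^esub> y) \<otimes>\<^bsub>class_group K\<^esub> z = x \<otimes>\<^bsub>class_group K\<^esub> (y \<otimes>\<^bsub>class_group K\<^esub> z)"
    if "x \<in> carrier (class_group K)" "y \<in> carrier (class_group K)" "z \<in> carrier (class_group K)" for x y z
    using that by (auto simp: class_group_carrier class_group_mult set_prod_assoc)
  show "\<one>\<^bsub>class_group K\<^esub> \<otimes>\<^bsub>class_group K\<^esub> x = x" if "x \<in> carrier (class_group K)" for x
    using that nonzero_idealsD by (auto simp: class_group_carrier class_group_mult class_group_one)
  show "x \<otimes>\<^bsub>class_group K\<^esub> y = y \<otimes>\<^bsub>class_group K\<^esub> x"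
    if "x \<in> carrier (class_group K)" "y \<in> carrier (class_group K)" for x y
    using that by (auto simp: class_group_carrier class_group_mult set_prod_commute)
qed

text \<open>A generator found among the complex numbers lies in the ring automatically, since
  \<open>a * 1\<close> belongs to the ideal.\<close>

lemma cls_eq_one_iff:
  assumes "I \<in> nonzero_ideals K"
  shows "cls I = \<one>\<^bsub>class_group K\<^esub> \<longleftrightarrow> (\<exists>a. a \<noteq> 0 \<and> I = scale a ints)"
proof
  assume "cls I = \<one>\<^bsub>class_group K\<^esub>"
  then have "(I, ints) \<in> ideal_equiv K" using cls_eq_iff[OF assms ints_nonzero] by (simp add: class_group_one)
  then obtain a b where "a \<noteq> 0" "b \<noteq> 0" "scale a I = scale b ints" by (rule ideal_equivE)
  then show "\<exists>a. a \<noteq> 0 \<and> I = scale a ints" using scale_eq_iff[of a I b ints] by (intro exI[of _ "b / a"]) simp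
next
  assume "\<exists>a. a \<noteq> 0 \<and> I = scale a ints"
  then obtain a where a: "a \<noteq> 0" "I = scale a ints" by blast
  then have "a * 1 \<in> I" unfolding a(2) scale_def by (intro imageI) simp
  then have "a \<in> ints" using nonzero_idealsD[OF assms] unfolding set_ideal_def by auto
  then have "(I, ints) \<in> ideal_equiv K" using a assms by (intro ideal_equivI[of _ _ 1 a]) auto
  then show "cls I = \<one>\<^bsub>class_group K\<^esub>" using cls_eq_iff[OF assms ints_nonzero] by (simp add: class_group_one)
qed

lemma cls_scale:
  assumes "I \<in> nonzero_ideals K" "a \<in> ints" "b \<in> ints" "a \<noteq> 0" "b \<noteq> 0" "J = scale (a / b) I" "J \<subseteq> ints"
  shows "J \<in> nonzero_ideals K" "cls J = cls I"
proof -
  show J: "J \<in> nonzero_ideals K" using nonzero_ideals_scale[OF assms(1), of "a / b"] assms by simp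
  have "scale b J = scale a I" using assms by simp
  then have "(J, I) \<in> ideal_equiv K" using assms J by (intro ideal_equivI[of _ _ b a])
  then show "cls J = cls I" using cls_eq_iff[OF J assms(1)] by simp
qed

end

section \<open>Extension of ideals to a larger field\<close>

locale number_field_ext = k: number_field K + l: number_field L for K L +
  assumes subset: "K \<subseteq> L"
begin

lemma ints_subset: "k.ints \<subseteq> l.ints"
  using subset by (auto simp: integers_of_def)

abbreviation ext where "ext I \<equiv> set_prod l.ints I"

lemma set_ideal_ext: 
  assumes "I \<subseteq> k.ints" "0 \<in> I" shows "set_ideal l.ints (ext I)"
  unfolding set_ideal_def
proof (intro conjI ballI)
  show "ext I \<subseteq> l.ints" by (rule set_prod_subsetI) (use assms ints_subset in auto)
  show "0 \<in> ext I" using set_prod.prod[of 0 l.ints 0 I] assms by simp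
  fix r x assume r: "r \<in> l.ints" and "x \<in> ext I"
  from this(2) show "r * x \<in> ext I"
  proof induction
    case (prod i j)
    then have "(r * i) * j \<in> ext I" using r by (intro set_prod.prod) auto
    then show ?case by (simp add: mult.assoc)
  qed (simp add: distrib_left set_prod.sum)
qed (rule set_prod.sum)

lemma genideal_eq_ext:
  assumes "set_ideal k.ints I" shows "Idl\<^bsub>ring_of_integers L\<^esub> I = ext I"
proof
  have I: "I \<subseteq> k.ints" "0 \<in> I" using assms by (auto simp: set_ideal_def)
  have "I \<subseteq> ext I" using set_prod.prod[of 1 l.ints _ I] by auto
  then show "Idl\<^bsub>ring_of_integers L\<^esub> I \<subseteq> ext I"
    using set_ideal_ext[OF I] l.ideal_iff unfolding genideal_def by blast
  show "ext I \<subseteq> Idl\<^bsub>ring_of_integers L\<^esub> I"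
    unfolding genideal_def l.ideal_iff
  proof (rule Inter_greatest)
    fix J assume "J \<in> {J. set_ideal l.ints J \<and> I \<subseteq> J}"
    then show "ext I \<subseteq> J" by (intro set_prod_subsetI) (auto simp: set_ideal_def)
  qed
qed

lemma ext_nonzero: "I \<in> nonzero_ideals K \<Longrightarrow> ext I \<in> nonzero_ideals L"
proof -
  assume I: "I \<in> nonzero_ideals K"
  then obtain x where x: "x \<in> I" "x \<noteq> 0" by (rule k.nonzero_idealE)
  have "set_ideal l.ints (ext I)" using k.nonzero_idealsD[OF I] by (intro set_ideal_ext) (auto simp: set_ideal_def)
  then show ?thesis using set_prod.prod[OF l.ints.one x(1)] x(2) by (intro l.nonzero_idealsI[of _ x]) auto
qed

lemma ext_prod: "ext (set_prod I J) = set_prod (ext I) (ext J)"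
  by (metis l.ints.set_prod_self set_prod_assoc set_prod_left_commute)

text \<open>Scaling commutes with extension, so all representatives give the same class and the
  union in \<open>class_extension\<close> collapses.\<close>

lemma class_extension_eq:
  assumes "I \<in> nonzero_ideals K" shows "class_extension L (k.cls I) = l.cls (ext I)"
proof -
  have "l.cls (Idl\<^bsub>ring_of_integers L\<^esub> J) = l.cls (ext I)" if "J \<in> k.cls I" for J
  proof -
    have "(I, J) \<in> ideal_equiv K" using that by (simp add: ideal_class_def)
    then obtain a b where *: "a \<in> k.ints" "a \<noteq> 0" "b \<in> k.ints" "b \<noteq> 0" "scale a I = scale b J"
       "J \<in> nonzero_ideals K" by (rule k.ideal_equivE)
    have "scale a (ext I) = scale b (ext J)" unfolding set_prod_scale_right[symmetric] *(5) ..
    then have "(ext I, ext J) \<in> ideal_equiv L"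
      using * assms ints_subset by (intro l.ideal_equivI[of _ _ a b] ext_nonzero) auto
    then have "l.cls (ext I) = l.cls (ext J)"
      using l.cls_eq_iff[OF ext_nonzero[OF assms] ext_nonzero[OF *(6)]] by simp
    then show ?thesis using genideal_eq_ext[OF k.nonzero_idealsD[OF *(6)]] by simp
  qed
  moreover have "I \<in> k.cls I" using k.equiv_ideal_equiv assms unfolding ideal_class_def by (rule equiv_class_self)
  ultimately show ?thesis unfolding class_extension_def by (intro SUP_eq_const) auto
qed

lemma capitulation_kernel_eq:
  "capitulation_kernel K L = k.cls ` {I \<in> nonzero_ideals K. \<exists>a. a \<noteq> 0 \<and> ext I = scale a l.ints}"
proof -
  have *: "class_extension L (k.cls I) = \<one>\<^bsub>class_group L\<^esub> \<longleftrightarrow> (\<exists>a. a \<noteq> 0 \<and> ext I = scale a l.ints)"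
    if "I \<in> nonzero_ideals K" for I
    unfolding class_extension_eq[OF that] by (rule l.cls_eq_one_iff[OF ext_nonzero[OF that]])
  show ?thesis
    unfolding capitulation_kernel_def kernel_def k.class_group_carrier using * by blast
qed

end

section \<open>Quadratic extensions of the Gaussian rationals\<close>

lemma gprime_one_plus_i: "gprime (1 + \<i>)"
proof (rule gprime_of_prime_gnorm)
  show "Factorial_Ring.prime (gnorm (1 + \<i>))" using gnorm_of_int_pair[of 1 1] by simp
qed simp

text \<open>Two successive divisions by the prime 1 + i, whose square is 2 up to a unit. This is the
  parity step in the computation of the integral basis.\<close>

lemma gauss_parity:
  assumes "c \<in> gauss_int" "b \<in> gauss_int" "m \<in> gauss_int" "c\<^sup>2 + 2 * b * c = 4 * m"
  obtains a where "a \<in> gauss_int" "c = 2 * a"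
proof -
  define l where "l = 1 + \<i>"
  have l: "gprime l" "l \<in> gauss_int" "l \<noteq> 0" using gprime_one_plus_i by (simp_all add: l_def complex_eq_iff)
  have two: "2 = - \<i> * l\<^sup>2" by (simp add: l_def power2_eq_square algebra_simps)
  have "c\<^sup>2 = 2 * (2 * m - b * c)" using assms(4) by (simp add: algebra_simps)
  also have "\<dots> = l * (- \<i> * l * (2 * m - b * c))" unfolding two by (simp add: power2_eq_square)
  finally have "l gdvd c\<^sup>2" using assms l by (intro gdvdI[of "- \<i> * l * (2 * m - b * c)"]) simp_all
  then have "l gdvd c" using gprime_dvd_power2[OF l(1) assms(1)] by blast
  then obtain e where e: "e \<in> gauss_int" "c = l * e" by (rule gdvdE)
  have "l\<^sup>2 * e\<^sup>2 = 2 * (2 * m - b * (l * e))" using assms(4) unfolding e(2) by (simp add: algebra_simps)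
  also have "\<dots> = l\<^sup>2 * (- \<i> * (- \<i> * l\<^sup>2 * m - b * (l * e)))" unfolding two by simp
  finally have "e\<^sup>2 = - \<i> * (- \<i> * l\<^sup>2 * m - b * (l * e))"
    using mult_left_cancel[of "l\<^sup>2"] l(3) by (metis power_not_zero)
  also have "\<dots> = l * (- \<i> * (- \<i> * l * m - b * e))" by (simp add: power2_eq_square algebra_simps)
  finally have "l gdvd e\<^sup>2" using assms l e by (intro gdvdI[of "- \<i> * (- \<i> * l * m - b * e)"]) simp_all
  then have "l gdvd e" using gprime_dvd_power2[OF l(1) e(1)] by blast
  then obtain g where g: "g \<in> gauss_int" "e = l * g" by (rule gdvdE)
  have "c = 2 * (\<i> * g)" unfolding e(2) g(2) two by (simp add: power2_eq_square mult_ac)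
  then show ?thesis using that[of "\<i> * g"] g(1) by simp
qed

section \<open>Integers and ideal norms of Q(i, sqrt d) for squarefree d = 1 mod 4\<close>

locale gauss_quadratic =
  fixes d :: nat
  assumes sqfree: "gsquarefree (of_nat d)" and mod4: "d mod 4 = 1"
    and sqrt_notin: "sqrtC d \<notin> gauss_rat"
begin

lemma sqrtC_square [simp]: "sqrtC d * sqrtC d = of_nat d"
  unfolding sqrtC_def of_real_mult[symmetric] by simp

sublocale quadratic_extension gauss_rat "sqrtC d"
  by unfold_locales (auto simp: sqrt_notin)

sublocale number_field L ..

definition \<omega> where "\<omega> = (1 + sqrtC d) / 2"

lemma sqrtC_omega: "sqrtC d = 2 * \<omega> - 1"
  by (simp add: \<omega>_def)

lemma omega_in [simp]: "\<omega> \<in> L"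
  unfolding \<omega>_def by simp

lemma conj_omega [simp]: "conj \<omega> = 1 - \<omega>"
proof -
  have "conj \<omega> = (1 - sqrtC d) / 2" unfolding \<omega>_def by simp
  then show ?thesis by (simp add: \<omega>_def field_simps)
qed

definition D :: complex where "D = of_nat ((d - 1) div 4)"

lemma D_in [simp]: "D \<in> gauss_int"
  by (simp add: D_def)

lemma d_eq: "of_nat d = 4 * D + 1"
proof -
  have "d = 4 * ((d - 1) div 4) + 1" using mod4 by presburger
  then have "(of_nat d :: complex) = of_nat (4 * ((d - 1) div 4) + 1)" by (rule arg_cong)
  then show ?thesis unfolding D_def by (simp only: of_nat_add of_nat_mult of_nat_numeral of_nat_1)
qed

lemma omega_square: "\<omega> * \<omega> = \<omega> + D"
proof -
  have "4 * (\<omega> * \<omega>) = 1 + 2 * sqrtC d + sqrtC d * sqrtC d"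
    unfolding \<omega>_def by (simp del: sqrtC_square add: algebra_simps)
  also have "\<dots> = 4 * (\<omega> + D)" unfolding sqrtC_square d_eq \<omega>_def by simp
  finally show ?thesis by (simp only: mult_left_cancel zero_neq_numeral[symmetric] not_False_eq_True simp_thms)
qed

lemma algebraic_int_omega [simp]: "algebraic_int \<omega>"
proof -
  define P where "P = [:- D, -1, 1:]"
  have "poly P \<omega> = \<omega> * \<omega> - (\<omega> + D)" by (simp add: P_def algebra_simps)
  then have "poly P \<omega> = 0" unfolding omega_square by simp
  moreover have "D \<in> \<int>" by (simp add: D_def)
  then have "\<forall>i. Polynomial.coeff P i \<in> \<int>"
    unfolding P_def coeff_pCons by (intro allI) (simp split: nat.split)
  moreover have "lead_coeff P = 1" by (simp add: P_def)
  ultimately show ?thesis by (intro algebraic_int.intros)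
qed

lemma gauss_int_in_ints [simp]: "a \<in> gauss_int \<Longrightarrow> a \<in> ints"
  by (simp add: integers_of_def)

lemma omega_in_ints [simp]: "\<omega> \<in> ints"
  by (simp add: integers_of_def)

lemma sqrtC_in_ints [simp]: "sqrtC d \<in> ints"
proof -
  have "algebraic_int ((sqrtC d)\<^sup>2)" unfolding power2_eq_square sqrtC_square by simp
  then have "algebraic_int (sqrtC d)" by (rule iffD1[OF algebraic_int_power2_iff])
  then show ?thesis by (simp add: integers_of_def)
qed

lemma ints_in_L: "x \<in> ints \<Longrightarrow> x \<in> L"
  by (simp add: integers_of_def)

lemma conj_ints [simp]: "x \<in> ints \<Longrightarrow> conj x \<in> ints"
  using algebraic_int_conj[of x] by (simp add: integers_of_def)

lemma trace_gauss: "x \<in> ints \<Longrightarrow> x + conj x \<in> gauss_int"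
  using ints.add[OF _ conj_ints, of x x] by (intro gauss_intI_integral trace_in) (simp_all add: integers_of_def)

lemma norm_gauss: "x \<in> ints \<Longrightarrow> x * conj x \<in> gauss_int"
  using ints.mult[OF _ conj_ints, of x x] by (intro gauss_intI_integral norm_in) (simp_all add: integers_of_def)

text \<open>For the doubled coordinates T and B the norm equation reads B^2 d = T^2 - 4 N.
  Squarefreeness of \<open>d\<close> makes B integral, and d = 1 mod 4 makes T - B even. Since only
  trace and norm enter, this also tests the integrality of quotients.\<close>

lemma integral_basis_of_trace_norm:
  assumes "x \<in> L" "x + conj x \<in> gauss_int" "x * conj x \<in> gauss_int"
  obtains a b where "a \<in> gauss_int" "b \<in> gauss_int" "x = a + b * \<omega>"
proof -
  obtain u v where uv: "u \<in> gauss_rat" "v \<in> gauss_rat" "x = u + v * sqrtC d"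
    using assms(1) by (rule quad_extE)
  have cx: "conj x = u - v * sqrtC d" using uv by simp
  define T N B where "T = 2 * u" "N = u\<^sup>2 - v\<^sup>2 * of_nat d" "B = 2 * v"
  have "x + conj x = 2 * u" unfolding cx unfolding uv(3) by simp
  then have T: "T \<in> gauss_int" using assms(2) unfolding T_N_B_def by simp
  have "x * conj x = u\<^sup>2 - v\<^sup>2 * (sqrtC d * sqrtC d)"
    unfolding cx unfolding uv(3) by (simp del: sqrtC_square add: power2_eq_square algebra_simps)
  then have N: "N \<in> gauss_int" using assms(3) unfolding T_N_B_def by simp
  have eq: "B\<^sup>2 * of_nat d = T\<^sup>2 - 4 * N" by (simp add: T_N_B_def power2_eq_square algebra_simps)
  have B: "B \<in> gauss_int"
    by (rule gsquarefree_coeff[OF sqfree]) (use uv T N eq in \<open>simp_all add: T_N_B_def(3)\<close>)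
  \<comment> \<open>This is T^2 - B^2, rearranged to the shape that \<open>gauss_parity\<close>
    expects, with d = 4 D + 1.\<close>
  have "(T - B)\<^sup>2 + 2 * B * (T - B) = 4 * (N + B\<^sup>2 * D)"
    using eq unfolding d_eq by (simp add: power2_eq_square algebra_simps)
  then obtain a where a: "a \<in> gauss_int" "T - B = 2 * a"
    by (rule gauss_parity[rotated 3]) (use T B N in auto)
  have "2 * x = T + B * sqrtC d" unfolding uv(3) T_N_B_def by (simp add: algebra_simps)
  also have "\<dots> = 2 * (a + B * \<omega>)"
    unfolding sqrtC_omega using a(2) by (simp add: algebra_simps)
  finally have "x = a + B * \<omega>"
    by (simp only: mult_left_cancel zero_neq_numeral[symmetric] not_False_eq_True simp_thms)
  then show ?thesis using that[OF a(1) B] by blast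
qed

lemma intsE:
  assumes "x \<in> ints" obtains a b where "a \<in> gauss_int" "b \<in> gauss_int" "x = a + b * \<omega>"
  by (rule integral_basis_of_trace_norm[OF ints_in_L[OF assms] trace_gauss[OF assms] norm_gauss[OF assms]])

lemma ints_of_trace_norm:
  assumes "x \<in> L" "x + conj x \<in> gauss_int" "x * conj x \<in> gauss_int" shows "x \<in> ints"
  using assms by (rule integral_basis_of_trace_norm) simp

lemma ideal_in_ints: "set_ideal ints I \<Longrightarrow> x \<in> I \<Longrightarrow> x \<in> ints"
  by (auto simp: set_ideal_def)

lemma set_ideal_conj: 
  assumes I: "set_ideal ints I" shows "set_ideal ints (conj ` I)"
  unfolding set_ideal_def
proof (intro conjI ballI)
  have sub: "I \<subseteq> ints" and zero: "0 \<in> I" and add: "\<And>x y. x \<in> I \<Longrightarrow> y \<in> I \<Longrightarrow> x + y \<in> I"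
    and mult: "\<And>r x. r \<in> ints \<Longrightarrow> x \<in> I \<Longrightarrow> r * x \<in> I"
    using I unfolding set_ideal_def by blast+
  show "conj ` I \<subseteq> ints" using sub by auto
  show "0 \<in> conj ` I" using zero by (intro image_eqI[of _ _ 0]) simp_all
  show "x + y \<in> conj ` I" if xy: "x \<in> conj ` I" "y \<in> conj ` I" for x y
  proof -
    obtain x' y' where "x' \<in> I" "y' \<in> I" "x = conj x'" "y = conj y'" using xy by blast
    then show ?thesis using sub add by (intro image_eqI[of _ _ "x' + y'"]) (simp_all add: subset_eq ints_in_L)
  qed
  show "r * x \<in> conj ` I" if r: "r \<in> ints" and x: "x \<in> conj ` I" for r x
  proof -
    obtain x' where "x' \<in> I" "x = conj x'" using x by blast
    then show ?thesis using sub mult[of "conj r" x'] r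
      by (intro image_eqI[of _ _ "conj r * x'"]) (simp_all add: subset_eq ints_in_L)
  qed
qed

lemma conj_image_scale:
  assumes "a \<in> L" "I \<subseteq> L" shows "conj ` scale a I = scale (conj a) (conj ` I)"
  using assms unfolding scale_def image_image by (intro image_cong refl) auto

text \<open>Let c generate the Gaussian integers in I * conj I. For a, b in I the numbers a * conj b
  + b * conj a, a * conj a and b * conj b are such integers, so the quotient a * conj b / c has
  trace and norm in Z[i] and is integral. Hence c divides the whole product.\<close>

lemma ideal_norm_principal:
  assumes "I \<in> nonzero_ideals L"
  obtains c where "c \<in> gauss_int" "c \<noteq> 0" "set_prod I (conj ` I) = scale c ints"
proof -
  have I: "set_ideal ints I" using assms by (rule nonzero_idealsD)
  define J where "J = set_prod I (conj ` I)"
  have J: "set_ideal ints J" unfolding J_def by (rule ints.set_ideal_prod[OF I set_ideal_conj[OF I]])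
  have inJ: "a * conj b \<in> J" if "a \<in> I" "b \<in> I" for a b
    unfolding J_def using that by (intro set_prod.prod) auto
  obtain c where c: "c \<in> J \<inter> gauss_int" "\<And>a. a \<in> J \<inter> gauss_int \<Longrightarrow> c gdvd a"
  proof (rule gauss_int_pid[of "J \<inter> gauss_int"])
    show "J \<inter> gauss_int \<noteq> {}" using J by (auto simp: set_ideal_def)
    show "a + b \<in> J \<inter> gauss_int" if "a \<in> J \<inter> gauss_int" "b \<in> J \<inter> gauss_int" for a b
      using that J unfolding set_ideal_def by simp
    show "a * b \<in> J \<inter> gauss_int" if "a \<in> gauss_int" "b \<in> J \<inter> gauss_int" for a b
      using that J unfolding set_ideal_def by simp
  qed auto
  obtain x where x: "x \<in> I" "x \<noteq> 0" "x \<in> ints" using assms by (rule nonzero_idealE)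
  have "c gdvd x * conj x" using c(2) inJ[OF x(1,1)] norm_gauss[OF x(3)] by blast
  then have c0: "c \<noteq> 0" using x ints_in_L[OF x(3)] by (auto simp: gdvd_def)
  have "J \<subseteq> scale c ints" unfolding J_def
  proof (rule set_prod_subsetI)
    fix a b' assume a: "a \<in> I" and b': "b' \<in> conj ` I"
    then obtain b where b: "b \<in> I" "b' = conj b" by blast
    have ab: "a \<in> ints" "b \<in> ints" using a b ideal_in_ints[OF I] by auto
    note abL = ab[THEN ints_in_L]
    define y where "y = a * conj b / c"
    have cG: "c \<in> gauss_int" using c by blast
    have cy: "conj y = b * conj a / c" unfolding y_def using abL cG by (simp add: mult.commute)
    have "a * conj b + b * conj a \<in> J" using inJ a b J unfolding set_ideal_def by blast
    moreover have "a * conj b + b * conj a \<in> gauss_int"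
      using trace_gauss[of "a * conj b"] ab abL by (simp add: mult.commute)
    ultimately obtain t where t: "t \<in> gauss_int" "a * conj b + b * conj a = c * t"
      using c(2) by (metis IntI gdvdE)
    obtain u where u: "u \<in> gauss_int" "a * conj a = c * u"
      using c(2) inJ[OF a a] norm_gauss[OF ab(1)] by (metis IntI gdvdE)
    obtain v where v: "v \<in> gauss_int" "b * conj b = c * v"
      using c(2) inJ[OF b(1,1)] norm_gauss[OF ab(2)] by (metis IntI gdvdE)
    have "y \<in> ints"
    proof (rule ints_of_trace_norm)
      show "y \<in> L" unfolding y_def using abL cG by simp
      have "y + conj y = t" unfolding cy using t(2) c0 unfolding y_def by (simp add: field_simps)
      then show "y + conj y \<in> gauss_int" using t by simp
      have "y * conj y = (a * conj a) * (b * conj b) / (c * c)" unfolding cy unfolding y_def by (simp add: mult_ac)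
      also have "\<dots> = u * v" unfolding u(2) v(2) using c0 by simp
      finally show "y * conj y \<in> gauss_int" using u v by simp
    qed
    then show "a * b' \<in> scale c ints" unfolding in_scale_iff[OF c0] y_def b(2) .
  next
    have "set_ideal ints (scale c ints)" using c by (intro ints.set_ideal_scale_in) simp_all
    then show "x + y \<in> scale c ints" if "x \<in> scale c ints" "y \<in> scale c ints" for x y
      using that unfolding set_ideal_def by blast
  qed
  moreover have "scale c ints \<subseteq> J"
    unfolding scale_def using c(1) J by (auto simp: set_ideal_def mult.commute)
  ultimately show ?thesis using that[of c] c c0 unfolding J_def by blast
qed

end

section \<open>Primes of Z[i] in the quadratic extension and ideals with principal square\<close>

lemma gauss_rat_denominator:
  assumes "a \<in> gauss_rat"
  obtains n :: nat where "n > 0" "of_nat n * a \<in> gauss_int"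
proof -
  obtain r t where a: "a = of_rat r + of_rat t * \<i>" using assms by (rule gauss_ratE)
  obtain i j :: int where i: "j > 0" "(of_rat r :: complex) = of_int i / of_int j"
    using Rats_cases'[OF Rats_of_rat[of r]] by metis
  obtain k l :: int where k: "l > 0" "(of_rat t :: complex) = of_int k / of_int l"
    using Rats_cases'[OF Rats_of_rat[of t]] by metis
  define n where "n = nat (j * l)"
  have "n > 0" using i(1) k(1) by (simp add: n_def)
  have "of_nat n = (of_int (j * l) :: complex)"
    using i(1) k(1) unfolding n_def by (metis less_le mult_pos_pos of_int_of_nat_eq int_nat_eq)
  then have "of_nat n * a = of_int (l * i) + of_int (j * k) * \<i>"
    unfolding a i(2) k(2) using i(1) k(1) by (simp add: field_simps)
  then have "of_nat n * a \<in> gauss_int" using gauss_intI[of "l * i" "j * k"] by simp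
  then show ?thesis using that[of n] \<open>n > 0\<close> by blast
qed

lemma gprime_gnorm_gt_1: "gprime p \<Longrightarrow> gnorm p > 1"
  using gauss_unit_iff[of p] gprime_not_unit[of p] gnorm_eq_0_iff[of p] gprime_in[of p] gprime_nz[of p]
  by (metis less_one linorder_neqE_nat)

context number_field
begin

lemma primeideal_set_ideal: "primeideal P (ring_of_integers K) \<Longrightarrow> set_ideal ints P"
  using ideal_iff primeideal.axioms(1) by blast

lemma primeideal_prime:
  "primeideal P (ring_of_integers K) \<Longrightarrow> x \<in> ints \<Longrightarrow> y \<in> ints \<Longrightarrow> x * y \<in> P \<Longrightarrow> x \<in> P \<or> y \<in> P"
  using primeideal.I_prime[of P "ring_of_integers K" x y] by (simp only: ring_of_integers_simps)

lemma primeideal_proper: 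
  assumes "primeideal P (ring_of_integers K)" shows "1 \<notin> P"
proof
  assume "1 \<in> P"
  then have "P = ints" using ints.set_ideal_eq_top[OF primeideal_set_ideal[OF assms]] by blast
  then show False using primeideal.I_notcarr[OF assms] by simp
qed

end

context gauss_quadratic
begin

lemma integral_multiple:
  assumes "z \<in> L" obtains n :: nat where "n > 0" "of_nat n * z \<in> ints"
proof -
  obtain a b where z: "a \<in> gauss_rat" "b \<in> gauss_rat" "z = a + b * sqrtC d" using assms by (rule quad_extE)
  obtain n where n: "n > 0" "of_nat n * a \<in> gauss_int" using gauss_rat_denominator[OF z(1)] .
  obtain m where m: "m > 0" "of_nat m * b \<in> gauss_int" using gauss_rat_denominator[OF z(2)] .
  have "of_nat (n * m) * z = of_nat m * (of_nat n * a) + of_nat n * (of_nat m * b) * sqrtC d"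
    unfolding z(3) by (simp add: algebra_simps)
  moreover have "\<dots> \<in> ints" using n m by simp
  ultimately have "of_nat (n * m) * z \<in> ints" by (simp only:)
  then show ?thesis using n m by (intro that[of "n * m"]) simp_all
qed

lemma omega_coord_unique:
  assumes "a + b * \<omega> = a' + b' * \<omega>" "a \<in> gauss_int" "b \<in> gauss_int" "a' \<in> gauss_int" "b' \<in> gauss_int"
  shows "a = a'" "b = b'"
proof -
  have form: "a + b * \<omega> = (a + b / 2) + (b / 2) * sqrtC d" for a b
    unfolding \<omega>_def by (simp add: add_divide_distrib distrib_left)
  have "(a + b / 2) + (b / 2) * sqrtC d = (a' + b' / 2) + (b' / 2) * sqrtC d"
    using assms(1) unfolding form .
  moreover have "a + b / 2 \<in> gauss_rat" "b / 2 \<in> gauss_rat" "a' + b' / 2 \<in> gauss_rat" "b' / 2 \<in> gauss_rat"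
    by (intro assms(2-5)[THEN gauss_int_in_rat] gq.add gq.divide gq.numeral)+
  ultimately have *: "a + b / 2 = a' + b' / 2" "b / 2 = b' / 2" by (rule coord_unique)+
  from *(2) show b: "b = b'" by simp
  from *(1) show "a = a'" unfolding b by simp
qed

lemma set_ideal_scale_ints: "a \<in> ints \<Longrightarrow> set_ideal ints (scale a ints)"
  by (rule ints.set_ideal_scale_in) simp_all

text \<open>H contains pi and sqrt d, whose squares pi^2 and pi * r generate pi because pi and r are
  coprime. Conversely pi divides four times any product of two elements of H, and 4 is invertible
  modulo pi.\<close>

lemma ramified_prime_square:
  assumes H: "primeideal H (ring_of_integers L)" "\<pi> \<in> H" and \<pi>: "gprime \<pi>" "\<not> \<pi> gdvd 2"
    and r: "r \<in> gauss_int" "of_nat d = \<pi> * r" "\<not> \<pi> gdvd r"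
  shows "set_prod H H = scale \<pi> ints"
proof
  have I: "set_ideal ints H" by (rule primeideal_set_ideal[OF H(1)])
  have sub: "H \<subseteq> ints" and add: "\<And>x y. x \<in> H \<Longrightarrow> y \<in> H \<Longrightarrow> x + y \<in> H"
    and mult: "\<And>r x. r \<in> ints \<Longrightarrow> x \<in> H \<Longrightarrow> r * x \<in> H"
    using I unfolding set_ideal_def by blast+
  have \<pi>G: "\<pi> \<in> gauss_int" "\<pi> \<in> ints" "\<pi> \<noteq> 0" using \<pi>(1) by simp_all
  have "sqrtC d * sqrtC d \<in> H" unfolding sqrtC_square r(2) using mult[of r \<pi>] H(2) r(1) by (simp add: mult.commute)
  then have s: "sqrtC d \<in> H" using primeideal_prime[OF H(1) sqrtC_in_ints sqrtC_in_ints] by blast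
  have HH: "set_ideal ints (set_prod H H)" by (rule ints.set_ideal_prod[OF I I])
  have HG: "\<pi> gdvd g" if g: "g \<in> H" "g \<in> gauss_int" for g
  proof (rule ccontr)
    assume "\<not> \<pi> gdvd g"
    then obtain s t where st: "s \<in> gauss_int" "t \<in> gauss_int" "s * \<pi> + t * g = 1"
      using gprime_bezout[OF \<pi>(1) g(2)] by metis
    have "s * \<pi> + t * g \<in> H" using st(1,2) H(2) g(1) by (intro add mult) simp_all
    then show False using primeideal_proper[OF H(1)] unfolding st(3) by blast
  qed
  obtain a b where ab: "a \<in> gauss_int" "b \<in> gauss_int" "a * \<pi> + b * r = 1"
    using gprime_bezout[OF \<pi>(1) r(1,3)] .
  have "a * (\<pi> * \<pi>) + b * (sqrtC d * sqrtC d) = \<pi> * (a * \<pi> + b * r)"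
    unfolding sqrtC_square r(2) by (simp add: algebra_simps)
  also have "\<dots> = \<pi>" unfolding ab(3) by simp
  finally have eq: "a * (\<pi> * \<pi>) + b * (sqrtC d * sqrtC d) = \<pi>" .
  have "\<pi> * \<pi> \<in> set_prod H H" "sqrtC d * sqrtC d \<in> set_prod H H"
    by (rule set_prod.prod[OF H(2) H(2)], rule set_prod.prod[OF s s])
  moreover have "a \<in> ints" "b \<in> ints" using ab by simp_all
  ultimately have "a * (\<pi> * \<pi>) + b * (sqrtC d * sqrtC d) \<in> set_prod H H"
    using HH unfolding set_ideal_def by blast
  then have "\<pi> \<in> set_prod H H" unfolding eq .
  then show "scale \<pi> ints \<subseteq> set_prod H H"
    using HH unfolding set_ideal_def scale_def by (auto simp: mult.commute)
  obtain u v where uv: "u \<in> gauss_int" "v \<in> gauss_int" "u * \<pi> + v * 4 = 1"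
  proof -
    have "\<not> \<pi> gdvd 2 * 2" using gprime_dvd_mult[OF \<pi>(1), of 2 2] \<pi>(2) by auto
    then have "\<not> \<pi> gdvd 4" by simp
    then show ?thesis using gprime_bezout[OF \<pi>(1), of 4] that by auto
  qed
  \<comment> \<open>Doubling replaces the basis 1, omega by 1, sqrt d. As sqrt d lies in H, so does
    the first coordinate, which is then a multiple of pi.\<close>
  have half: "\<exists>g\<in>gauss_int. \<exists>b\<in>gauss_int. 2 * x = \<pi> * g + b * sqrtC d" if x: "x \<in> H" for x
  proof -
    obtain a b where ab: "a \<in> gauss_int" "b \<in> gauss_int" "x = a + b * \<omega>"
      using intsE x sub by (metis subsetD)
    have *: "2 * x = (2 * a + b) + b * sqrtC d" unfolding ab(3) sqrtC_omega by (simp add: algebra_simps)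
    have "2 * x + (- b) * sqrtC d \<in> H" using x s ab by (intro add mult) simp_all
    then have "2 * a + b \<in> H" unfolding * by simp
    then have "\<pi> gdvd 2 * a + b" using HG ab by simp
    then obtain g where "g \<in> gauss_int" "2 * a + b = \<pi> * g" by (rule gdvdE)
    then show ?thesis using * ab(2) by metis
  qed
  have scI: "set_ideal ints (scale \<pi> ints)" by (rule set_ideal_scale_ints[OF \<pi>G(2)])
  show "set_prod H H \<subseteq> scale \<pi> ints"
  proof (rule set_prod_subsetI)
    fix x y assume x: "x \<in> H" and y: "y \<in> H"
    obtain g b where gb: "g \<in> gauss_int" "b \<in> gauss_int" "2 * x = \<pi> * g + b * sqrtC d" using half[OF x] by blast
    obtain g' b' where gb': "g' \<in> gauss_int" "b' \<in> gauss_int" "2 * y = \<pi> * g' + b' * sqrtC d" using half[OF y] by blast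
    have "4 * (x * y) = (2 * x) * (2 * y)" by simp
    also have "\<dots> = \<pi> * (\<pi> * g * g' + (g * b' + g' * b) * sqrtC d) + b * b' * (sqrtC d * sqrtC d)"
      unfolding gb(3) gb'(3) by (simp add: algebra_simps del: sqrtC_square)
    also have "\<dots> = \<pi> * (\<pi> * g * g' + (g * b' + g' * b) * sqrtC d + b * b' * r)"
      unfolding sqrtC_square r(2) by (simp add: algebra_simps)
    finally have four: "4 * (x * y) = \<pi> * (\<pi> * g * g' + (g * b' + g' * b) * sqrtC d + b * b' * r)" .
    have xy: "x \<in> ints" "y \<in> ints" using x y sub by auto
    have "x * y = (u * \<pi> + v * 4) * (x * y)" unfolding uv(3) by simp
    also have "\<dots> = \<pi> * (u * (x * y)) + v * (4 * (x * y))" by (simp add: algebra_simps)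
    also have "\<dots> = \<pi> * (u * (x * y) + v * (\<pi> * g * g' + (g * b' + g' * b) * sqrtC d + b * b' * r))"
      unfolding four by (simp add: algebra_simps)
    finally have "x * y = \<pi> * (u * (x * y) + v * (\<pi> * g * g' + (g * b' + g' * b) * sqrtC d + b * b' * r))" .
    moreover have "u * (x * y) + v * (\<pi> * g * g' + (g * b' + g' * b) * sqrtC d + b * b' * r) \<in> ints"
      using uv(1,2) xy \<pi>G gb(1,2) gb'(1,2) r(1) by simp
    ultimately show "x * y \<in> scale \<pi> ints" unfolding scale_def by blast
  qed (use scI in \<open>unfold set_ideal_def, blast\<close>)
qed

text \<open>The discriminant of X^2 - X - D is d: if pi does not divide the coordinate b of omega,
  then b = -2 a modulo pi and the other coordinate of x^2 becomes a^2 * d. As d is odd, the prime 1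
  + i is covered.\<close>

lemma unramified_radical:
  assumes \<pi>: "gprime \<pi>" "\<not> \<pi> gdvd of_nat d" and x: "x \<in> ints" "x * x \<in> scale \<pi> ints"
  shows "x \<in> scale \<pi> ints"
proof -
  have \<pi>G: "\<pi> \<in> gauss_int" "\<pi> \<noteq> 0" using \<pi>(1) by simp_all
  obtain a b where ab: "a \<in> gauss_int" "b \<in> gauss_int" "x = a + b * \<omega>" using x(1) by (rule intsE)
  obtain y where y: "y \<in> ints" "x * x = \<pi> * y" using x(2) unfolding scale_def by blast
  obtain e g where eg: "e \<in> gauss_int" "g \<in> gauss_int" "y = e + g * \<omega>" using y(1) by (rule intsE)
  have "x * x = a * a + (2 * a * b) * \<omega> + b * b * (\<omega> * \<omega>)" unfolding ab(3) by (simp add: algebra_simps)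
  also have "\<dots> = (a * a + b * b * D) + (b * (b + 2 * a)) * \<omega>" unfolding omega_square by (simp add: algebra_simps)
  finally have "(a * a + b * b * D) + (b * (b + 2 * a)) * \<omega> = \<pi> * e + (\<pi> * g) * \<omega>"
    unfolding y(2) eg(3) by (simp add: algebra_simps)
  then have *: "a * a + b * b * D = \<pi> * e" "b * (b + 2 * a) = \<pi> * g"
    using omega_coord_unique[of "a * a + b * b * D" "b * (b + 2 * a)" "\<pi> * e" "\<pi> * g"] ab(1,2) eg(1,2) \<pi>G by simp_all
  have div1: "\<pi> gdvd a * a + b * b * D" unfolding *(1) using eg(1) by simp
  have div2: "\<pi> gdvd b * (b + 2 * a)" unfolding *(2) using eg(2) by simp
  have "\<pi> gdvd a \<and> \<pi> gdvd b"
  proof (cases "\<pi> gdvd b")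
    case True
    then have "\<pi> gdvd b * (b * D)" using ab by (intro gdvd_mult_right) simp_all
    then have "\<pi> gdvd (a * a + b * b * D) - b * (b * D)" using div1 by (intro gdvd_diff)
    then have "\<pi> gdvd a * a" by (simp add: mult.assoc)
    then show ?thesis using True gprime_dvd_mult[OF \<pi>(1) ab(1,1)] by blast
  next
    case False
    then have div3: "\<pi> gdvd b + 2 * a" using gprime_dvd_mult[OF \<pi>(1) ab(2) _ div2] ab by simp
    then have "\<pi> gdvd (b + 2 * a) * (D * (b - 2 * a))" using ab by (intro gdvd_mult_right) simp_all
    then have "\<pi> gdvd (a * a + b * b * D) - (b + 2 * a) * (D * (b - 2 * a))" using div1 by (intro gdvd_diff)
    moreover have "(a * a + b * b * D) - (b + 2 * a) * (D * (b - 2 * a)) = (a * a) * of_nat d"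
      unfolding d_eq by (simp add: algebra_simps)
    ultimately have "\<pi> gdvd (a * a) * of_nat d" by (simp only:)
    then have "\<pi> gdvd a * a" using gprime_dvd_mult[OF \<pi>(1), of "a * a" "of_nat d"] \<pi>(2) ab(1) by simp
    then have a: "\<pi> gdvd a" using gprime_dvd_mult[OF \<pi>(1) ab(1,1)] by blast
    have "\<pi> gdvd (b + 2 * a) - 2 * a" by (rule gdvd_diff[OF div3]) (use a in simp)
    then show ?thesis using a by simp
  qed
  then obtain a' b' where "a' \<in> gauss_int" "b' \<in> gauss_int" "a = \<pi> * a'" "b = \<pi> * b'" by (elim conjE gdvdE)
  then have "x = \<pi> * (a' + b' * \<omega>)" "a' + b' * \<omega> \<in> ints" unfolding ab(3) by (simp_all add: algebra_simps)
  then show ?thesis unfolding scale_def by blast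
qed

lemma square_subset_prime:
  assumes "primeideal P (ring_of_integers L)" "J \<subseteq> ints" "set_prod J J \<subseteq> P" shows "J \<subseteq> P"
proof
  fix x assume x: "x \<in> J"
  then have "x * x \<in> P" using assms(3) set_prod.prod[OF x x] by blast
  then show "x \<in> P" using primeideal_prime[OF assms(1)] x assms(2) by blast
qed

text \<open>Strip one prime pi from c at a time. If pi = P^2 ramifies, J lies in P and J * P / pi
  has square (c / pi). Otherwise J / pi is an integral ideal of the same class with square (c /
  pi^2). Asking that S be closed under multiplication by the classes of A lets a generated subgroup
  take its place.\<close>

lemma class_of_ideal_with_principal_square:
  assumes ram: "\<And>\<pi>. gprime \<pi> \<Longrightarrow> \<pi> gdvd of_nat d \<Longrightarrow> \<exists>P\<in>A. set_prod P P = scale \<pi> ints"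
    and prime: "\<And>P. P \<in> A \<Longrightarrow> primeideal P (ring_of_integers L) \<and> P \<in> nonzero_ideals L"
    and S: "\<one>\<^bsub>class_group L\<^esub> \<in> S" "\<And>s P. s \<in> S \<Longrightarrow> P \<in> A \<Longrightarrow> s \<otimes>\<^bsub>class_group L\<^esub> cls P \<in> S"
  shows "J \<in> nonzero_ideals L \<Longrightarrow> c \<in> gauss_int \<Longrightarrow> set_prod J J = scale c ints \<Longrightarrow> cls J \<in> S"
proof (induction "gnorm c" arbitrary: J c rule: less_induct)
  case less
  have J: "set_ideal ints J" using less.prems(1) by (rule nonzero_idealsD)
  have Jsub: "J \<subseteq> ints" using J by (simp add: set_ideal_def)
  have c0: "c \<noteq> 0"
  proof
    assume "c = 0"
    obtain x where x: "x \<in> J" "x \<noteq> 0" using less.prems(1) by (rule nonzero_idealE)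
    have "x * x \<in> scale c ints" unfolding less.prems(3)[symmetric] by (rule set_prod.prod[OF x(1,1)])
    then show False using x \<open>c = 0\<close> by (auto simp: scale_def)
  qed
  show ?case
  proof (cases "c gdvd 1")
    case True
    then obtain e where e: "e \<in> gauss_int" "1 = c * e" by (rule gdvdE)
    have "c * e \<in> scale c ints" unfolding scale_def using e(1) by (intro imageI) simp
    then have "1 \<in> set_prod J J" unfolding less.prems(3) e(2)[symmetric] .
    then have "1 \<in> J" using ints.set_ideal_prod_subset[OF J J] by blast
    then have "J = ints" by (rule ints.set_ideal_eq_top[OF J])
    then show ?thesis using S(1) by (simp add: class_group_one)
  next
    case False
    then obtain \<pi> where \<pi>: "gprime \<pi>" "\<pi> gdvd c" using gprime_factor_exists[OF less.prems(2) c0] by blast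
    then obtain c' where c': "c' \<in> gauss_int" "c = \<pi> * c'" by (elim gdvdE)
    have \<pi>G: "\<pi> \<in> gauss_int" "\<pi> \<noteq> 0" "\<pi> \<in> ints" using \<pi>(1) by simp_all
    have gn: "gnorm c = gnorm \<pi> * gnorm c'" unfolding c'(2) by (rule gnorm_mult[OF \<pi>G(1) c'(1)])
    have c'0: "c' \<noteq> 0" using c0 unfolding c'(2) by auto
    have gc': "gnorm c' > 0" using gnorm_eq_0_iff[OF c'(1)] c'0 by simp
    have smaller: "gnorm c' < gnorm c" unfolding gn using gc' gprime_gnorm_gt_1[OF \<pi>(1)] by simp
    have sub: "scale c ints \<subseteq> scale \<pi> ints"
    proof
      fix z assume "z \<in> scale c ints"
      then obtain y where "y \<in> ints" "z = c * y" unfolding scale_def by blast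
      then have "z = \<pi> * (c' * y)" "c' * y \<in> ints" using c' by (simp_all add: mult.assoc)
      then show "z \<in> scale \<pi> ints" unfolding scale_def by blast
    qed
    show ?thesis
    proof (cases "\<pi> gdvd of_nat d")
      case True
      obtain P where P: "P \<in> A" "set_prod P P = scale \<pi> ints" using ram[OF \<pi>(1) True] by blast
      have Pp: "primeideal P (ring_of_integers L)" "P \<in> nonzero_ideals L" using prime[OF P(1)] by blast+
      have PI: "set_ideal ints P" using Pp(2) by (rule nonzero_idealsD)
      have "set_prod J J \<subseteq> P"
        using sub ints.set_ideal_prod_subset[OF PI PI] unfolding less.prems(3) P(2) by blast
      then have JP: "J \<subseteq> P" by (rule square_subset_prime[OF Pp(1) Jsub])
      \<comment> \<open>Since P^2 = (pi), dividing J by P amounts to multiplying by P and dividing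
        by pi.\<close>
      define J' where "J' = scale (1 / \<pi>) (set_prod J P)"
      have "set_prod J P \<subseteq> scale \<pi> ints" unfolding P(2)[symmetric] by (rule set_prod_mono[OF JP subset_refl])
      then have "J' \<subseteq> ints" unfolding J'_def scale_def using \<pi>G(2) by auto
      then have J'n: "J' \<in> nonzero_ideals L" unfolding J'_def
        using less.prems(1) Pp(2) \<pi>G(2) by (intro nonzero_ideals_scale) simp_all
      have "set_prod J' J' = scale (1 / \<pi> * (1 / \<pi>)) (set_prod (set_prod J J) (set_prod P P))"
        unfolding J'_def by (simp add: set_prod_ac)
      also have "\<dots> = scale c' ints"
        unfolding P(2) less.prems(3) unfolding c'(2) using \<pi>G(2) by simp
      finally have "cls J' \<in> S" using less.hyps[OF smaller J'n c'(1)] by blast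
      then have "cls J' \<otimes>\<^bsub>class_group L\<^esub> cls P \<in> S" using S(2) P(1) by blast
      moreover have "set_prod J' P = J"
      proof -
        have "set_prod J' P = scale (1 / \<pi>) (set_prod J (set_prod P P))"
          unfolding J'_def by (simp add: set_prod_assoc)
        also have "\<dots> = J" unfolding P(2) using \<pi>G(2) J by simp
        finally show ?thesis .
      qed
      ultimately show ?thesis using class_group_mult[OF J'n Pp(2)] by simp
    next
      case False
      have Jpi: "J \<subseteq> scale \<pi> ints"
      proof
        fix x assume x: "x \<in> J"
        have "x * x \<in> scale \<pi> ints" using set_prod.prod[OF x x] sub unfolding less.prems(3) by blast
        then show "x \<in> scale \<pi> ints" using unramified_radical[OF \<pi>(1) False] x Jsub by blast
      qed
      define J' where "J' = scale (1 / \<pi>) J"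
      have J'sub: "J' \<subseteq> ints" unfolding J'_def using Jpi \<pi>G(2) unfolding scale_def by auto
      have J'n: "J' \<in> nonzero_ideals L" "cls J' = cls J"
        using cls_scale[OF less.prems(1), of 1 \<pi> J'] \<pi>G J'sub unfolding J'_def by simp_all
      \<comment> \<open>Integrality of c / pi^2 will be read off from the square of
        \<open>J'\<close>, an integral ideal that contains it.\<close>
      define e where "e = c / (\<pi> * \<pi>)"
      have sq: "set_prod J' J' = scale e ints" unfolding J'_def e_def using less.prems(3) by (simp add: field_simps)
      have "e * 1 \<in> scale e ints" unfolding scale_def by (intro imageI) simp
      then have "e \<in> ints"
        using ints.set_ideal_prod[OF nonzero_idealsD[OF J'n(1)] nonzero_idealsD[OF J'n(1)]]
        unfolding sq set_ideal_def by auto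
      then have eG: "e \<in> gauss_int"
        by (intro gauss_intI_integral) (use less.prems(2) \<pi>G in \<open>simp_all add: e_def integers_of_def\<close>)
      have "c' = \<pi> * e" unfolding e_def c'(2) using \<pi>G(2) by simp
      then have gn': "gnorm c' = gnorm \<pi> * gnorm e" using gnorm_mult[OF \<pi>G(1) eG] by simp
      have "gnorm e \<le> gnorm c'" unfolding gn' using gprime_gnorm_gt_1[OF \<pi>(1)] by simp
      then show ?thesis using less.hyps[OF _ J'n(1) eG sq] smaller unfolding J'n(2) by linarith
    qed
  qed
qed

text \<open>Write gamma = delta / conj delta. Scaling I by an integral multiple of conj delta gives
  an ideal J equal to its own conjugate, so J^2 = J * conj J is principal.\<close>

lemma hilbert90_representative:
  assumes I: "I \<in> nonzero_ideals L" and \<gamma>: "\<gamma> \<in> L" "\<gamma> * conj \<gamma> = 1" "scale \<gamma> (conj ` I) = I"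
  obtains J c where "J \<in> nonzero_ideals L" "cls J = cls I" "c \<in> gauss_int" "set_prod J J = scale c ints"
proof -
  \<comment> \<open>The choice 1 + gamma works unless it vanishes, and sqrt d settles gamma =
    -1.\<close>
  obtain \<delta> where \<delta>: "\<delta> \<in> L" "\<delta> \<noteq> 0" "\<gamma> * conj \<delta> = \<delta>"
  proof (cases "\<gamma> = - 1")
    case True
    have "sqrtC d \<noteq> 0" using sqrt_notin by auto
    then show ?thesis using that[of "sqrtC d"] True by simp
  next
    case False
    then have "1 + \<gamma> \<noteq> 0" by (metis add_eq_0_iff)
    moreover have "\<gamma> * conj (1 + \<gamma>) = 1 + \<gamma>" using \<gamma> by (simp add: distrib_left)
    ultimately show ?thesis using that[of "1 + \<gamma>"] \<gamma>(1) by simp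
  qed
  obtain n where n: "n > 0" "of_nat n * conj \<delta> \<in> ints" using integral_multiple[of "conj \<delta>"] \<delta>(1) by auto
  define \<epsilon> where "\<epsilon> = of_nat n * conj \<delta>"
  have \<epsilon>: "\<epsilon> \<in> ints" "\<epsilon> \<noteq> 0" using n \<delta> by (simp_all add: \<epsilon>_def)
  have IL: "set_ideal ints I" "I \<subseteq> L" using nonzero_idealsD[OF I] ideal_in_ints ints_in_L by blast+
  define J where "J = scale \<epsilon> I"
  have Jsub: "J \<subseteq> ints" unfolding J_def using ints.set_ideal_scale_in[OF \<epsilon>(1) IL(1)] by (simp add: set_ideal_def)
  have J: "J \<in> nonzero_ideals L" "cls J = cls I"
    using cls_scale[OF I, of \<epsilon> 1 J] \<epsilon> Jsub unfolding J_def by simp_all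
  have "conj \<epsilon> = \<epsilon> * \<gamma>"
    unfolding \<epsilon>_def using \<delta> by (simp add: mult_ac)
  then have "conj ` J = scale (\<epsilon> * \<gamma>) (conj ` I)"
    unfolding J_def using conj_image_scale[OF ints_in_L[OF \<epsilon>(1)] IL(2)] by simp
  also have "\<dots> = scale \<epsilon> (scale \<gamma> (conj ` I))" by simp
  also have "\<dots> = J" unfolding \<gamma>(3) J_def ..
  finally have "conj ` J = J" .
  then show ?thesis using ideal_norm_principal[OF J(1)] that[OF J] by metis
qed

end

section \<open>Pell equations\<close>

lemma sqrt_irrational_or_square:
  assumes "sqrt (real D) \<in> \<rat>" shows "\<exists>t::nat. D = t\<^sup>2"
proof -
  have "algebraic_int (sqrt (real D))" by (intro algebraic_int_sqrt int_imp_algebraic_int) simp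
  then have "sqrt (real D) \<in> \<int>" using assms by (rule rational_algebraic_int_is_int)
  then obtain t :: int where t: "sqrt (real D) = of_int t" by (auto elim: Ints_cases)
  have "real_of_int t \<ge> 0" unfolding t[symmetric] by simp
  then have t0: "t \<ge> 0" by simp
  have "real D = (sqrt (real D))\<^sup>2" by simp
  then have "real_of_int (int D) = real_of_int (t\<^sup>2)" unfolding t by simp
  then have "int D = t\<^sup>2" by (simp only: of_int_eq_iff)
  also have "\<dots> = int ((nat t)\<^sup>2)" using t0 by simp
  finally have "D = (nat t)\<^sup>2" by (simp only: of_nat_eq_iff)
  then show ?thesis by blast
qed

text \<open>Infinitely many h / k lie within 1 / k^2 of sqrt D and give bounded norms h^2 - D k^2.
  Two such pairs with the same norm c that agree modulo c have a quotient with integral coordinates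
  and norm 1.\<close>

lemma pell_solution_int:
  fixes D :: nat
  assumes nonsq: "\<And>t::nat. D \<noteq> t\<^sup>2"
  obtains u v :: int where "v \<noteq> 0" "u\<^sup>2 - int D * v\<^sup>2 = 1"
proof -
  define \<theta> where "\<theta> = sqrt (real D)"
  have "\<theta> \<notin> \<rat>" using nonsq sqrt_irrational_or_square unfolding \<theta>_def by blast
  then have inf: "infinite (approx_set \<theta>)" using rational_iff_finite_approx_set by blast
  have D: "D \<ge> 2" using nonsq[of 0] nonsq[of 1] by (simp add: Suc_le_eq numeral_2_eq_2)
  have th: "\<theta> \<ge> 1" "\<theta>\<^sup>2 = real D" using D by (simp_all add: \<theta>_def)
  define nrm where "nrm = (\<lambda>(h::int, k::int). h\<^sup>2 - int D * k\<^sup>2)"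
  \<comment> \<open>The norm is the product of k theta - h, of size below 1 / k, and h + k theta, of
    size at most 2 k theta + 1.\<close>
  define B where "B = \<lceil>2 * \<theta> + 1\<rceil>"
  have pos: "k > 0 \<and> h > 0 \<and> nrm (h, k) \<in> {- B..B}" if "(h, k) \<in> approx_set \<theta>" for h k
  proof -
    have k: "k > 0" and close: "\<bar>\<theta> - of_int h / of_int k\<bar> < 1 / (of_int k)\<^sup>2"
      using that by (auto simp: approx_set_def)
    have kr: "(of_int k :: real) \<ge> 1" using k by simp
    have "\<bar>of_int k * \<theta> - of_int h\<bar> = of_int k * \<bar>\<theta> - of_int h / of_int k\<bar>"
      using kr by (simp add: abs_mult_pos' right_diff_distrib)
    also have "\<dots> < of_int k * (1 / (of_int k)\<^sup>2)" using close kr by (intro mult_strict_left_mono) auto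
    also have "\<dots> = 1 / of_int k" using kr by (simp add: power2_eq_square)
    finally have c1: "\<bar>of_int k * \<theta> - of_int h\<bar> < 1 / of_int k" .
    also have "\<dots> \<le> 1" using kr by simp
    finally have c2: "\<bar>of_int k * \<theta> - of_int h\<bar> < 1" .
    have kth: "of_int k * \<theta> \<ge> 1" using mult_mono[OF kr th(1)] k by simp
    then have h0: "(of_int h :: real) > 0" using c2 by linarith
    have "\<bar>of_int h + of_int k * \<theta>\<bar> \<le> 2 * (of_int k * \<theta>) + 1" using c2 kth h0 by linarith
    then have "\<bar>of_int k * \<theta> - of_int h\<bar> * \<bar>of_int h + of_int k * \<theta>\<bar> \<le> (1 / of_int k) * (2 * (of_int k * \<theta>) + 1)"
      using kr by (intro mult_mono[OF less_imp_le[OF c1]]) simp_all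
    also have "\<dots> = 2 * \<theta> + 1 / of_int k" using kr by (simp add: field_simps)
    also have "\<dots> \<le> 2 * \<theta> + 1" using kr by simp
    finally have "\<bar>(of_int k * \<theta> - of_int h) * (of_int h + of_int k * \<theta>)\<bar> \<le> 2 * \<theta> + 1" by (simp only: abs_mult)
    moreover have "(of_int k * \<theta> - of_int h) * (of_int h + of_int k * \<theta>) = - of_int (nrm (h, k))"
      unfolding nrm_def using th(2) by (simp add: algebra_simps power2_eq_square)
    ultimately have "\<bar>of_int (nrm (h, k)) :: real\<bar> \<le> 2 * \<theta> + 1" by simp
    moreover have "2 * \<theta> + 1 \<le> of_int B" unfolding B_def by (rule le_of_int_ceiling)
    ultimately have "of_int (nrm (h, k)) \<le> (of_int B :: real)" "of_int (- B) \<le> (of_int (nrm (h, k)) :: real)"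
      by (simp_all add: abs_le_iff)
    then have "nrm (h, k) \<le> B" "- B \<le> nrm (h, k)" by (simp_all only: of_int_le_iff)
    then show ?thesis using k h0 by simp
  qed
  have "nrm ` approx_set \<theta> \<subseteq> {- B..B}" using pos by auto
  then have "finite (nrm ` approx_set \<theta>)" by (rule finite_subset) simp
  then obtain a0 where "a0 \<in> approx_set \<theta>" and inf1: "infinite {a \<in> approx_set \<theta>. nrm a = nrm a0}"
    using pigeonhole_infinite[OF inf] by blast
  define c where "c = nrm a0"
  define A where "A = {a \<in> approx_set \<theta>. nrm a = c}"
  have infA: "infinite A" using inf1 by (simp add: A_def c_def)
  have c0: "c \<noteq> 0"
  proof
    assume "c = 0"
    obtain h k where hk: "a0 = (h, k)" by force
    then have "k > 0" "h > 0" using pos \<open>a0 \<in> approx_set \<theta>\<close> by auto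
    have "h\<^sup>2 = int D * k\<^sup>2" using \<open>c = 0\<close> hk by (simp add: c_def nrm_def)
    then have "real_of_int (h\<^sup>2) = real_of_int (int D * k\<^sup>2)" by (simp only:)
    then have "(of_int h)\<^sup>2 = (\<theta> * of_int k)\<^sup>2" using th(2) by (simp add: power_mult_distrib)
    then have "of_int h = \<theta> * of_int k" using \<open>k > 0\<close> \<open>h > 0\<close> th(1) by (simp add: power2_eq_iff_nonneg)
    then have "\<theta> = of_int h / of_int k" using \<open>k > 0\<close> by simp
    then show False using \<open>\<theta> \<notin> \<rat>\<close> by simp
  qed
  define r where "r = (\<lambda>(h, k). (h mod \<bar>c\<bar>, k mod \<bar>c\<bar>))"
  have "r ` A \<subseteq> {0..<\<bar>c\<bar>} \<times> {0..<\<bar>c\<bar>}" using c0 by (auto simp: r_def)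
  then have "finite (r ` A)" by (rule finite_subset) simp
  then obtain a1 where a1: "a1 \<in> A" and inf2: "infinite {a \<in> A. r a = r a1}"
    using pigeonhole_infinite[OF infA] by blast
  have "infinite ({a \<in> A. r a = r a1} - {a1})" using inf2 by (rule infinite_remove)
  then obtain a2 where a2: "a2 \<in> A" "r a2 = r a1" "a2 \<noteq> a1" using infinite_imp_nonempty by blast
  obtain h1 k1 where 1: "a1 = (h1, k1)" by force
  obtain h2 k2 where 2: "a2 = (h2, k2)" by force
  have n: "h1\<^sup>2 - int D * k1\<^sup>2 = c" "h2\<^sup>2 - int D * k2\<^sup>2 = c" using a1 a2(1) by (auto simp: A_def nrm_def 1 2)
  have p: "k1 > 0" "h1 > 0" "k2 > 0" "h2 > 0" using a1 a2(1) pos by (auto simp: A_def 1 2)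
  have "h2 mod \<bar>c\<bar> = h1 mod \<bar>c\<bar>" "k2 mod \<bar>c\<bar> = k1 mod \<bar>c\<bar>" using a2(2) by (simp_all add: r_def 1 2)
  then have "\<bar>c\<bar> dvd h2 - h1" "\<bar>c\<bar> dvd k2 - k1" by (simp_all add: mod_eq_dvd_iff)
  then have "c dvd h2 - h1" "c dvd k2 - k1" by simp_all
  then obtain s t where "h2 - h1 = c * s" "k2 - k1 = c * t" by (elim dvdE)
  then have st: "h2 = h1 + c * s" "k2 = k1 + c * t" by (simp_all add: algebra_simps)
  \<comment> \<open>The coordinates of (h1 - k1 sqrt D) (h2 + k2 sqrt D); the congruences modulo c
    make both divisible by c.\<close>
  define X' Y' where "X' = h1 * h2 - int D * k1 * k2" "Y' = h1 * k2 - h2 * k1"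
  have Xe: "X' = c * (1 + h1 * s - int D * k1 * t)"
  proof -
    have "X' = (h1\<^sup>2 - int D * k1\<^sup>2) + c * (h1 * s - int D * k1 * t)"
      unfolding X'_Y'_def st by (simp add: algebra_simps power2_eq_square)
    then show ?thesis unfolding n(1) by (simp add: algebra_simps)
  qed
  have Ye: "Y' = c * (h1 * t - s * k1)" unfolding X'_Y'_def st by (simp add: algebra_simps)
  define u v where "u = 1 + h1 * s - int D * k1 * t" "v = h1 * t - s * k1"
  have X: "X' = c * u" and Y: "Y' = c * v" unfolding Xe Ye u_v_def by (rule refl)+
  have "c\<^sup>2 * (u\<^sup>2 - int D * v\<^sup>2) = X'\<^sup>2 - int D * Y'\<^sup>2"
    unfolding X Y by (simp add: power_mult_distrib right_diff_distrib)
  also have "\<dots> = (h1\<^sup>2 - int D * k1\<^sup>2) * (h2\<^sup>2 - int D * k2\<^sup>2)"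
    unfolding X'_Y'_def by (simp add: algebra_simps power2_eq_square)
  also have "\<dots> = c\<^sup>2 * 1" unfolding n by (simp add: power2_eq_square)
  finally have "u\<^sup>2 - int D * v\<^sup>2 = 1" using c0 by simp
  \<comment> \<open>If v = 0 the two fractions coincide, and the equal norms then make the pairs
    themselves equal.\<close>
  moreover have "v \<noteq> 0"
  proof
    assume "v = 0"
    then have cross: "h1 * k2 = h2 * k1" using Y unfolding X'_Y'_def by simp
    have "c * k2\<^sup>2 = (h1 * k2)\<^sup>2 - int D * k1\<^sup>2 * k2\<^sup>2" unfolding n(1)[symmetric] by (simp add: algebra_simps power_mult_distrib)
    also have "\<dots> = k1\<^sup>2 * (h2\<^sup>2 - int D * k2\<^sup>2)" unfolding cross by (simp add: algebra_simps power_mult_distrib)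
    also have "\<dots> = c * k1\<^sup>2" unfolding n(2) by simp
    finally have "k2\<^sup>2 = k1\<^sup>2" using c0 by simp
    then have "k2 = k1" using p by (simp add: power2_eq_iff_nonneg)
    then have "h1 = h2" using cross p by simp
    then show False using \<open>k2 = k1\<close> a2(3) 1 2 by simp
  qed
  ultimately show ?thesis using that by blast
qed

text \<open>Minimality of \<open>y\<close> will exclude the case in which all primes of
  \<open>D\<close> divide the smaller of two consecutive factors.\<close>

lemma pell_minimal:
  fixes D :: nat
  assumes "\<And>t::nat. D \<noteq> t\<^sup>2"
  obtains x y :: nat where "y > 0" "x\<^sup>2 = D * y\<^sup>2 + 1" "\<And>x' y'. y' > 0 \<Longrightarrow> x'\<^sup>2 = D * y'\<^sup>2 + 1 \<Longrightarrow> y \<le> y'"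
proof -
  obtain u v :: int where uv: "v \<noteq> 0" "u\<^sup>2 - int D * v\<^sup>2 = 1" using pell_solution_int[OF assms] by metis
  have "int ((nat \<bar>u\<bar>)\<^sup>2) = int (D * (nat \<bar>v\<bar>)\<^sup>2 + 1)" using uv(2) by simp
  then have "(nat \<bar>u\<bar>)\<^sup>2 = D * (nat \<bar>v\<bar>)\<^sup>2 + 1" by (simp only: of_nat_eq_iff)
  then have ex: "nat \<bar>v\<bar> > 0 \<and> (\<exists>x. x\<^sup>2 = D * (nat \<bar>v\<bar>)\<^sup>2 + 1)" using uv(1) by auto
  obtain y where y: "y > 0 \<and> (\<exists>x::nat. x\<^sup>2 = D * y\<^sup>2 + 1)"
    and min: "\<And>z. z > 0 \<and> (\<exists>x::nat. x\<^sup>2 = D * z\<^sup>2 + 1) \<Longrightarrow> y \<le> z"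
    using ex_has_least_nat[of "\<lambda>y. y > 0 \<and> (\<exists>x::nat. x\<^sup>2 = D * y\<^sup>2 + 1)", OF ex, of "\<lambda>y. y"] by blast
  then show ?thesis using that by blast
qed

lemma coprime_mult_square:
  fixes u v w :: nat
  assumes "Rings.coprime u v" "u * v = w\<^sup>2" "u > 0" "v > 0"
  obtains a b where "u = a\<^sup>2" "v = b\<^sup>2"
proof -
  have "is_nth_power 2 (u * v)" unfolding assms(2) by (auto simp: is_nth_power_def)
  then have "is_nth_power 2 u" "is_nth_power 2 v"
    using is_nth_power_mult_coprime_natD[of u v 2] assms by auto
  then show ?thesis using that by (auto simp: is_nth_power_def)
qed

lemma coprime_mult_prime:
  fixes u v w q :: nat
  assumes "Factorial_Ring.prime q" "Rings.coprime u v" "u * v = q * w" "u > 0" "v > 0"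
  obtains u' where "u = q * u'" "Rings.coprime u' v" "u' * v = w" "u' > 0"
  | v' where "v = q * v'" "Rings.coprime u v'" "u * v' = w" "v' > 0"
proof -
  have q0: "q > 0" using assms(1) by (simp add: prime_gt_0_nat)
  have "q dvd u * v" unfolding assms(3) by simp
  then consider u' where "u = q * u'" | v' where "v = q * v'"
    using prime_dvd_mult_nat[OF assms(1)] by (auto elim!: dvdE)
  then show ?thesis
  proof cases
    case 1
    have "q * (u' * v) = q * w" using assms(3) unfolding 1 by (simp add: mult.assoc)
    then have "u' * v = w" using q0 by simp
    moreover have "Rings.coprime u' v" using assms(2) unfolding 1 by simp
    moreover have "u' > 0" using assms(4) unfolding 1 by simp
    ultimately show ?thesis using that(1) 1 by blast
  next
    case 2
    have "q * (u * v') = q * w" using assms(3) unfolding 2 by (simp add: mult_ac)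
    then have "u * v' = w" using q0 by simp
    moreover have "Rings.coprime u v'" using assms(2) unfolding 2 by simp
    moreover have "v' > 0" using assms(5) unfolding 2 by simp
    ultimately show ?thesis using that(2) 2 by blast
  qed
qed

text \<open>\<open>q\<close> stays prime in Z[i] and divides (a + b i) (a - b i), hence one of the
  factors, and therefore its coordinates.\<close>

lemma prime_3_mod_4_dvd_sum_squares:
  fixes q :: nat and a b :: int
  assumes "Factorial_Ring.prime q" "q mod 4 = 3" "int q dvd a\<^sup>2 + b\<^sup>2"
  shows "int q dvd b"
proof -
  obtain k where k: "a\<^sup>2 + b\<^sup>2 = int q * k" using assms(3) by (rule dvdE)
  define z where "z = of_int a + of_int b * \<i>"
  have z: "z \<in> gauss_int" unfolding z_def by (rule gauss_intI)
  have "z * cnj z = of_int (a\<^sup>2 + b\<^sup>2)" unfolding z_def by (simp add: algebra_simps power2_eq_square)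
  also have "\<dots> = of_nat q * of_int k" unfolding k by simp
  finally have "of_nat q gdvd z * cnj z" by (intro gdvdI[of "of_int k"]) simp_all
  then have "of_nat q gdvd z \<or> of_nat q gdvd cnj z"
    using gprime_dvd_mult[OF gprime_inert[OF assms(1,2)] z] z by simp
  then obtain g where g: "g \<in> gauss_int" "z = of_nat q * g \<or> cnj z = of_nat q * g" by (auto elim!: gdvdE)
  obtain r s where rs: "g = of_int r + of_int s * \<i>" using g(1) by (rule gauss_intE)
  have "Im z = of_int b" "Im (cnj z) = - of_int b" by (simp_all add: z_def)
  moreover have "Im (of_nat q * g) = of_int (int q * s)" unfolding rs by simp
  ultimately have "(of_int b :: real) = of_int (int q * s) \<or> (of_int b :: real) = of_int (int q * (- s))"
    using g(2) by fastforce
  then have "b = int q * s \<or> b = int q * (- s)" by (simp only: of_int_eq_iff)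
  then show ?thesis by (metis dvd_triv_left)
qed

text \<open>Squares are 0 or 1 modulo 4 and D = 1 mod 4, so x is odd and y even; (x - 1)/2 and (x +
  1)/2 are then consecutive integers whose product is D times a square.\<close>

lemma pell_half_factorization:
  fixes x y D :: nat
  assumes "D mod 4 = 1" "x\<^sup>2 = D * y\<^sup>2 + 1" "y > 0"
  obtains t w where "x = 2 * t + 1" "y = 2 * w" "t * (t + 1) = D * w\<^sup>2" "w > 0" "t > 0"
proof -
  have "D = 4 * (D div 4) + 1" using assms(1) by presburger
  then obtain D' where D': "D = 4 * D' + 1" by blast
  have sq: "z\<^sup>2 mod 4 = (if even z then 0 else 1)" for z :: nat
  proof (cases "even z")
    case True
    then obtain k where "z = 2 * k" by (rule evenE)
    then show ?thesis by (simp add: power2_eq_square)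
  next
    case False
    then obtain k where "z = 2 * k + 1" by (rule oddE)
    then have "z\<^sup>2 = 1 + 4 * (k * k + k)" by (simp add: power2_eq_square algebra_simps)
    then show ?thesis using False by (simp only: mod_mult_self2) simp
  qed
  have "x\<^sup>2 = 4 * (D' * y\<^sup>2) + y\<^sup>2 + 1" using assms(2) unfolding D' by (simp add: algebra_simps)
  then have "x\<^sup>2 mod 4 = (y\<^sup>2 mod 4 + 1) mod 4" by (simp add: mod_simps)
  then have "odd x" "even y" unfolding sq by (auto split: if_splits)
  obtain t where t: "x = 2 * t + 1" using \<open>odd x\<close> by (rule oddE)
  obtain w where w: "y = 2 * w" using \<open>even y\<close> by (rule evenE)
  have "4 * (t * (t + 1)) = 4 * (D * w\<^sup>2)" using assms(2) unfolding t w by (simp add: power2_eq_square algebra_simps)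
  then have eq: "t * (t + 1) = D * w\<^sup>2" by simp
  have "w > 0" using assms(3) w by simp
  moreover have "D > 0" using D' by simp
  ultimately have "D * w\<^sup>2 > 0" by simp
  then have "t > 0" unfolding eq[symmetric] by simp
  then show ?thesis using that t w eq \<open>w > 0\<close> by blast
qed

text \<open>The prime p divides exactly one of the coprime numbers t and t + 1. If t = p b^2 and t +
  1 = a^2, then (a, b) solves the same Pell equation with b at most w < y, against minimality. The
  other distribution is the desired equation.\<close>

lemma negative_pell:
  fixes p :: nat
  assumes "Factorial_Ring.prime p" "p mod 4 = 1"
  obtains a b :: nat where "a\<^sup>2 + 1 = p * b\<^sup>2" "even a"
proof -
  have p0: "p > 1" using assms(1) by (rule prime_gt_1_nat)
  have nonsq: "p \<noteq> t\<^sup>2" for t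
  proof
    assume "p = t\<^sup>2"
    then have "Factorial_Ring.prime (t\<^sup>2)" using assms(1) by simp
    then show False by (simp add: prime_power_iff)
  qed
  obtain x y where xy: "y > 0" "x\<^sup>2 = p * y\<^sup>2 + 1" "\<And>x' y'. y' > 0 \<Longrightarrow> x'\<^sup>2 = p * y'\<^sup>2 + 1 \<Longrightarrow> y \<le> y'"
    using pell_minimal[of p] nonsq by metis
  obtain t w where t: "x = 2 * t + 1" "y = 2 * w" "t * (t + 1) = p * w\<^sup>2" "w > 0" "t > 0"
    by (rule pell_half_factorization[OF assms(2) xy(2,1)])
  have cop: "Rings.coprime t (t + 1)" by simp
  have sol: "\<exists>a b. a\<^sup>2 + 1 = p * b\<^sup>2"
  proof (rule coprime_mult_prime[OF assms(1) cop t(3) t(5)])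
    fix t' assume *: "t = p * t'" "Rings.coprime t' (t + 1)" "t' * (t + 1) = w\<^sup>2" "t' > 0"
    obtain b a where ba: "t' = b\<^sup>2" "t + 1 = a\<^sup>2" using coprime_mult_square[OF *(2,3,4)] by auto
    have "a\<^sup>2 = p * b\<^sup>2 + 1" unfolding ba(2)[symmetric] *(1) ba(1) by simp
    moreover have "b > 0" using *(4) ba(1) by (cases b) auto
    ultimately have "y \<le> b" using xy(3) by blast
    moreover have "b\<^sup>2 \<le> w\<^sup>2" unfolding *(3)[symmetric] ba(1)[symmetric] by simp
    then have "b \<le> w" by (simp add: power2_nat_le_eq_le)
    ultimately show ?thesis using t(2,4) by simp
  next
    fix v assume *: "t + 1 = p * v" "Rings.coprime t v" "t * v = w\<^sup>2" "v > 0"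
    obtain a b where "t = a\<^sup>2" "v = b\<^sup>2" using coprime_mult_square[OF *(2,3) t(5) *(4)] by auto
    then have "a\<^sup>2 + 1 = p * b\<^sup>2" using *(1) by simp
    then show ?thesis by blast
  qed simp
  then obtain a b where ab: "a\<^sup>2 + 1 = p * b\<^sup>2" by blast
  \<comment> \<open>For odd a the left side is 2 modulo 4, whereas p b^2 is odd or divisible by
    4.\<close>
  have "even a"
  proof (rule ccontr)
    assume "odd a"
    then obtain k where k: "a = 2 * k + 1" by (rule oddE)
    have e: "4 * (k * k + k) + 2 = p * b\<^sup>2" using ab unfolding k by (simp add: power2_eq_square algebra_simps)
    have "even (p * b\<^sup>2)" unfolding e[symmetric] by simp
    moreover have "odd p" using assms(2) by presburger
    ultimately have "even b" by simp
    then obtain j where "b = 2 * j" by (rule evenE)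
    then have "4 * (k * k + k) + 2 = 4 * (p * j\<^sup>2)" using e by (simp add: power2_eq_square)
    then show False by presburger
  qed
  then show ?thesis using that ab by blast
qed

text \<open>There are four ways to distribute q1 and q2 over the coprime t and t + 1. Both in t
  contradicts minimality, both in t + 1 makes q1 = 3 mod 4 divide a^2 + 1, and the mixed ways yield
  the two signs.\<close>

lemma pell_mixed:
  fixes q1 q2 :: nat
  assumes "Factorial_Ring.prime q1" "Factorial_Ring.prime q2" "q1 \<noteq> q2" "q1 mod 4 = 3" "q2 mod 4 = 3"
  obtains a b :: int where "int q1 * a\<^sup>2 - int q2 * b\<^sup>2 = 1 \<or> int q1 * a\<^sup>2 - int q2 * b\<^sup>2 = -1"
proof -
  define m where "m = q1 * q2"
  have m4: "m mod 4 = 1" unfolding m_def using assms(4,5) mod_mult_eq[of q1 4 q2] by simp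
  have nonsq: "m \<noteq> t\<^sup>2" for t
  proof
    assume m: "m = t\<^sup>2"
    then have "q1 dvd t\<^sup>2" unfolding m_def by (metis dvd_triv_left)
    then have "q1 dvd t" using assms(1) prime_dvd_power_nat by blast
    then obtain r where r: "t = q1 * r" by (rule dvdE)
    have "q1 * q2 = q1 * (q1 * (r * r))" using m unfolding m_def r by (simp add: power2_eq_square mult_ac)
    then have "q2 = q1 * (r * r)" using prime_gt_0_nat[OF assms(1)] by simp
    then have "q1 dvd q2" by simp
    then show False using assms(1-3) primes_dvd_imp_eq by blast
  qed
  obtain x y where xy: "y > 0" "x\<^sup>2 = m * y\<^sup>2 + 1" "\<And>x' y'. y' > 0 \<Longrightarrow> x'\<^sup>2 = m * y'\<^sup>2 + 1 \<Longrightarrow> y \<le> y'"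
    using pell_minimal[of m] nonsq by metis
  obtain t w where t: "x = 2 * t + 1" "y = 2 * w" "t * (t + 1) = m * w\<^sup>2" "w > 0" "t > 0"
    by (rule pell_half_factorization[OF m4 xy(2,1)])
  have cop: "Rings.coprime t (t + 1)" by simp
  have eq: "t * (t + 1) = q1 * (q2 * w\<^sup>2)" using t(3) by (simp add: m_def mult.assoc)
  have "\<exists>a b. q1 * a\<^sup>2 + 1 = q2 * b\<^sup>2 \<or> q2 * b\<^sup>2 + 1 = q1 * a\<^sup>2"
  proof (rule coprime_mult_prime[OF assms(1) cop eq t(5)])
    fix u assume *: "t = q1 * u" "Rings.coprime u (t + 1)" "u * (t + 1) = q2 * w\<^sup>2" "u > 0"
    show ?thesis
    proof (rule coprime_mult_prime[OF assms(2) *(2,3,4)])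
      fix u' assume **: "u = q2 * u'" "Rings.coprime u' (t + 1)" "u' * (t + 1) = w\<^sup>2" "u' > 0"
      obtain b a where ba: "u' = b\<^sup>2" "t + 1 = a\<^sup>2" using coprime_mult_square[OF **(2,3,4)] by auto
      have "a\<^sup>2 = m * b\<^sup>2 + 1" unfolding ba(2)[symmetric] *(1) **(1) ba(1) m_def by simp
      moreover have "b > 0" using **(4) ba(1) by (cases b) auto
      ultimately have "y \<le> b" using xy(3) by blast
      moreover have "b\<^sup>2 \<le> w\<^sup>2" unfolding **(3)[symmetric] ba(1)[symmetric] by simp
      then have "b \<le> w" by (simp add: power2_nat_le_eq_le)
      ultimately show ?thesis using t(2,4) by simp
    next
      fix v assume **: "t + 1 = q2 * v" "Rings.coprime u v" "u * v = w\<^sup>2" "v > 0"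
      obtain a b where "u = a\<^sup>2" "v = b\<^sup>2" using coprime_mult_square[OF **(2,3) *(4) **(4)] by auto
      then have "q1 * a\<^sup>2 + 1 = q2 * b\<^sup>2" using *(1) **(1) by simp
      then show ?thesis by blast
    qed simp
  next
    fix v assume *: "t + 1 = q1 * v" "Rings.coprime t v" "t * v = q2 * w\<^sup>2" "v > 0"
    show ?thesis
    proof (rule coprime_mult_prime[OF assms(2) *(2,3) t(5) *(4)])
      fix u assume **: "t = q2 * u" "Rings.coprime u v" "u * v = w\<^sup>2" "u > 0"
      obtain b a where "u = b\<^sup>2" "v = a\<^sup>2" using coprime_mult_square[OF **(2,3,4) *(4)] by auto
      then have "q2 * b\<^sup>2 + 1 = q1 * a\<^sup>2" using *(1) **(1) by simp
      then show ?thesis by blast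
    next
      fix v' assume **: "v = q2 * v'" "Rings.coprime t v'" "t * v' = w\<^sup>2" "v' > 0"
      obtain a b where ab: "t = a\<^sup>2" "v' = b\<^sup>2" using coprime_mult_square[OF **(2,3) t(5) **(4)] by auto
      have "q1 dvd a\<^sup>2 + 1" using *(1) unfolding ab(1) by (metis dvd_triv_left)
      then have "int q1 dvd int (a\<^sup>2 + 1)" by (simp only: of_nat_dvd_iff)
      then have "int q1 dvd (int a)\<^sup>2 + 1\<^sup>2" by (simp add: add.commute)
      then have "int q1 dvd 1" by (rule prime_3_mod_4_dvd_sum_squares[OF assms(1,4)])
      then show ?thesis using prime_gt_1_nat[OF assms(1)] by simp
    qed
  qed simp
  then obtain a b where "q1 * a\<^sup>2 + 1 = q2 * b\<^sup>2 \<or> q2 * b\<^sup>2 + 1 = q1 * a\<^sup>2" by blast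
  then have "int (q1 * a\<^sup>2 + 1) = int (q2 * b\<^sup>2) \<or> int (q2 * b\<^sup>2 + 1) = int (q1 * a\<^sup>2)" by (simp only: of_nat_eq_iff)
  then have "int q1 * (int a)\<^sup>2 - int q2 * (int b)\<^sup>2 = 1 \<or> int q1 * (int a)\<^sup>2 - int q2 * (int b)\<^sup>2 = -1" by auto
  then show ?thesis by (rule that)
qed

section \<open>Square roots of principal ideals and norms of units\<close>

context number_field
begin

text \<open>The elements of I / theta are integral because their squares are, and an integral ideal
  whose square is the whole ring is the whole ring.\<close>

lemma ideal_of_square_principal:
  assumes I: "set_ideal ints I" and \<theta>: "\<theta> \<in> K" "\<theta> \<noteq> 0" and sq: "set_prod I I = scale (\<theta> * \<theta>) ints"
  shows "I = scale \<theta> ints"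
proof -
  have Isub: "I \<subseteq> ints" using I by (simp add: set_ideal_def)
  have sub: "scale (1 / \<theta>) I \<subseteq> ints"
  proof
    fix z assume "z \<in> scale (1 / \<theta>) I"
    then obtain x where x: "x \<in> I" "z = x / \<theta>" unfolding scale_def by auto
    have "x * x \<in> scale (\<theta> * \<theta>) ints" unfolding sq[symmetric] by (rule set_prod.prod[OF x(1,1)])
    then have "(x * x) / (\<theta> * \<theta>) \<in> ints" using \<theta>(2) by (simp add: in_scale_iff)
    moreover have "(x * x) / (\<theta> * \<theta>) = z\<^sup>2" unfolding x(2) by (simp add: power2_eq_square)
    ultimately have "algebraic_int (z\<^sup>2)" by (simp only: integers_of_def mem_Collect_eq)
    then have "algebraic_int z" by (rule iffD1[OF algebraic_int_power2_iff])
    moreover have "z \<in> K" unfolding x(2) using x(1) Isub \<theta>(1) by (intro divide) (auto simp: integers_of_def)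
    ultimately show "z \<in> ints" by (simp add: integers_of_def)
  qed
  define J where "J = scale (1 / \<theta>) I"
  have J: "set_ideal ints J" unfolding J_def by (rule ints.set_ideal_scale[OF I sub])
  have "set_prod J J = ints" unfolding J_def using \<theta>(2) by (simp add: sq)
  then have "1 \<in> J" using ints.set_ideal_prod_subset[OF J J] by auto
  then have "J = ints" by (rule ints.set_ideal_eq_top[OF J])
  then have "scale \<theta> J = scale \<theta> ints" by simp
  then show ?thesis unfolding J_def using \<theta>(2) by simp
qed

lemma scale_associated:
  assumes "\<eta> \<in> ints" "inverse \<eta> \<in> ints" "\<eta> \<noteq> 0" shows "scale (a * \<eta>) ints = scale a ints"
proof -
  have "scale (a * \<eta>) ints = scale a (scale \<eta> ints)" by simp
  also have "scale \<eta> ints = ints" by (rule ints.scale_unit[OF assms(3,1,2)]) simp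
  finally show ?thesis .
qed

end

text \<open>Let 2 u = A + B' sqrt d, so A^2 - d B'^2 would be 4 i or -4 i. Its squared modulus 16
  equals R^2 + 4 d V^2, where R = |A|^2 - d |B'|^2 and V is, up to sign, the imaginary part of A *
  cnj B'. As 4 d > 16, V = 0 and R = 4 or -4. Together with the vanishing real part this gives a^2 -
  d r^2 = 2 or -2 for the real parts a, r of A, B', which is impossible modulo 4.\<close>

lemma (in gauss_quadratic) norm_unit_not_imaginary:
  assumes u: "u \<in> ints" and d: "d \<ge> 5"
  shows "u * conj u \<noteq> \<i>" "u * conj u \<noteq> - \<i>"
proof -
  have main: False if uc: "u * conj u = of_int t * \<i>" and t: "t = 1 \<or> t = -1" for t :: int
  proof -
    obtain A' B' where AB: "A' \<in> gauss_int" "B' \<in> gauss_int" "u = A' + B' * \<omega>" using u by (rule intsE)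
    define A where "A = 2 * A' + B'"
    have A: "A \<in> gauss_int" using AB by (simp add: A_def)
    have u2: "2 * u = A + B' * sqrtC d" unfolding AB(3) A_def sqrtC_omega by (simp add: algebra_simps)
    have "conj (2 * u) = A - B' * sqrtC d" unfolding u2 using A AB(2) by simp
    then have c2: "2 * conj u = A - B' * sqrtC d" using ints_in_L[OF u] by simp
    have "4 * (u * conj u) = (2 * u) * (2 * conj u)" by simp
    also have "\<dots> = A * A - B' * B' * (sqrtC d * sqrtC d)"
      unfolding u2 c2 by (simp add: algebra_simps del: sqrtC_square)
    finally have eq: "A * A - B' * B' * of_nat d = 4 * (of_int t * \<i>)" unfolding uc sqrtC_square by simp
    obtain a b where a: "A = of_int a + of_int b * \<i>" using A by (rule gauss_intE)
    obtain r s where r: "B' = of_int r + of_int s * \<i>" using AB(2) by (rule gauss_intE)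
    have "Re (A * A - B' * B' * of_nat d) = of_int (a * a - b * b - int d * (r * r - s * s))"
      unfolding a r by (simp add: algebra_simps)
    then have "(of_int (a * a - b * b - int d * (r * r - s * s)) :: real) = of_int 0" unfolding eq by simp
    then have e1: "a * a - b * b - int d * (r * r - s * s) = 0" by (simp only: of_int_eq_iff)
    have "Im (A * A - B' * B' * of_nat d) = of_int (2 * (a * b) - 2 * int d * (r * s))"
      unfolding a r by (simp add: algebra_simps)
    then have "(of_int (2 * (a * b) - 2 * int d * (r * s)) :: real) = of_int (4 * t)" unfolding eq by simp
    then have e2: "2 * (a * b) - 2 * int d * (r * s) = 4 * t" by (simp only: of_int_eq_iff)
    define R V where "R = a * a + b * b - int d * (r * r + s * s)" "V = a * s - b * r"
    have "R * R + 4 * int d * (V * V) = (a * a - b * b - int d * (r * r - s * s)) * (a * a - b * b - int d * (r * r - s * s)) +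
        (2 * (a * b) - 2 * int d * (r * s)) * (2 * (a * b) - 2 * int d * (r * s))"
      unfolding R_V_def by (simp add: algebra_simps)
    also have "\<dots> = 16" unfolding e1 e2 using t by auto
    finally have e3: "R * R + 4 * int d * (V * V) = 16" .
    have "V = 0"
    proof (rule ccontr)
      assume "V \<noteq> 0"
      then have "V * V \<ge> 1" by (metis int_one_le_iff_zero_less mult_eq_0_iff not_real_square_gt_zero zero_less_mult_iff not_less linorder_neqE_linordered_idom)
      then have "4 * int d * (V * V) \<ge> 4 * int d * 1" by (intro mult_left_mono) simp_all
      moreover have "R * R \<ge> 0" by simp
      ultimately show False using e3 d by linarith
    qed
    then have "R\<^sup>2 = 4\<^sup>2" using e3 by (simp add: power2_eq_square)
    then have R: "R = 4 \<or> R = -4" unfolding power2_eq_iff .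
    have "2 * (a * a - int d * (r * r)) = R" using e1 unfolding R_V_def by (simp add: algebra_simps)
    moreover have "x = 2 \<or> x = -2" if "2 * x = R" for x :: int using that R by presburger
    ultimately have e4: "a * a - int d * (r * r) = 2 \<or> a * a - int d * (r * r) = -2" by blast
    obtain D' where D': "int d = 4 * D' + 1"
    proof -
      have "int d = 4 * (int d div 4) + 1" using mod4 by presburger
      then show ?thesis using that by blast
    qed
    have e5: "a * a - int d * (r * r) = (a * a - r * r) - 4 * (D' * (r * r))" unfolding D' by (simp add: algebra_simps)
    have sq: "\<exists>k. z * z = 4 * k \<or> z * z = 4 * k + 1" for z :: int
    proof (cases "even z")
      case True
      then obtain k where "z = 2 * k" by (rule evenE)
      then have "z * z = 4 * (k * k)" by simp
      then show ?thesis by blast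
    next
      case False
      then obtain k where "z = 2 * k + 1" by (rule oddE)
      then have "z * z = 4 * (k * k + k) + 1" by (simp add: algebra_simps)
      then show ?thesis by blast
    qed
    obtain k where k: "a * a = 4 * k \<or> a * a = 4 * k + 1" using sq[of a] by blast
    obtain l where l: "r * r = 4 * l \<or> r * r = 4 * l + 1" using sq[of r] by blast
    define z where "z = D' * (r * r)"
    have "a * a - r * r - 4 * z = 2 \<or> a * a - r * r - 4 * z = -2" using e4 unfolding e5 z_def .
    then show False using k l by presburger
  qed
  show "u * conj u \<noteq> \<i>" using main[of 1] by auto
  show "u * conj u \<noteq> - \<i>" using main[of "-1"] by auto
qed

lemma sqrtC_mult: "sqrtC (a * b) = sqrtC a * sqrtC b"
  by (simp add: sqrtC_def real_sqrt_mult)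

lemma sqrtC_self [simp]: "sqrtC a * sqrtC a = of_nat a"
  unfolding sqrtC_def of_real_mult[symmetric] by simp

text \<open>A square root z in Z[i] would, by radicality, be divisible by n = z^2 and hence be a
  unit.\<close>

lemma sqrtC_notin_gauss_rat:
  assumes "gsquarefree (of_nat n)" "n > 1" shows "sqrtC n \<notin> gauss_rat"
proof
  assume in_gq: "sqrtC n \<in> gauss_rat"
  define z where "z = sqrtC n"
  have zz: "z\<^sup>2 = of_nat n" by (simp add: z_def power2_eq_square)
  have "algebraic_int (z\<^sup>2)" unfolding zz by simp
  then have "algebraic_int z" by (rule iffD1[OF algebraic_int_power2_iff])
  then have z: "z \<in> gauss_int" using in_gq unfolding z_def by (intro gauss_intI_integral)
  have z0: "z \<noteq> 0" using zz assms(2) by auto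
  have "of_nat n gdvd z\<^sup>2" unfolding zz by simp
  then have "of_nat n gdvd z" using assms(1) z unfolding gsquarefree_def by blast
  then obtain c where c: "c \<in> gauss_int" "z = of_nat n * c" by (rule gdvdE)
  have "z * 1 = z * (z * c)" using c(2) unfolding zz[symmetric] by (simp add: power2_eq_square mult.assoc)
  then have "1 = z * c" using z0 by (simp only: mult_left_cancel not_False_eq_True)
  then have "z gdvd 1" using c(1) by (rule gdvdI[rotated])
  then have "gnorm z = 1" using gauss_unit_iff[OF z] by blast
  then have "gnorm (z * z) = 1" using gnorm_mult[OF z z] by simp
  moreover have "gnorm (of_nat n) = n * n" using gnorm_of_int_pair[of "int n" 0]
    by (simp add: power2_eq_square nat_mult_distrib)
  ultimately have "n * n = 1" using zz by (simp add: power2_eq_square)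
  then show False using assms(2) by simp
qed

section \<open>The biquadratic field\<close>

context quadratic_extension
begin

lemma conj_image_integers: "conj ` integers_of L = integers_of L"
proof
  show "conj ` integers_of L \<subseteq> integers_of L"
    using algebraic_int_conj conj_in unfolding integers_of_def by blast
  show "integers_of L \<subseteq> conj ` integers_of L"
  proof
    fix x assume "x \<in> integers_of L"
    then have x: "x \<in> L" "algebraic_int x" by (simp_all add: integers_of_def)
    then have "conj x \<in> integers_of L" using algebraic_int_conj conj_in unfolding integers_of_def by blast
    moreover have "x = conj (conj x)" using conj_conj[OF x(1)] by simp
    ultimately show "x \<in> conj ` integers_of L" by blast
  qed
qed

lemma conj_image_ext:
  assumes "I \<subseteq> L"
  shows "conj ` set_prod (integers_of L) I = set_prod (integers_of L) (conj ` I)"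
proof -
  have "conj ` set_prod (integers_of L) I = set_prod (conj ` integers_of L) (conj ` I)"
  proof (rule set_prod_image[of L])
    show "integers_of L \<subseteq> L" by (auto simp: integers_of_def)
  qed (use assms in simp_all)
  then show ?thesis unfolding conj_image_integers .
qed

lemma conj_image_principal:
  assumes "a \<in> L" shows "conj ` scale a (integers_of L) = scale (conj a) (integers_of L)"
proof -
  have "conj ` scale a (integers_of L) = scale (conj a) (conj ` integers_of L)"
    unfolding scale_def image_image by (intro image_cong refl) (use assms in \<open>simp add: integers_of_def\<close>)
  then show ?thesis unfolding conj_image_integers .
qed

end

context number_field
begin

lemma principal_eqD:
  assumes "scale a ints = scale b ints" "a \<noteq> 0" "b \<noteq> 0"
  shows "a / b \<in> ints" "b / a \<in> ints"
proof -
  have self: "c * 1 \<in> scale c ints" for c unfolding scale_def by (intro imageI) simp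
  show "a / b \<in> ints" using self[of a] unfolding assms(1) in_scale_iff[OF assms(3)] by simp
  show "b / a \<in> ints" using self[of b] unfolding assms(1)[symmetric] in_scale_iff[OF assms(2)] by simp
qed

end

lemma gnorm_of_nat: "gnorm (of_nat n) = n * n"
  using gnorm_of_int_pair[of "int n" 0] by (simp add: power2_eq_square nat_mult_distrib)

locale biquadratic =
  fixes p q1 q2 e f :: nat
  assumes prime: "Factorial_Ring.prime p" "Factorial_Ring.prime q1" "Factorial_Ring.prime q2"
    and neq: "p \<noteq> q1" "p \<noteq> q2" "q1 \<noteq> q2"
    and mod4: "p mod 4 = 1" "q1 mod 4 = 3" "q2 mod 4 = 3"
    and p_eq: "p = e\<^sup>2 + 4 * f\<^sup>2"
begin

text \<open>Both conjugate primes are brought to the shape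
  \<open>of_int e' + of_int (2 * f') * \<i>\<close>, so that one lemma treats them alike; the even
  imaginary part is decisive in \<open>pi_times_unit_square\<close>.\<close>

definition \<pi>1 :: complex where "\<pi>1 = of_int (int e) + of_int (2 * int f) * \<i>"
definition \<pi>2 :: complex where "\<pi>2 = of_int (int e) + of_int (2 * - int f) * \<i>"

abbreviation d where "d \<equiv> p * q1 * q2"
abbreviation m where "m \<equiv> q1 * q2"

lemma gnorm_pi: "gnorm \<pi>1 = p" "gnorm \<pi>2 = p"
proof -
  have "nat ((int e)\<^sup>2 + (2 * int f)\<^sup>2) = nat (int p)" unfolding p_eq by (simp add: power_mult_distrib)
  then show "gnorm \<pi>1 = p" "gnorm \<pi>2 = p" unfolding \<pi>1_def \<pi>2_def gnorm_of_int_pair by simp_all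
qed

lemma gprimes: "gprime \<pi>1" "gprime \<pi>2" "gprime (of_nat q1)" "gprime (of_nat q2)"
proof -
  have "\<pi>1 \<in> gauss_int" "\<pi>2 \<in> gauss_int" unfolding \<pi>1_def \<pi>2_def by (rule gauss_intI)+
  then show "gprime \<pi>1" "gprime \<pi>2" using gprime_of_prime_gnorm gnorm_pi prime(1) by metis+
qed (use gprime_inert prime mod4 in auto)

lemma gints [simp]: "\<pi>1 \<in> gauss_int" "\<pi>2 \<in> gauss_int"
  using gprimes by simp_all

lemma pi_mult: "\<pi>1 * \<pi>2 = of_nat p"
proof -
  have "\<pi>1 * \<pi>2 = of_int ((int e)\<^sup>2 + 4 * (int f)\<^sup>2)"
    unfolding \<pi>1_def \<pi>2_def by (simp add: power2_eq_square algebra_simps)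
  also have "(int e)\<^sup>2 + 4 * (int f)\<^sup>2 = int p" unfolding p_eq by simp
  finally show ?thesis by simp
qed

lemma odd_p: "odd p"
  using mod4(1) by presburger

lemma not_prime_dvd: 
  fixes a b :: nat
  assumes "Factorial_Ring.prime a" "Factorial_Ring.prime b" "a \<noteq> b" shows "\<not> a dvd b * b"
  using assms primes_dvd_imp_eq prime_dvd_mult_nat by blast

text \<open>Divisibility would pass to the sum 2 e, and norms would give p dividing 4 e^2. As p is
  odd it would divide e, but e^2 is at most p.\<close>

lemma pi_not_dvd_pi: "\<not> \<pi>1 gdvd \<pi>2" "\<not> \<pi>2 gdvd \<pi>1"
proof -
  have sum: "\<pi>1 + \<pi>2 = of_nat (2 * e)" "\<pi>2 + \<pi>1 = of_nat (2 * e)" unfolding \<pi>1_def \<pi>2_def by simp_all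
  have False if "p dvd gnorm (of_nat (2 * e))"
  proof -
    have "p dvd 2 * e" using that prime_dvd_mult_nat[OF prime(1), of "2 * e" "2 * e"] unfolding gnorm_of_nat by blast
    moreover have "\<not> p dvd 2"
    proof
      assume "p dvd 2"
      then have "p = 2" using primes_dvd_imp_eq[OF prime(1) two_is_prime_nat] by blast
      then show False using odd_p by simp
    qed
    ultimately have "p dvd e" using prime_dvd_mult_nat[OF prime(1), of 2 e] by blast
    moreover have "e \<noteq> 0"
    proof
      assume "e = 0"
      then have "even p" unfolding p_eq by simp
      then show False using odd_p by simp
    qed
    ultimately have "p \<le> e" by (simp add: dvd_imp_le)
    then have "p * p \<le> e * e" by (rule mult_le_mono) fact
    also have "\<dots> \<le> p" by (simp add: p_eq power2_eq_square)
    finally show False using prime_gt_1_nat[OF prime(1)] by simp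
  qed
  moreover have "p dvd gnorm (of_nat (2 * e))" if "\<pi>1 gdvd \<pi>2"
    using gdvd_gnorm[of \<pi>1 "\<pi>1 + \<pi>2"] gdvd_add[OF gdvd_refl that] unfolding gnorm_pi sum by simp
  moreover have "p dvd gnorm (of_nat (2 * e))" if "\<pi>2 gdvd \<pi>1"
    using gdvd_gnorm[of \<pi>2 "\<pi>2 + \<pi>1"] gdvd_add[OF gdvd_refl that] unfolding gnorm_pi sum by simp
  ultimately show "\<not> \<pi>1 gdvd \<pi>2" "\<not> \<pi>2 gdvd \<pi>1" by blast+
qed

lemma pi_not_dvd_q: "\<not> \<pi>1 gdvd of_nat q1" "\<not> \<pi>1 gdvd of_nat q2" "\<not> \<pi>2 gdvd of_nat q1" "\<not> \<pi>2 gdvd of_nat q2"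
  using gdvd_gnorm[OF gints(1), of "of_nat q1"] gdvd_gnorm[OF gints(1), of "of_nat q2"]
    gdvd_gnorm[OF gints(2), of "of_nat q1"] gdvd_gnorm[OF gints(2), of "of_nat q2"]
    not_prime_dvd[OF prime(1,2) neq(1)] not_prime_dvd[OF prime(1,3) neq(2)]
  unfolding gnorm_pi gnorm_of_nat by blast+

lemma q_not_dvd_pi: 
  assumes "q = q1 \<or> q = q2" shows "\<not> of_nat q gdvd \<pi>1" "\<not> of_nat q gdvd \<pi>2"
proof -
  have "\<not> q * q dvd p"
  proof
    assume "q * q dvd p"
    then have "q dvd p" by (rule dvd_mult_left)
    then show False using assms prime neq primes_dvd_imp_eq by blast
  qed
  then show "\<not> of_nat q gdvd \<pi>1" "\<not> of_nat q gdvd \<pi>2"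
    using gdvd_gnorm[of "of_nat q" \<pi>1] gdvd_gnorm[of "of_nat q" \<pi>2] unfolding gnorm_pi gnorm_of_nat by auto
qed

lemma q_not_dvd_q: "\<not> of_nat q1 gdvd of_nat q2" "\<not> of_nat q2 gdvd of_nat q1"
proof -
  have "\<not> q1 * q1 dvd q2 * q2" "\<not> q2 * q2 dvd q1 * q1"
    using not_prime_dvd[OF prime(2,3) neq(3)] not_prime_dvd[OF prime(3,2) neq(3)[symmetric]] dvd_mult_left by blast+
  then show "\<not> of_nat q1 gdvd of_nat q2" "\<not> of_nat q2 gdvd of_nat q1"
    using gdvd_gnorm[of "of_nat q1" "of_nat q2"] gdvd_gnorm[of "of_nat q2" "of_nat q1"] unfolding gnorm_of_nat by auto
qed

lemma not_dvd_2: "\<not> \<pi>1 gdvd 2" "\<not> \<pi>2 gdvd 2" "\<not> of_nat q1 gdvd 2" "\<not> of_nat q2 gdvd 2"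
proof -
  have g2: "gnorm 2 = 2 * 2" using gnorm_of_nat[of 2] by simp
  have nd: "\<not> r dvd 2 * 2" if "Factorial_Ring.prime r" "odd r" for r :: nat
    by (rule not_prime_dvd[OF that(1) two_is_prime_nat]) (use that(2) in auto)
  have odd: "odd q1" "odd q2" using mod4 by presburger+
  show "\<not> \<pi>1 gdvd 2" "\<not> \<pi>2 gdvd 2"
    using gdvd_gnorm[of \<pi>1 2] gdvd_gnorm[of \<pi>2 2] nd[OF prime(1) odd_p] unfolding gnorm_pi g2 by auto
  have "\<not> q1 * q1 dvd 2 * 2" "\<not> q2 * q2 dvd 2 * 2"
    using nd[OF prime(2) odd(1)] nd[OF prime(3) odd(2)] dvd_mult_left by blast+
  then show "\<not> of_nat q1 gdvd 2" "\<not> of_nat q2 gdvd 2"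
    using gdvd_gnorm[of "of_nat q1" 2] gdvd_gnorm[of "of_nat q2" 2] unfolding gnorm_of_nat g2 by auto
qed

lemma d_factor: "of_nat d = \<pi>1 * (\<pi>2 * (of_nat q1 * of_nat q2))"
  using pi_mult by (simp add: mult.assoc[symmetric])

lemma gsquarefree_m: "gsquarefree (of_nat m)"
  using gsquarefree_mult[OF gprimes(3) gsquarefree_prime[OF gprimes(4)] q_not_dvd_q(1)] by simp

lemma gsquarefree_p: "gsquarefree (of_nat p)"
  using gsquarefree_mult[OF gprimes(1) gsquarefree_prime[OF gprimes(2)] pi_not_dvd_pi(1)] unfolding pi_mult .

lemma pi_not_dvd_rest:
  "\<not> \<pi>1 gdvd \<pi>2 * (of_nat q1 * of_nat q2)" "\<not> \<pi>2 gdvd \<pi>1 * (of_nat q1 * of_nat q2)"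
  "\<not> of_nat q1 gdvd \<pi>1 * (\<pi>2 * of_nat q2)" "\<not> of_nat q2 gdvd \<pi>1 * (\<pi>2 * of_nat q1)"
  "\<not> \<pi>2 gdvd of_nat q1 * of_nat q2"
proof -
  have *: "\<not> r gdvd a * b" if "gprime r" "a \<in> gauss_int" "b \<in> gauss_int" "\<not> r gdvd a" "\<not> r gdvd b" for r a b
    using gprime_dvd_mult[OF that(1-3)] that(4,5) by blast
  show "\<not> \<pi>1 gdvd \<pi>2 * (of_nat q1 * of_nat q2)" "\<not> \<pi>2 gdvd \<pi>1 * (of_nat q1 * of_nat q2)"
    "\<not> of_nat q1 gdvd \<pi>1 * (\<pi>2 * of_nat q2)" "\<not> of_nat q2 gdvd \<pi>1 * (\<pi>2 * of_nat q1)"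
    "\<not> \<pi>2 gdvd of_nat q1 * of_nat q2"
    by (intro * gprimes pi_not_dvd_pi pi_not_dvd_q q_not_dvd_pi q_not_dvd_q gauss_int_simps gints disjI1 disjI2 refl)+
qed

lemma gsquarefree_d: "gsquarefree (of_nat d)"
proof -
  have "gsquarefree (\<pi>2 * (of_nat q1 * of_nat q2))"
    using gsquarefree_mult[OF gprimes(2) gsquarefree_m] pi_not_dvd_rest(5) by simp
  then have "gsquarefree (\<pi>1 * (\<pi>2 * (of_nat q1 * of_nat q2)))"
    using gsquarefree_mult[OF gprimes(1)] pi_not_dvd_rest(1) by blast
  then show ?thesis unfolding d_factor .
qed

lemma m_mod4: "m mod 4 = 1"
  using mod4(2,3) mod_mult_eq[of q1 4 q2] by simp

lemma d_mod4: "d mod 4 = 1"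
  using mod4(1) m_mod4 mod_mult_eq[of p 4 m] by (simp add: mult.assoc)

lemma gt1: "p > 1" "q1 > 1" "q2 > 1" "m > 1" "d > 1" "m \<ge> 5"
proof -
  show g: "p > 1" "q1 > 1" "q2 > 1" using prime prime_gt_1_nat by blast+
  have "q1 \<ge> 3" "q2 \<ge> 3" using mod4 by presburger+
  then have "m \<ge> 3 * 3" by (rule mult_le_mono)
  then show "m > 1" "m \<ge> 5" by simp_all
  then show "d > 1" using g mult_le_mono[of 1 p 2 m] by (simp add: mult.assoc)
qed

sublocale k: gauss_quadratic d
  by unfold_locales (rule gsquarefree_d d_mod4 sqrtC_notin_gauss_rat[OF gsquarefree_d gt1(5)])+

sublocale F: gauss_quadratic m
  by unfold_locales (rule gsquarefree_m m_mod4 sqrtC_notin_gauss_rat[OF gsquarefree_m gt1(4)])+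

lemma sqrtC_rel: "sqrtC d = sqrtC m * sqrtC p" "sqrtC m = sqrtC d / of_nat p * sqrtC p"
proof -
  show *: "sqrtC d = sqrtC m * sqrtC p" using sqrtC_mult[of m p] by (simp add: mult_ac)
  have "sqrtC d / of_nat p * sqrtC p = sqrtC m * (sqrtC p * sqrtC p) / of_nat p" unfolding * by (simp del: sqrtC_self)
  then show "sqrtC m = sqrtC d / of_nat p * sqrtC p" unfolding sqrtC_self using gt1(1) by simp
qed

lemma sqrtC_p_notin: "sqrtC p \<notin> gauss_rat"
  by (rule sqrtC_notin_gauss_rat[OF gsquarefree_p gt1(1)])

text \<open>The square of a + b sqrt d lies in Q(i) only if a b = 0.\<close>

lemma (in gauss_quadratic) sqrtC_in_L_cases:
  assumes "sqrtC n \<in> L" shows "sqrtC n \<in> gauss_rat \<or> (\<exists>b\<in>gauss_rat. sqrtC n = b * sqrtC d)"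
proof -
  obtain a b where ab: "a \<in> gauss_rat" "b \<in> gauss_rat" "sqrtC n = a + b * sqrtC d" using assms by (rule quad_extE)
  have "sqrtC n * sqrtC n = (a * a + b * b * (sqrtC d * sqrtC d)) + (2 * a * b) * sqrtC d"
    unfolding ab(3) by (simp add: algebra_simps del: sqrtC_square sqrtC_self)
  then have "(a * a + b * b * of_nat d) + (2 * a * b) * sqrtC d = of_nat n + 0 * sqrtC d"
    unfolding sqrtC_square sqrtC_self by simp
  moreover have "a * a + b * b * of_nat d \<in> gauss_rat" "2 * a * b \<in> gauss_rat" "of_nat n \<in> gauss_rat" "0 \<in> gauss_rat"
    using ab(1,2) by simp_all
  ultimately have "2 * a * b = 0" by (rule coord_unique(2))
  then have "a = 0 \<or> b = 0" by simp
  then show ?thesis using ab by auto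
qed

lemma sqrtC_p_notin_F: "sqrtC p \<notin> F.L"
proof
  assume "sqrtC p \<in> F.L"
  then obtain b where b: "b \<in> gauss_rat" "sqrtC p = b * sqrtC m"
    using F.sqrtC_in_L_cases sqrtC_p_notin by blast
  have "sqrtC d = b * (sqrtC m * sqrtC m)" unfolding sqrtC_rel(1) b(2) by (simp add: mult_ac del: sqrtC_self F.sqrtC_square)
  also have "\<dots> \<in> gauss_rat" unfolding sqrtC_self using b(1) by simp
  finally show False using k.sqrt_notin by blast
qed

lemma sqrtC_p_notin_k: "sqrtC p \<notin> k.L"
proof
  assume "sqrtC p \<in> k.L"
  then obtain b where b: "b \<in> gauss_rat" "sqrtC p = b * sqrtC d"
    using k.sqrtC_in_L_cases sqrtC_p_notin by blast
  have "sqrtC m = (b / of_nat p) * (sqrtC d * sqrtC d)"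
    by (subst sqrtC_rel(2), subst b(2)) (simp del: sqrtC_self k.sqrtC_square)
  also have "\<dots> \<in> gauss_rat" unfolding sqrtC_self using b(1) by simp
  finally show False using F.sqrt_notin by blast
qed

text \<open>K1 is viewed as a quadratic extension in two ways, over F = Q(sqrt(q1 q2), i) and over
  k, with the same generator sqrt p. \<open>M.conj\<close> fixes F and \<open>N.conj\<close> fixes
  k; each restricts to the nontrivial conjugation on the base of the other.\<close>

sublocale M: quadratic_extension F.L "sqrtC p"
  by unfold_locales (rule sqrtC_p_notin_F, simp)

sublocale N: quadratic_extension k.L "sqrtC p"
  by unfold_locales (rule sqrtC_p_notin_k, simp)

lemma k_subset_M: "k.L \<subseteq> M.L"
proof
  fix z assume "z \<in> k.L"
  then obtain u v where uv: "u \<in> gauss_rat" "v \<in> gauss_rat" "z = u + v * sqrtC d" by (rule quad_extE)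
  have "z = u + (v * sqrtC m) * sqrtC p" unfolding uv(3) sqrtC_rel(1) by simp
  then show "z \<in> M.L" using quad_extI[of u F.L "v * sqrtC m" "sqrtC p"] uv(1,2) by simp
qed

lemma F_subset_N: "F.L \<subseteq> N.L"
proof
  fix z assume "z \<in> F.L"
  then obtain u v where uv: "u \<in> gauss_rat" "v \<in> gauss_rat" "z = u + v * sqrtC m" by (rule quad_extE)
  have "z = u + (v * (sqrtC d / of_nat p)) * sqrtC p" unfolding uv(3) by (subst sqrtC_rel(2)) simp
  then show "z \<in> N.L" using quad_extI[of u k.L "v * (sqrtC d / of_nat p)" "sqrtC p"] uv(1,2) by simp
qed

lemma N_L_eq: "N.L = M.L"
proof
  show "N.L \<subseteq> M.L"
  proof
    fix z assume "z \<in> N.L"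
    then obtain a b where "a \<in> k.L" "b \<in> k.L" "z = a + b * sqrtC p" by (rule quad_extE)
    then show "z \<in> M.L" using k_subset_M M.gen_in by (auto intro!: M.ext.add M.ext.mult)
  qed
  show "M.L \<subseteq> N.L"
  proof
    fix z assume "z \<in> M.L"
    then obtain a b where "a \<in> F.L" "b \<in> F.L" "z = a + b * sqrtC p" by (rule quad_extE)
    then show "z \<in> N.L" using F_subset_N N.gen_in by (auto intro!: N.ext.add N.ext.mult)
  qed
qed

sublocale E: number_field_ext k.L M.L
  by unfold_locales (rule k_subset_M)

lemma M_conj_k:
  assumes "z \<in> k.L" shows "M.conj z = k.conj z"
proof -
  obtain u v where uv: "u \<in> gauss_rat" "v \<in> gauss_rat" "z = u + v * sqrtC d" using assms by (rule quad_extE)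
  have z: "z = u + (v * sqrtC m) * sqrtC p" unfolding uv(3) sqrtC_rel(1) by simp
  have "M.conj z = u - (v * sqrtC m) * sqrtC p" unfolding z using uv(1,2) by (intro M.conj_eq) simp_all
  also have "\<dots> = u - v * sqrtC d" unfolding sqrtC_rel(1) by simp
  also have "\<dots> = k.conj z" unfolding uv(3) by (rule k.conj_eq[symmetric, OF uv(1,2)])
  finally show ?thesis .
qed

lemma N_conj_F:
  assumes "z \<in> F.L" shows "N.conj z = F.conj z"
proof -
  obtain u v where uv: "u \<in> gauss_rat" "v \<in> gauss_rat" "z = u + v * sqrtC m" using assms by (rule quad_extE)
  have z: "z = u + (v * (sqrtC d / of_nat p)) * sqrtC p" unfolding uv(3) by (subst sqrtC_rel(2)) simp
  have "N.conj z = u - (v * (sqrtC d / of_nat p)) * sqrtC p" unfolding z using uv(1,2) by (intro N.conj_eq) simp_all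
  also have "\<dots> = u - v * sqrtC m" by (subst sqrtC_rel(2)) simp
  also have "\<dots> = F.conj z" unfolding uv(3) by (rule F.conj_eq[symmetric, OF uv(1,2)])
  finally show ?thesis .
qed

text \<open>Both maps change the sign of sqrt p, so either composite keeps sqrt p and applies
  \<open>F.conj\<close> to the coordinates.\<close>

lemma conj_commute:
  assumes "z \<in> M.L" shows "N.conj (M.conj z) = M.conj (N.conj z)"
proof -
  obtain a b where ab: "a \<in> F.L" "b \<in> F.L" "z = a + b * sqrtC p" using assms by (rule quad_extE)
  have abN: "a \<in> N.L" "b \<in> N.L" using ab F_subset_N by blast+
  have "N.conj (M.conj z) = N.conj (a - b * sqrtC p)" unfolding ab(3) using ab(1,2) by simp
  also have "\<dots> = F.conj a + F.conj b * sqrtC p" using abN ab(1,2) by (simp add: N_conj_F)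
  also have "\<dots> = M.conj (F.conj a - F.conj b * sqrtC p)" using M.conj_eq[of "F.conj a" "- F.conj b"] ab(1,2) by simp
  also have "F.conj a - F.conj b * sqrtC p = N.conj z" unfolding ab(3) using abN ab(1,2) by (simp add: N_conj_F)
  finally show ?thesis .
qed

end

lemma (in complex_subring) principal_prod: "set_prod (scale a R) (scale b R) = scale (a * b) R"
  by (simp add: mult.commute)

lemma mult_swap_middle: "(x * y) * (z * t) = (x * z) * (y * t)" for x :: complex
  by simp

section \<open>Descent from K1 to k: replacing a capitulating ideal by an invariant one\<close>

context biquadratic
begin

lemma ext_ints: "E.ext k.ints = E.l.ints"
proof
  show "E.ext k.ints \<subseteq> E.l.ints"
    by (rule set_prod_subsetI) (use E.ints_subset in auto)
  show "E.l.ints \<subseteq> E.ext k.ints" using set_prod.prod[of _ E.l.ints 1 k.ints] by auto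
qed

lemma ext_scale_ints: "E.ext (scale a k.ints) = scale a E.l.ints"
  by (simp only: set_prod_scale_right ext_ints)

text \<open>For y in conj I the product x * y is divisible by c in K1, hence in k, because both
  numbers lie in k. So x * (I * conj I) is contained in c * I, and c itself belongs to I * conj
  I.\<close>

lemma ext_contract:
  assumes I: "I \<in> nonzero_ideals k.L" and x: "x \<in> k.L" "x \<in> E.ext I" shows "x \<in> I"
proof -
  have II: "set_ideal k.ints I" by (rule k.nonzero_idealsD[OF I])
  obtain c where c: "c \<in> gauss_int" "c \<noteq> 0" "set_prod I (k.conj ` I) = scale c k.ints"
    by (rule k.ideal_norm_principal[OF I])
  have xy: "x * y / c \<in> k.ints" if y: "y \<in> k.conj ` I" for y
  proof -
    have "x * y \<in> set_prod (E.ext I) (k.conj ` I)" using x(2) y by (rule set_prod.prod)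
    also have "set_prod (E.ext I) (k.conj ` I) = E.ext (scale c k.ints)" unfolding set_prod_assoc c(3) ..
    finally have "x * y / c \<in> E.l.ints" unfolding ext_scale_ints in_scale_iff[OF c(2)] .
    moreover have "y \<in> k.ints" using y k.set_ideal_conj[OF II] k.ideal_in_ints by blast
    then have "x * y / c \<in> k.L" using x(1) c(1) k.ints_in_L by simp
    ultimately show ?thesis by (simp add: integers_of_def)
  qed
  have sI: "set_ideal k.ints (scale c I)" using c(1) by (intro k.ints.set_ideal_scale_in II) simp
  have "set_prod I (k.conj ` I) \<subseteq> {z. x * z \<in> scale c I}"
  proof (rule set_prod_subsetI)
    fix i y assume i: "i \<in> I" and y: "y \<in> k.conj ` I"
    have "(x * y / c) * i \<in> I" using xy[OF y] i II unfolding set_ideal_def by blast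
    then have "x * (i * y) / c \<in> I" by (simp add: mult_ac)
    then show "i * y \<in> {z. x * z \<in> scale c I}" using in_scale_iff[OF c(2)] by blast
  next
    fix u v assume "u \<in> {z. x * z \<in> scale c I}" "v \<in> {z. x * z \<in> scale c I}"
    then have "x * u + x * v \<in> scale c I" using sI unfolding set_ideal_def by blast
    then show "u + v \<in> {z. x * z \<in> scale c I}" by (simp add: distrib_left)
  qed
  moreover have "c * 1 \<in> set_prod I (k.conj ` I)" unfolding c(3) scale_def by (intro imageI) simp
  ultimately have "x * c \<in> scale c I" by auto
  then show ?thesis unfolding in_scale_iff[OF c(2)] using c(2) by simp
qed

lemma ext_inj:
  assumes "I \<in> nonzero_ideals k.L" "J \<in> nonzero_ideals k.L" "E.ext I = E.ext J" shows "I = J"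
proof -
  have *: "I \<subseteq> J" if "I \<in> nonzero_ideals k.L" "J \<in> nonzero_ideals k.L" "E.ext I = E.ext J" for I J
  proof
    fix x assume x: "x \<in> I"
    have "1 * x \<in> E.ext I" by (rule set_prod.prod) (use x in simp_all)
    then have "x \<in> E.ext J" unfolding that(3) by simp
    moreover have "x \<in> k.L" using k.ideal_in_ints[OF k.nonzero_idealsD[OF that(1)] x] by (rule k.ints_in_L)
    ultimately show "x \<in> J" using ext_contract[OF that(2)] by blast
  qed
  show ?thesis using *[OF assms] *[OF assms(2,1) assms(3)[symmetric]] by blast
qed

text \<open>Two relative norms of the generator a are compared: over k it yields n with I^2 = (n),
  over F it yields c times a unit u. Their compatibility determines the norm of n / c, which brings
  Hilbert 90 into reach.\<close>

lemma capitulating_class: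
  assumes I: "I \<in> nonzero_ideals k.L" and a: "a \<noteq> 0" "E.ext I = scale a E.l.ints"
  obtains J c where "J \<in> nonzero_ideals k.L" "k.cls J = k.cls I" "c \<in> gauss_int" "set_prod J J = scale c k.ints"
proof -
  have II: "set_ideal k.ints I" by (rule k.nonzero_idealsD[OF I])
  have Isub: "I \<subseteq> k.L" using k.ideal_in_ints[OF II] k.ints_in_L by blast
  have IM: "I \<subseteq> M.L" using Isub k_subset_M by blast
  have aM: "a \<in> M.L"
  proof -
    have "a * 1 \<in> E.ext I" unfolding a(2) scale_def by (intro imageI) simp
    then show ?thesis using E.l.nonzero_idealsD[OF E.ext_nonzero[OF I]] unfolding set_ideal_def integers_of_def by auto
  qed
  have aN: "a \<in> N.L" using aM unfolding N_L_eq .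
  define n where "n = a * N.conj a"
  \<comment> \<open>\<open>N.conj\<close> fixes I elementwise, so \<open>N.conj a\<close> generates
    the extended ideal just as \<open>a\<close> does.\<close>
  have "N.conj ` E.ext I = E.ext (N.conj ` I)"
    using N.conj_image_ext[of I] IM unfolding N_L_eq by blast
  also have "N.conj ` I = (\<lambda>x. x) ` I" by (intro image_cong refl N.conj_base) (use Isub in blast)
  also have "\<dots> = I" by simp
  finally have sa: "scale (N.conj a) E.l.ints = E.ext I"
    using N.conj_image_principal[OF aN] unfolding N_L_eq a(2) by simp
  have nk: "n \<in> k.L" unfolding n_def by (rule N.norm_in[OF aN])
  have n0: "n \<noteq> 0" unfolding n_def using a(1) N.conj_eq_0_iff[OF aN] by simp
  have "E.ext (set_prod I I) = set_prod (E.ext I) (E.ext I)" by (rule E.ext_prod)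
  also have "\<dots> = set_prod (scale a E.l.ints) (scale (N.conj a) E.l.ints)" unfolding sa a(2) ..
  also have "\<dots> = scale n E.l.ints" unfolding n_def by (rule E.l.ints.principal_prod)
  finally have extn: "E.ext (set_prod I I) = scale n E.l.ints" .
  have IIn: "set_prod I I \<in> nonzero_ideals k.L" by (rule k.nonzero_ideals_prod[OF I I])
  have n_int: "n \<in> k.ints"
  proof -
    have "n * 1 \<in> E.ext (set_prod I I)" unfolding extn scale_def by (intro imageI) simp
    then have "n \<in> set_prod I I" using ext_contract[OF IIn nk] by simp
    then show ?thesis by (rule k.ideal_in_ints[OF k.nonzero_idealsD[OF IIn]])
  qed
  have "n * 1 \<in> scale n k.ints" unfolding scale_def by (intro imageI) simp
  then have nn: "scale n k.ints \<in> nonzero_ideals k.L"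
    using n0 by (intro k.nonzero_idealsI[of _ n] k.set_ideal_scale_ints n_int) simp_all
  have sq: "set_prod I I = scale n k.ints"
    by (rule ext_inj[OF IIn nn]) (simp only: extn ext_scale_ints)
  obtain c where c: "c \<in> gauss_int" "c \<noteq> 0" "set_prod I (k.conj ` I) = scale c k.ints"
    by (rule k.ideal_norm_principal[OF I])
  have "M.conj ` E.ext I = E.ext (M.conj ` I)" by (rule M.conj_image_ext[OF IM])
  also have "M.conj ` I = k.conj ` I" using Isub M_conj_k by (intro image_cong) auto
  finally have ra: "scale (M.conj a) E.l.ints = E.ext (k.conj ` I)"
    using M.conj_image_principal[OF aM] unfolding a(2) by simp
  have "scale (a * M.conj a) E.l.ints = set_prod (scale a E.l.ints) (scale (M.conj a) E.l.ints)"
    by (rule E.l.ints.principal_prod[symmetric])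
  also have "\<dots> = set_prod (E.ext I) (E.ext (k.conj ` I))" unfolding ra a(2) ..
  also have "\<dots> = scale c E.l.ints" unfolding E.ext_prod[symmetric] c(3) by (rule ext_scale_ints)
  finally have ac: "scale (a * M.conj a) E.l.ints = scale c E.l.ints" .
  \<comment> \<open>A unit of F, because \<open>a * M.conj a\<close> and \<open>c\<close> both
    generate the extension of I * conj I.\<close>
  define u where "u = a * M.conj a / c"
  have am0: "a * M.conj a \<noteq> 0" using a(1) M.conj_eq_0_iff[OF aM] by simp
  have u_int: "u \<in> E.l.ints" "c / (a * M.conj a) \<in> E.l.ints"
    unfolding u_def by (rule E.l.principal_eqD[OF ac am0 c(2)])+
  have amF: "a * M.conj a \<in> F.L" by (rule M.norm_in[OF aM])
  have uF: "u \<in> F.L" unfolding u_def using c(1) by (intro F.ext.divide[OF amF]) simp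
  have uints: "u \<in> F.ints" using u_int(1) uF unfolding integers_of_def by blast
  have iu: "inverse u = c / (a * M.conj a)" unfolding u_def by simp
  have iuints: "inverse u \<in> F.ints"
    using u_int(2) F.ext.inverse[OF uF] unfolding iu[symmetric] integers_of_def by blast
  define w where "w = u * F.conj u"
  have wG: "w \<in> gauss_int" unfolding w_def by (rule F.norm_gauss[OF uints])
  have u0: "u \<noteq> 0" using am0 c(2) by (simp add: u_def)
  have "w * (inverse u * F.conj (inverse u)) = (u * inverse u) * F.conj (u * inverse u)"
    unfolding w_def F.conj_mult[OF uF F.ext.inverse[OF uF]] by (rule mult_swap_middle)
  also have "u * inverse u = 1" using u0 by simp
  also have "1 * F.conj 1 = 1" by simp
  finally have "w gdvd 1" using F.norm_gauss[OF iuints] by (intro gdvdI[of "inverse u * F.conj (inverse u)"]) simp_all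
  then have w: "w = 1 \<or> w = -1"
    using gauss_units[OF wG] F.norm_unit_not_imaginary[OF uints gt1(6)] unfolding w_def by blast
  have cN: "N.conj c = c" "k.conj c = c" using c(1) by simp_all
  have MaN: "M.conj a \<in> N.L" using aM unfolding N_L_eq by simp
  have NaM: "N.conj a \<in> M.L" using aN unfolding N_L_eq[symmetric] by simp
  have uN: "u \<in> N.L" using uF F_subset_N by blast
  have cL': "c \<in> N.L" using c(1) by simp
  \<comment> \<open>The product of the four conjugates of a, grouped in two ways: over k it is the
    norm of n, over F the norm of u * c.\<close>
  have "n * k.conj n = n * M.conj n" using M_conj_k[OF nk] by simp
  also have "\<dots> = (a * N.conj a) * (M.conj a * M.conj (N.conj a))"
    unfolding n_def M.conj_mult[OF aM NaM] ..
  also have "\<dots> = (a * M.conj a) * (N.conj a * N.conj (M.conj a))" unfolding conj_commute[OF aM]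
    by (rule mult_swap_middle)
  also have "\<dots> = (a * M.conj a) * N.conj (a * M.conj a)" unfolding N.conj_mult[OF aN MaN] ..
  also have "a * M.conj a = u * c" unfolding u_def using c(2) by simp
  also have "(u * c) * N.conj (u * c) = (u * N.conj u) * (c * c)"
    unfolding N.conj_mult[OF uN cL'] cN(1) by (rule mult_swap_middle)
  also have "u * N.conj u = w" unfolding w_def N_conj_F[OF uF] ..
  finally have nw: "n * k.conj n = w * (c * c)" .
  have cL: "c \<in> k.L" using c(1) by simp
  \<comment> \<open>Multiply I^2 = (n) by conj I and use I * conj I = (c).\<close>
  have base: "scale (n / c) (k.conj ` I) = I"
  proof -
    have "scale n (k.conj ` I) = set_prod (set_prod I I) (k.conj ` I)"
      unfolding sq set_prod_scale_left k.ints.set_prod_ideal[OF k.set_ideal_conj[OF II]] ..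
    also have "\<dots> = set_prod I (scale c k.ints)" unfolding set_prod_assoc c(3) ..
    also have "\<dots> = scale c I" unfolding set_prod_scale_right k.ints.set_prod_ideal2[OF II] ..
    finally show ?thesis using scale_eq_iff[OF c(2), of I n "k.conj ` I"] by blast
  qed
  have norm: "(n / c) * k.conj (n / c) = w"
    unfolding k.conj_divide[OF nk cL] cN(2) times_divide_times_eq nw using c(2) by simp
  have ncL: "n / c \<in> k.L" using nk cL by (rule k.ext.divide)
  from w show ?thesis
  proof
    assume "w = 1"
    then have n1: "(n / c) * k.conj (n / c) = 1" unfolding norm .
    show ?thesis by (rule k.hilbert90_representative[OF I ncL n1 base]) (rule that)
  next
    \<comment> \<open>The unit i is fixed by \<open>k.conj\<close>, so multiplying by it keeps the
      ideal and changes the norm by i^2 = -1.\<close>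
    assume w1: "w = -1"
    have "scale (\<i> * (n / c)) (k.conj ` I) = scale \<i> (scale (n / c) (k.conj ` I))"
      by (rule scale_scale[symmetric])
    also have "\<dots> = scale \<i> I" unfolding base ..
    also have "\<dots> = I" by (rule k.ints.scale_unit[OF _ _ _ II]) simp_all
    finally have b: "scale (\<i> * (n / c)) (k.conj ` I) = I" .
    have iL: "\<i> \<in> k.L" by simp
    have "(\<i> * (n / c)) * k.conj (\<i> * (n / c)) = (\<i> * \<i>) * ((n / c) * k.conj (n / c))"
      unfolding k.conj_mult[OF iL ncL] k.conj_base[OF imaginary_in_gauss_rat] by (rule mult_swap_middle)
    also have "\<dots> = 1" unfolding norm w1 by simp
    finally have n1: "(\<i> * (n / c)) * k.conj (\<i> * (n / c)) = 1" .
    show ?thesis by (rule k.hilbert90_representative[OF I k.ext.mult[OF iL ncL] n1 b]) (rule that)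
  qed
qed

end

section \<open>Capitulation of the ramified primes\<close>

context number_field
begin

lemma principal_of_square:
  assumes I: "set_ideal ints I" "set_prod I I = scale r ints" and r: "r \<noteq> 0"
    and \<theta>: "\<theta> \<in> K" "\<theta> * \<theta> = r * \<eta>" and \<eta>: "\<eta> \<in> ints" "inverse \<eta> \<in> ints" "\<eta> \<noteq> 0"
  shows "\<theta> \<noteq> 0" "I = scale \<theta> ints"
proof -
  show t0: "\<theta> \<noteq> 0" using \<theta>(2) r \<eta>(3) by auto
  have "set_prod I I = scale (\<theta> * \<theta>) ints" unfolding \<theta>(2) scale_associated[OF \<eta>] by (rule I(2))
  then show "I = scale \<theta> ints" by (rule ideal_of_square_principal[OF I(1) \<theta>(1) t0])
qed

end

context biquadratic
begin

lemma capitulates_of_square: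
  assumes H: "H \<in> nonzero_ideals k.L" "set_prod H H = scale r k.ints" and r: "r \<noteq> 0"
    and \<theta>: "\<theta> \<in> M.L" "\<theta> * \<theta> = r * \<eta>" and \<eta>: "\<eta> \<in> E.l.ints" "inverse \<eta> \<in> E.l.ints" "\<eta> \<noteq> 0"
  shows "\<exists>a. a \<noteq> 0 \<and> E.ext H = scale a E.l.ints"
proof -
  have "set_prod (E.ext H) (E.ext H) = scale r E.l.ints"
    unfolding E.ext_prod[symmetric] H(2) by (rule ext_scale_ints)
  then show ?thesis
    using E.l.principal_of_square[OF E.l.nonzero_idealsD[OF E.ext_nonzero[OF H(1)]] _ r \<theta> \<eta>] by blast
qed

lemma sqrtC_integral [simp]: "algebraic_int (sqrtC n)"
proof -
  have "algebraic_int ((sqrtC n)\<^sup>2)" unfolding power2_eq_square sqrtC_self by simp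
  then show ?thesis by (rule iffD1[OF algebraic_int_power2_iff])
qed

lemma gauss_int_in_M_ints [simp]: "a \<in> gauss_int \<Longrightarrow> a \<in> E.l.ints"
  by (simp add: integers_of_def)

lemma sqrtC_p_in_M_ints: "sqrtC p \<in> E.l.ints"
  unfolding integers_of_def by simp

lemma sqrtC_m_in_M_ints: "sqrtC m \<in> E.l.ints"
  unfolding integers_of_def by simp

text \<open>Take z = gcd(w, b). Its square expands into multiples of w^2, b w and b^2 = w * cnj w,
  so w divides z^2. Conversely z^2 divides w, because w = mu w^2 + nu b^2 by the Bezout
  relation.\<close>

lemma gauss_coprime_square:
  assumes w: "w \<in> gauss_int" "w * cnj w = of_nat b * of_nat b" "w \<noteq> 0"
    and cop: "\<mu> \<in> gauss_int" "\<nu> \<in> gauss_int" "\<mu> * w + \<nu> * cnj w = 1"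
  obtains z u where "z \<in> gauss_int" "z \<noteq> 0" "u \<in> gauss_int" "u gdvd 1" "w = u * (z * z)"
proof -
  have bG: "of_nat b \<in> gauss_int" by simp
  obtain z s t where z: "s \<in> gauss_int" "t \<in> gauss_int" "z = s * w + t * of_nat b" "z gdvd w" "z gdvd of_nat b" "z \<in> gauss_int"
    by (rule gauss_gcd[OF w(1) bG])
  obtain w1 where w1: "w1 \<in> gauss_int" "w = z * w1" using z(4) by (rule gdvdE)
  obtain b1 where b1: "b1 \<in> gauss_int" "of_nat b = z * b1" using z(5) by (rule gdvdE)
  define v where "v = s * s * w + 2 * s * t * of_nat b + t * t * cnj w"
  define u where "u = \<mu> * (w1 * w1) + \<nu> * (b1 * b1)"
  have uv: "u \<in> gauss_int" "v \<in> gauss_int" using z(1,2) w(1) w1(1) b1(1) cop(1,2) by (simp_all add: u_def v_def)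
  have "z * z = s * s * (w * w) + 2 * s * t * of_nat b * w + t * t * (of_nat b * of_nat b)"
    unfolding z(3) by (simp add: algebra_simps)
  also have "\<dots> = w * v" unfolding w(2)[symmetric] v_def by (simp add: algebra_simps)
  finally have zz: "z * z = w * v" .
  have "w = w * (\<mu> * w + \<nu> * cnj w)" unfolding cop(3) by simp
  also have "\<dots> = \<mu> * (w * w) + \<nu> * (w * cnj w)" by (simp add: algebra_simps)
  also have "\<dots> = \<mu> * ((z * w1) * (z * w1)) + \<nu> * ((z * b1) * (z * b1))"
    unfolding w(2) unfolding b1(2) unfolding w1(2)[symmetric] ..
  also have "\<dots> = u * (z * z)" unfolding u_def by (simp add: algebra_simps)
  finally have wu: "w = u * (z * z)" .
  have "w * 1 = u * (w * v)" using wu unfolding zz by simp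
  also have "\<dots> = w * (u * v)" by (rule mult.left_commute)
  finally have "1 = u * v" using w(3) by (simp only: mult_left_cancel not_False_eq_True)
  then have "u gdvd 1" by (rule gdvdI[OF uv(2)])
  moreover have "z \<noteq> 0"
  proof
    assume "z = 0"
    then have "w = 0" unfolding w1(2) by simp
    then show False using w(3) by simp
  qed
  ultimately show ?thesis using that[of z u] z(6) uv(1) wu by blast
qed

text \<open>From a^2 + 1 = p b^2 one gets a + s i = pi * u * z^2 with a sign s and a unit u of Z[i].
  The unit eps = a + b sqrt p of norm -1 satisfies (eps + s i)^2 = 2 eps (a + s i). So pi * eps is a
  square as soon as 2 u is, that is, for u = i or -i.\<close>

lemma pi_times_unit_square:
  fixes e' f' :: int
  assumes \<pi>: "\<pi> = of_int e' + of_int (2 * f') * \<i>" "gprime \<pi>" "\<pi> * cnj \<pi> = of_nat p"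
  shows "\<exists>\<theta> \<eta>. \<theta> \<in> M.L \<and> \<theta> * \<theta> = \<pi> * \<eta> \<and> \<eta> \<in> E.l.ints \<and> inverse \<eta> \<in> E.l.ints \<and> \<eta> \<noteq> 0"
proof -
  have \<pi>G: "\<pi> \<in> gauss_int" "\<pi> \<noteq> 0" "cnj \<pi> \<in> gauss_int" using \<pi>(2) by simp_all
  obtain a b :: nat where ab: "a\<^sup>2 + 1 = p * b\<^sup>2" "even a" using negative_pell[OF prime(1) mod4(1)] by metis
  obtain a' where a': "a = 2 * a'" using ab(2) by (rule evenE)
  have "of_nat (a\<^sup>2 + 1) = (of_nat (p * b\<^sup>2) :: complex)" unfolding ab(1) ..
  then have abC: "of_nat a * of_nat a + 1 = (of_nat p * (of_nat b * of_nat b) :: complex)"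
    by (simp add: power2_eq_square add.commute)
  have "(of_nat a + \<i>) * (of_nat a - \<i>) = \<pi> * (cnj \<pi> * (of_nat b * of_nat b))"
  proof -
    have "(of_nat a + \<i>) * (of_nat a - \<i>) = of_nat a * of_nat a + 1" by (simp add: algebra_simps)
    also have "\<dots> = (\<pi> * cnj \<pi>) * (of_nat b * of_nat b)" unfolding abC \<pi>(3) ..
    finally show ?thesis by (simp only: mult.assoc)
  qed
  then have "\<pi> gdvd (of_nat a + \<i>) * (of_nat a - \<i>)" using \<pi>G by (intro gdvdI[of "cnj \<pi> * (of_nat b * of_nat b)"]) simp_all
  then have "\<pi> gdvd of_nat a + \<i> \<or> \<pi> gdvd of_nat a - \<i>" using gprime_dvd_mult[OF \<pi>(2)] by simp
  then have "\<pi> gdvd of_nat a + of_int 1 * \<i> \<or> \<pi> gdvd of_nat a + of_int (-1) * \<i>" by simp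
  then obtain s :: int where s: "s = 1 \<or> s = -1" "\<pi> gdvd of_nat a + of_int s * \<i>" by blast
  have ss: "of_int s * of_int s = (1 :: complex)" using s(1) by auto
  obtain w where w: "w \<in> gauss_int" "of_nat a + of_int s * \<i> = \<pi> * w" using s(2) by (rule gdvdE)
  have "cnj (of_nat a + of_int s * \<i>) = cnj \<pi> * cnj w" unfolding w(2) by simp
  then have cw: "of_nat a - of_int s * \<i> = cnj \<pi> * cnj w" by simp
  have nrm: "(of_nat a + of_int s * \<i>) * (of_nat a - of_int s * \<i>) = of_nat a * of_nat a + 1"
  proof -
    have "(of_nat a + of_int s * \<i>) * (of_nat a - of_int s * \<i>) = of_nat a * of_nat a + of_int s * of_int s"
      by (simp add: algebra_simps)
    then show ?thesis unfolding ss .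
  qed
  have "of_nat p * (w * cnj w) = (\<pi> * w) * (cnj \<pi> * cnj w)" unfolding \<pi>(3)[symmetric] by (rule mult_swap_middle)
  also have "\<dots> = of_nat p * (of_nat b * of_nat b)" unfolding w(2)[symmetric] cw[symmetric] nrm by (rule abC)
  finally have wb: "w * cnj w = of_nat b * of_nat b" using gt1(1) by simp
  have nz: "of_nat a + of_int s * \<i> \<noteq> 0"
  proof
    assume "of_nat a + of_int s * \<i> = 0"
    then have "Im (of_nat a + of_int s * \<i>) = 0" by simp
    then show False using s(1) by auto
  qed
  then have w0: "w \<noteq> 0" using w(2) by auto
  \<comment> \<open>Bezout coefficients for w and its conjugate. The product (a + s i) (a - s i) is
    a^2 + 1, and the difference 2 s i of the factors, multiplied by a' a s i, contributes -a^2 since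
    a = 2 a'.\<close>
  define \<mu> \<nu> where "\<mu> = \<pi> * ((of_nat a - of_int s * \<i>) + of_nat (a' * a) * of_int s * \<i>)"
    and "\<nu> = - cnj \<pi> * of_nat (a' * a) * of_int s * \<i>"
  have \<mu>\<nu>: "\<mu> \<in> gauss_int" "\<nu> \<in> gauss_int" using \<pi>G unfolding \<mu>_def \<nu>_def by simp_all
  have "\<mu> * w + \<nu> * cnj w = (\<pi> * w) * ((of_nat a - of_int s * \<i>) + of_nat (a' * a) * of_int s * \<i>)
      - (cnj \<pi> * cnj w) * (of_nat (a' * a) * of_int s * \<i>)"
    unfolding \<mu>_def \<nu>_def by (simp add: mult_ac)
  also have "\<dots> = (of_nat a + of_int s * \<i>) * (of_nat a - of_int s * \<i>)
      + of_nat (a' * a) * (2 * (\<i> * \<i>) * (of_int s * of_int s))"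
    unfolding w(2)[symmetric] cw[symmetric] by (simp add: algebra_simps)
  also have "\<dots> = 1" unfolding nrm ss unfolding a' by simp
  finally have cop: "\<mu> * w + \<nu> * cnj w = 1" .
  obtain z u where z: "z \<in> gauss_int" "z \<noteq> 0" "u \<in> gauss_int" "u gdvd 1" "w = u * (z * z)"
    by (rule gauss_coprime_square[OF w(1) wb w0 \<mu>\<nu> cop])
  have au: "of_nat a + of_int s * \<i> = \<pi> * (u * (z * z))" using w(2) unfolding z(5) .
  obtain c1 c2 where zc: "z = of_int c1 + of_int c2 * \<i>" using z(1) by (rule gauss_intE)
  \<comment> \<open>Both pi and z^2 have even imaginary part, hence so has their product, whereas a
    + s i has imaginary part 1 or -1. So u cannot be real.\<close>
  have "Im (\<pi> * (z * z)) = of_int (2 * (e' * (c1 * c2) + f' * (c1 * c1 - c2 * c2)))"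
    unfolding zc \<pi>(1) by (simp add: algebra_simps)
  moreover have "Im (of_nat a + of_int s * \<i>) = of_int s" by simp
  ultimately have not_real: "of_nat a + of_int s * \<i> \<noteq> of_int r * (\<pi> * (z * z))" for r
  proof -
    assume im: "Im (\<pi> * (z * z)) = of_int (2 * (e' * (c1 * c2) + f' * (c1 * c1 - c2 * c2)))"
      "Im (of_nat a + of_int s * \<i>) = of_int s"
    show ?thesis
    proof
      assume "of_nat a + of_int s * \<i> = of_int r * (\<pi> * (z * z))"
      then have "Im (of_nat a + of_int s * \<i>) = Im (of_int r * (\<pi> * (z * z)))" by (rule arg_cong)
      also have "\<dots> = of_int r * Im (\<pi> * (z * z))" by simp
      finally have "real_of_int s = of_int (r * (2 * (e' * (c1 * c2) + f' * (c1 * c1 - c2 * c2))))" unfolding im by simp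
      then have "s = r * (2 * (e' * (c1 * c2) + f' * (c1 * c1 - c2 * c2)))" by (simp only: of_int_eq_iff)
      then have "even s" by simp
      then show False using s(1) by auto
    qed
  qed
  have "u \<noteq> 1" using not_real[of 1] au by auto
  moreover have "u \<noteq> -1" using not_real[of "-1"] au by auto
  ultimately have u: "u = \<i> \<or> u = - \<i>" using gauss_units[OF z(3,4)] by blast
  obtain l where l: "l \<in> gauss_int" "l \<noteq> 0" "l * l = 2 * u"
  proof -
    have 1: "(1 + \<i>) * (1 + \<i>) = 2 * \<i>" "(1 - \<i>) * (1 - \<i>) = 2 * - \<i>" by (simp_all add: algebra_simps)
    have 2: "1 + \<i> \<noteq> 0" "1 - \<i> \<noteq> 0" by (simp_all add: complex_eq_iff)
    show ?thesis using u that[of "1 + \<i>"] that[of "1 - \<i>"] 1 2 by auto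
  qed
  \<comment> \<open>As the norm is -1, the inverse of this unit is minus its conjugate.\<close>
  define \<epsilon> \<epsilon>' where "\<epsilon> = of_nat a + of_nat b * sqrtC p" and "\<epsilon>' = of_nat b * sqrtC p - of_nat a"
  have eint: "\<epsilon> \<in> E.l.ints" "\<epsilon>' \<in> E.l.ints"
    unfolding \<epsilon>_def \<epsilon>'_def using sqrtC_p_in_M_ints
    by (auto intro!: E.l.ints.add E.l.ints.diff E.l.ints.mult)
  have "\<epsilon> * \<epsilon>' = of_nat b * of_nat b * (sqrtC p * sqrtC p) - of_nat a * of_nat a"
    unfolding \<epsilon>_def \<epsilon>'_def by (simp add: algebra_simps del: sqrtC_self)
  also have "\<dots> = 1" unfolding sqrtC_self using abC by (simp add: algebra_simps)
  finally have ee: "\<epsilon> * \<epsilon>' = 1" .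
  have e0: "\<epsilon> \<noteq> 0" using ee by auto
  have inv: "inverse \<epsilon> = \<epsilon>'" using ee by (rule inverse_unique)
  define \<theta> where "\<theta> = (\<epsilon> + of_int s * \<i>) / (l * z)"
  have "(\<epsilon> + of_int s * \<i>) * (\<epsilon> + of_int s * \<i>) = \<epsilon> * \<epsilon> + 2 * of_int s * \<i> * \<epsilon> + (\<i> * \<i>) * (of_int s * of_int s)"
    by (simp add: algebra_simps)
  also have "\<dots> = \<epsilon> * \<epsilon> + 2 * of_int s * \<i> * \<epsilon> - \<epsilon> * \<epsilon>'" unfolding ss ee by simp
  also have "\<dots> = \<epsilon> * ((\<epsilon> - \<epsilon>') + 2 * of_int s * \<i>)" by (simp add: algebra_simps)
  also have "(\<epsilon> - \<epsilon>') + 2 * of_int s * \<i> = 2 * (of_nat a + of_int s * \<i>)" unfolding \<epsilon>_def \<epsilon>'_def by (simp add: algebra_simps)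
  also have "\<epsilon> * (2 * (of_nat a + of_int s * \<i>)) = \<pi> * \<epsilon> * ((2 * u) * (z * z))" unfolding au by (simp add: mult_ac)
  also have "\<dots> = \<pi> * \<epsilon> * ((l * z) * (l * z))" unfolding l(3)[symmetric] by (simp add: mult_ac)
  finally have num: "(\<epsilon> + of_int s * \<i>) * (\<epsilon> + of_int s * \<i>) = \<pi> * \<epsilon> * ((l * z) * (l * z))" .
  have "\<theta> * \<theta> = \<pi> * \<epsilon>" unfolding \<theta>_def times_divide_times_eq num using l(2) z(2) by simp
  moreover have "\<epsilon> \<in> M.L" using eint(1) unfolding integers_of_def by blast
  then have "\<theta> \<in> M.L" unfolding \<theta>_def using l(1) z(1)
    by (intro M.ext.divide M.ext.add M.ext.mult) simp_all
  ultimately show ?thesis using eint e0 inv by metis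
qed

text \<open>If q1 A^2 - q2 B^2 = 1 or -1, then eta = (A sqrt q1 + B sqrt q2)^2 is a unit. Multiplied
  by q1 or q2 it becomes the square of q1 A + B sqrt(q1 q2) or q2 B + A sqrt(q1 q2), which involve
  only sqrt(q1 q2).\<close>

lemma q_times_unit_square:
  obtains \<theta>1 \<theta>2 \<eta> where "\<theta>1 \<in> M.L" "\<theta>2 \<in> M.L" "\<theta>1 * \<theta>1 = of_nat q1 * \<eta>" "\<theta>2 * \<theta>2 = of_nat q2 * \<eta>"
    "\<eta> \<in> E.l.ints" "inverse \<eta> \<in> E.l.ints" "\<eta> \<noteq> 0"
proof -
  obtain a b :: int where ab: "int q1 * a\<^sup>2 - int q2 * b\<^sup>2 = 1 \<or> int q1 * a\<^sup>2 - int q2 * b\<^sup>2 = -1"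
    using pell_mixed[OF prime(2,3) neq(3) mod4(2,3)] by metis
  define g h :: complex where "g = of_nat q1" and "h = of_nat q2"
  define A B where "A = (of_int a :: complex)" and "B = (of_int b :: complex)"
  define S where "S = sqrtC m"
  have SS: "S * S = g * h" unfolding S_def sqrtC_self g_def h_def by simp
  have "of_int (int q1 * a\<^sup>2 - int q2 * b\<^sup>2) = g * A * A - h * B * B"
    unfolding g_def h_def A_def B_def by (simp add: power2_eq_square)
  then have "g * A * A - h * B * B = 1 \<or> g * A * A - h * B * B = -1"
    using ab by (metis of_int_1 of_int_minus)
  moreover have "t * t = 1" if "t = 1 \<or> t = -1" for t :: complex using that by auto
  ultimately have one: "(g * A * A - h * B * B) * (g * A * A - h * B * B) = 1" by blast
  have mem: "g \<in> E.l.ints" "h \<in> E.l.ints" "A \<in> E.l.ints" "B \<in> E.l.ints" "S \<in> E.l.ints"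
    unfolding g_def h_def A_def B_def S_def using sqrtC_m_in_M_ints by simp_all
  define \<eta> \<eta>' where "\<eta> = g * A * A + h * B * B + 2 * A * B * S" and "\<eta>' = g * A * A + h * B * B - 2 * A * B * S"
  have two: "2 \<in> E.l.ints" by simp
  have eint: "\<eta> \<in> E.l.ints" "\<eta>' \<in> E.l.ints" unfolding \<eta>_def \<eta>'_def
    by (intro E.l.ints.add E.l.ints.diff E.l.ints.mult mem two)+
  have "\<eta> * \<eta>' = (g * A * A + h * B * B) * (g * A * A + h * B * B) - 4 * A * A * B * B * (S * S)"
    unfolding \<eta>_def \<eta>'_def by (simp add: algebra_simps)
  also have "\<dots> = (g * A * A - h * B * B) * (g * A * A - h * B * B)" unfolding SS by (simp add: algebra_simps)
  finally have ee: "\<eta> * \<eta>' = 1" unfolding one .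
  have "(g * A + B * S) * (g * A + B * S) = g * g * A * A + 2 * g * A * B * S + B * B * (S * S)" by (simp add: algebra_simps)
  also have "\<dots> = g * \<eta>" unfolding SS \<eta>_def by (simp add: algebra_simps)
  finally have t1: "(g * A + B * S) * (g * A + B * S) = g * \<eta>" .
  have "(h * B + A * S) * (h * B + A * S) = h * h * B * B + 2 * h * A * B * S + A * A * (S * S)" by (simp add: algebra_simps)
  also have "\<dots> = h * \<eta>" unfolding SS \<eta>_def by (simp add: algebra_simps)
  finally have t2: "(h * B + A * S) * (h * B + A * S) = h * \<eta>" .
  have "g * A + B * S \<in> E.l.ints" "h * B + A * S \<in> E.l.ints" by (intro E.l.ints.add E.l.ints.mult mem)+
  then have "g * A + B * S \<in> M.L" "h * B + A * S \<in> M.L" unfolding integers_of_def by blast+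
  moreover have "inverse \<eta> = \<eta>'" using ee by (rule inverse_unique)
  moreover have "\<eta> \<noteq> 0" using ee by auto
  ultimately show ?thesis using that t1 t2 eint unfolding g_def h_def by metis
qed

end

section \<open>The four ramified classes and the kernel they generate\<close>

locale biquadratic_primes = biquadratic +
  fixes H1 H2 Q1 Q2 :: "complex set"
  assumes prime_ideals: "primeideal H1 (ring_of_integers k.L)" "primeideal H2 (ring_of_integers k.L)"
    "primeideal Q1 (ring_of_integers k.L)" "primeideal Q2 (ring_of_integers k.L)"
    and above: "\<pi>1 \<in> H1" "\<pi>2 \<in> H2" "of_nat q1 \<in> Q1" "of_nat q2 \<in> Q2"
begin

lemma prime_squares:
  "set_prod H1 H1 = scale \<pi>1 k.ints" "set_prod H2 H2 = scale \<pi>2 k.ints"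
  "set_prod Q1 Q1 = scale (of_nat q1) k.ints" "set_prod Q2 Q2 = scale (of_nat q2) k.ints"
proof -
  have d: "of_nat d = \<pi>2 * (\<pi>1 * (of_nat q1 * of_nat q2))" "of_nat d = of_nat q1 * (\<pi>1 * (\<pi>2 * of_nat q2))"
    "of_nat d = of_nat q2 * (\<pi>1 * (\<pi>2 * of_nat q1))"
    unfolding d_factor by (simp_all only: mult_ac)
  show "set_prod H1 H1 = scale \<pi>1 k.ints"
    by (rule k.ramified_prime_square[OF prime_ideals(1) above(1) gprimes(1) not_dvd_2(1) _ d_factor pi_not_dvd_rest(1)]) simp
  show "set_prod H2 H2 = scale \<pi>2 k.ints"
    by (rule k.ramified_prime_square[OF prime_ideals(2) above(2) gprimes(2) not_dvd_2(2) _ d(1) pi_not_dvd_rest(2)]) simp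
  show "set_prod Q1 Q1 = scale (of_nat q1) k.ints"
    by (rule k.ramified_prime_square[OF prime_ideals(3) above(3) gprimes(3) not_dvd_2(3) _ d(2) pi_not_dvd_rest(3)]) simp
  show "set_prod Q2 Q2 = scale (of_nat q2) k.ints"
    by (rule k.ramified_prime_square[OF prime_ideals(4) above(4) gprimes(4) not_dvd_2(4) _ d(3) pi_not_dvd_rest(4)]) simp
qed

lemma nonzero [simp]:
  "H1 \<in> nonzero_ideals k.L" "H2 \<in> nonzero_ideals k.L" "Q1 \<in> nonzero_ideals k.L" "Q2 \<in> nonzero_ideals k.L"
  using prime_ideals[THEN k.primeideal_set_ideal] above gprimes[THEN gprime_nz]
  by (auto intro: k.nonzero_idealsI)

lemma capitulating_primes:
  assumes "P \<in> {H1, H2, Q1, Q2}" shows "\<exists>a. a \<noteq> 0 \<and> E.ext P = scale a E.l.ints"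
proof -
  have cnj: "cnj \<pi>1 = \<pi>2" "cnj \<pi>2 = \<pi>1" unfolding \<pi>1_def \<pi>2_def by simp_all
  have 1: "\<pi>1 * cnj \<pi>1 = of_nat p" "\<pi>2 * cnj \<pi>2 = of_nat p" unfolding cnj using pi_mult by (simp_all add: mult.commute)
  have "\<exists>a. a \<noteq> 0 \<and> E.ext H1 = scale a E.l.ints"
    using capitulates_of_square[OF nonzero(1) prime_squares(1) gprime_nz[OF gprimes(1)]]
      pi_times_unit_square[OF \<pi>1_def gprimes(1) 1(1)] by blast
  moreover have "\<exists>a. a \<noteq> 0 \<and> E.ext H2 = scale a E.l.ints"
    using capitulates_of_square[OF nonzero(2) prime_squares(2) gprime_nz[OF gprimes(2)]]
      pi_times_unit_square[OF \<pi>2_def gprimes(2) 1(2)] by blast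
  moreover obtain \<theta>1 \<theta>2 \<eta> where \<theta>: "\<theta>1 \<in> M.L" "\<theta>2 \<in> M.L" "\<theta>1 * \<theta>1 = of_nat q1 * \<eta>" "\<theta>2 * \<theta>2 = of_nat q2 * \<eta>"
    "\<eta> \<in> E.l.ints" "inverse \<eta> \<in> E.l.ints" "\<eta> \<noteq> 0" by (rule q_times_unit_square)
  moreover have "\<exists>a. a \<noteq> 0 \<and> E.ext Q1 = scale a E.l.ints"
    by (rule capitulates_of_square[OF nonzero(3) prime_squares(3) gprime_nz[OF gprimes(3)] \<theta>(1,3,5,6,7)])
  moreover have "\<exists>a. a \<noteq> 0 \<and> E.ext Q2 = scale a E.l.ints"
    by (rule capitulates_of_square[OF nonzero(4) prime_squares(4) gprime_nz[OF gprimes(4)] \<theta>(2,4,5,6,7)])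
  ultimately show ?thesis using assms by blast
qed

abbreviation Cl where "Cl \<equiv> class_group k.L"

sublocale Cl: comm_monoid Cl
  by (rule k.class_group_comm_monoid)

lemma prime_class_carrier: "P \<in> {H1, H2, Q1, Q2} \<Longrightarrow> k.cls P \<in> carrier Cl"
  using nonzero by (auto simp: k.class_group_carrier)

lemma principal_class: 
  assumes "I \<in> nonzero_ideals k.L" "I = scale a k.ints" "a \<noteq> 0" shows "k.cls I = \<one>\<^bsub>Cl\<^esub>"
  using k.cls_eq_one_iff[OF assms(1)] assms(2,3) by blast

lemma prime_class_square: 
  assumes "P \<in> {H1, H2, Q1, Q2}" shows "k.cls P \<otimes>\<^bsub>Cl\<^esub> k.cls P = \<one>\<^bsub>Cl\<^esub>"
proof -
  obtain r where "P \<in> nonzero_ideals k.L" "set_prod P P = scale r k.ints" "r \<noteq> 0"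
    using assms nonzero prime_squares gprimes[THEN gprime_nz] by blast
  then show ?thesis
    using principal_class[OF k.nonzero_ideals_prod] k.class_group_mult by metis
qed

text \<open>One inclusion is the capitulation of the four primes and the multiplicativity of
  extension. For the other, a capitulating ideal is replaced by one of the same class with principal
  square, and the primes are stripped from that square.\<close>

lemma kernel_eq_generate:
  assumes gens: "X' \<subseteq> k.cls ` {H1, H2, Q1, Q2}"
    and all: "\<And>P. P \<in> {H1, H2, Q1, Q2} \<Longrightarrow> k.cls P \<in> generate Cl X'"
  shows "capitulation_kernel k.L M.L = generate Cl X'"
proof
  show "generate Cl X' \<subseteq> capitulation_kernel k.L M.L"
  proof
    fix C assume "C \<in> generate Cl X'"
    then have "C \<in> k.cls ` {I \<in> nonzero_ideals k.L. \<exists>a. a \<noteq> 0 \<and> E.ext I = scale a E.l.ints}" (is "_ \<in> ?K")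
    proof induction
      case one
      have "E.ext k.ints = scale 1 E.l.ints" unfolding ext_ints by simp
      moreover have "(1 :: complex) \<noteq> 0" by simp
      moreover have "k.ints \<in> nonzero_ideals k.L" by simp
      ultimately have "k.ints \<in> {I \<in> nonzero_ideals k.L. \<exists>a. a \<noteq> 0 \<and> E.ext I = scale a E.l.ints}" by blast
      then show ?case unfolding k.class_group_one by blast
    next
      case (incl h)
      then show ?case using gens capitulating_primes nonzero by blast
    next
      case (inv h)
      then obtain P where P: "P \<in> {H1, H2, Q1, Q2}" "h = k.cls P" using gens by blast
      \<comment> \<open>Each generator squares to one, which evaluates the inverse occurring in
        \<open>generate\<close> within the class monoid.\<close>
      have "inv\<^bsub>Cl\<^esub> h = h" unfolding P(2)
        by (rule Cl.comm_inv_char[OF prime_class_carrier[OF P(1)] prime_class_carrier[OF P(1)] prime_class_square[OF P(1)]])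
      then show ?case using P capitulating_primes[OF P(1)] nonzero by auto
    next
      case (eng h1 h2)
      then obtain I J a b where IJ: "I \<in> nonzero_ideals k.L" "J \<in> nonzero_ideals k.L" "h1 = k.cls I" "h2 = k.cls J"
        "a \<noteq> 0" "b \<noteq> 0" "E.ext I = scale a E.l.ints" "E.ext J = scale b E.l.ints" by blast
      have "E.ext (set_prod I J) = scale (a * b) E.l.ints"
        unfolding E.ext_prod IJ(7,8) by (rule E.l.ints.principal_prod)
      moreover have "h1 \<otimes>\<^bsub>Cl\<^esub> h2 = k.cls (set_prod I J)" unfolding IJ(3,4) by (rule k.class_group_mult[OF IJ(1,2)])
      moreover have "a * b \<noteq> 0" using IJ by simp
      ultimately show ?case using k.nonzero_ideals_prod[OF IJ(1,2)] by blast
    qed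
    then show "C \<in> capitulation_kernel k.L M.L" unfolding E.capitulation_kernel_eq .
  qed
  show "capitulation_kernel k.L M.L \<subseteq> generate Cl X'"
  proof
    fix C assume "C \<in> capitulation_kernel k.L M.L"
    then obtain I a where I: "I \<in> nonzero_ideals k.L" "C = k.cls I" "a \<noteq> 0" "E.ext I = scale a E.l.ints"
      unfolding E.capitulation_kernel_eq by blast
    obtain J c where J: "J \<in> nonzero_ideals k.L" "k.cls J = k.cls I" "c \<in> gauss_int" "set_prod J J = scale c k.ints"
      by (rule capitulating_class[OF I(1,3,4)])
    have "k.cls J \<in> generate Cl X'"
    proof (rule k.class_of_ideal_with_principal_square[of "{H1, H2, Q1, Q2}"])
      fix r assume r: "gprime r" "r gdvd of_nat d"
      have "r gdvd \<pi>1 \<or> r gdvd \<pi>2 \<or> r gdvd of_nat q1 \<or> r gdvd of_nat q2"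
        using r(2) unfolding d_factor
        using gprime_dvd_mult[OF r(1), of \<pi>1 "\<pi>2 * (of_nat q1 * of_nat q2)"]
          gprime_dvd_mult[OF r(1), of \<pi>2 "of_nat q1 * of_nat q2"]
          gprime_dvd_mult[OF r(1), of "of_nat q1" "of_nat q2"] by auto
      then obtain t P where t: "P \<in> {H1, H2, Q1, Q2}" "set_prod P P = scale t k.ints" "r gdvd t" "gprime t"
        using prime_squares gprimes by blast
      \<comment> \<open>A prime divisor of d is only associated to one of the four chosen
        generators; the unit between them is absorbed by the ideal.\<close>
      obtain u where u: "u \<in> gauss_int" "u gdvd 1" "t = r * u" by (rule gprime_associated[OF r(1) t(4,3)])
      obtain v where v: "v \<in> gauss_int" "1 = u * v" using u(2) by (rule gdvdE)
      have "inverse u = v" using v(2) by (intro inverse_unique) simp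
      moreover have "u \<noteq> 0" using v(2) by auto
      ultimately have "scale (r * u) k.ints = scale r k.ints" using u(1) v(1) by (intro k.scale_associated) simp_all
      then show "\<exists>P\<in>{H1, H2, Q1, Q2}. set_prod P P = scale r k.ints" using t(1,2) unfolding u(3) by blast
    next
      show "primeideal P (ring_of_integers k.L) \<and> P \<in> nonzero_ideals k.L" if "P \<in> {H1, H2, Q1, Q2}" for P
        using that prime_ideals nonzero by blast
      show "\<one>\<^bsub>Cl\<^esub> \<in> generate Cl X'" by (rule generate.one)
      show "s \<otimes>\<^bsub>Cl\<^esub> k.cls P \<in> generate Cl X'" if "s \<in> generate Cl X'" "P \<in> {H1, H2, Q1, Q2}" for s P
        by (rule generate.eng[OF that(1) all[OF that(2)]])
    qed (use J in simp_all)
    then show "C \<in> generate Cl X'" unfolding I(2) J(2) .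
  qed
qed

text \<open>The square of the product ideal is (d), and d is the square of sqrt d in k, so the
  product is (sqrt d).\<close>

lemma product_relation:
  "(k.cls H1 \<otimes>\<^bsub>Cl\<^esub> k.cls H2) \<otimes>\<^bsub>Cl\<^esub> (k.cls Q1 \<otimes>\<^bsub>Cl\<^esub> k.cls Q2) = \<one>\<^bsub>Cl\<^esub>"
proof -
  define T where "T = set_prod (set_prod H1 H2) (set_prod Q1 Q2)"
  have T: "T \<in> nonzero_ideals k.L" unfolding T_def by simp
  have "set_prod T T = set_prod (set_prod (set_prod H1 H1) (set_prod H2 H2)) (set_prod (set_prod Q1 Q1) (set_prod Q2 Q2))"
    unfolding T_def by (simp only: set_prod_ac)
  also have "\<dots> = scale ((\<pi>1 * \<pi>2) * (of_nat q1 * of_nat q2)) k.ints"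
    unfolding prime_squares by (simp only: k.ints.principal_prod)
  also have "(\<pi>1 * \<pi>2) * (of_nat q1 * of_nat q2) = of_nat d" unfolding d_factor by (rule mult.assoc)
  finally have "set_prod T T = scale (sqrtC d * sqrtC d) k.ints" unfolding sqrtC_self .
  moreover have "sqrtC d \<noteq> 0" using k.sqrt_notin by auto
  ultimately have "T = scale (sqrtC d) k.ints"
    using k.ideal_of_square_principal[OF k.nonzero_idealsD[OF T] k.gen_in] by blast
  then have "k.cls T = \<one>\<^bsub>Cl\<^esub>" using principal_class[OF T] \<open>sqrtC d \<noteq> 0\<close> by blast
  then show ?thesis unfolding T_def by (simp add: k.class_group_mult)
qed

lemma principal_class_of_square:
  assumes I: "I \<in> nonzero_ideals k.L" "set_prod I I = scale r k.ints" and r: "r \<noteq> 0"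
    and \<theta>: "\<theta> \<in> k.L" "\<theta> * \<theta> = r * \<eta>" and \<eta>: "\<eta> \<in> k.ints" "inverse \<eta> \<in> k.ints" "\<eta> \<noteq> 0"
  shows "k.cls I = \<one>\<^bsub>Cl\<^esub>"
  using k.principal_of_square[OF k.nonzero_idealsD[OF I(1)] I(2) r \<theta> \<eta>] by (intro principal_class[OF I(1)])

end

section \<open>The fundamental unit\<close>

lemma (in complex_subfield) quad_ext_subset:
  assumes "A \<subseteq> F" "s \<in> F" shows "quad_ext A s \<subseteq> F"
proof
  fix z assume "z \<in> quad_ext A s"
  then obtain a b where ab: "a \<in> A" "b \<in> A" "z = a + b * s" by (rule quad_extE)
  have "a \<in> F" "b \<in> F" using ab(1,2) assms(1) by blast+
  then show "z \<in> F" unfolding ab(3) using assms(2) by (intro add mult)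
qed

text \<open>For a unit of norm 1 and trace t this exhibits (t + 2) times the unit as a
  square.\<close>

lemma square_plus_one:
  fixes u t :: complex
  assumes "u * u = t * u - 1" shows "(u + 1) * (u + 1) = (t + 2) * u"
proof -
  have "(u + 1) * (u + 1) = u * u + 2 * u + 1" by (simp add: algebra_simps)
  also have "\<dots> = (t + 2) * u" unfolding assms by (simp add: left_diff_distrib distrib_right)
  finally show ?thesis .
qed

lemma square_minus_one:
  fixes u t :: complex
  assumes "u * u = t * u - 1" shows "(u - 1) * (u - 1) = (t - 2) * u"
proof -
  have "(u - 1) * (u - 1) = u * u - 2 * u + 1" by (simp add: algebra_simps)
  also have "\<dots> = (t - 2) * u" unfolding assms by (simp add: left_diff_distrib distrib_right)
  finally show ?thesis .
qed

text \<open>Each prime of the list is assigned to one of the coprime factors; what remains are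
  coprime factors of a square, hence squares.\<close>

lemma coprime_mult_primes:
  fixes u v w :: nat
  assumes "\<forall>q\<in>set qs. Factorial_Ring.prime q" "Rings.coprime u v" "u * v = prod_list qs * w\<^sup>2" "u > 0" "v > 0"
  shows "\<exists>xs ys a b. u = prod_list xs * a\<^sup>2 \<and> v = prod_list ys * b\<^sup>2 \<and>
    set xs \<subseteq> set qs \<and> set ys \<subseteq> set qs \<and> length xs + length ys = length qs"
  using assms
proof (induction qs arbitrary: u v)
  case Nil
  then have "u * v = w\<^sup>2" by simp
  then obtain a b where "u = a\<^sup>2" "v = b\<^sup>2" using coprime_mult_square[OF Nil.prems(2) _ Nil.prems(4,5)] by metis
  then have "u = prod_list [] * a\<^sup>2 \<and> v = prod_list [] * b\<^sup>2" by simp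
  then show ?case by (intro exI[of _ "[]"] exI[of _ a] exI[of _ b]) simp
next
  case (Cons q qs)
  have q: "Factorial_Ring.prime q" and qs: "\<forall>q\<in>set qs. Factorial_Ring.prime q" using Cons.prems(1) by auto
  have eq: "u * v = q * (prod_list qs * w\<^sup>2)" using Cons.prems(3) by (simp add: mult.assoc)
  show ?case
  proof (rule coprime_mult_prime[OF q Cons.prems(2) eq Cons.prems(4,5)])
    fix u' assume u': "u = q * u'" "Rings.coprime u' v" "u' * v = prod_list qs * w\<^sup>2" "u' > 0"
    obtain xs ys a b where *: "u' = prod_list xs * a\<^sup>2" "v = prod_list ys * b\<^sup>2"
      "set xs \<subseteq> set qs" "set ys \<subseteq> set qs" "length xs + length ys = length qs"
      using Cons.IH[OF qs u'(2,3,4) Cons.prems(5)] by blast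
    have "u = prod_list (q # xs) * a\<^sup>2" unfolding u'(1) *(1) by simp
    then show ?thesis using *(2-5) by (intro exI[of _ "q # xs"] exI[of _ ys] exI[of _ a] exI[of _ b]) auto
  next
    fix v' assume v': "v = q * v'" "Rings.coprime u v'" "u * v' = prod_list qs * w\<^sup>2" "v' > 0"
    obtain xs ys a b where *: "u = prod_list xs * a\<^sup>2" "v' = prod_list ys * b\<^sup>2"
      "set xs \<subseteq> set qs" "set ys \<subseteq> set qs" "length xs + length ys = length qs"
      using Cons.IH[OF qs v'(2,3) Cons.prems(4) v'(4)] by blast
    have "v = prod_list (q # ys) * b\<^sup>2" unfolding v'(1) *(2) by simp
    then show ?thesis using *(1,3-5) by (intro exI[of _ xs] exI[of _ "q # ys"] exI[of _ a] exI[of _ b]) auto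
  qed
qed

text \<open>When three primes are shared by two factors, one factor receives at most one of
  them.\<close>

lemma coprime_mult_three_primes:
  fixes u v w :: nat
  assumes "Factorial_Ring.prime q" "Factorial_Ring.prime r" "Factorial_Ring.prime s"
    and "Rings.coprime u v" "u * v = q * r * s * w\<^sup>2" "u > 0" "v > 0"
  obtains D n where "D \<in> {1, q, r, s}" "u = D * n\<^sup>2 \<or> v = D * n\<^sup>2"
proof -
  have "\<exists>xs ys a b. u = prod_list xs * a\<^sup>2 \<and> v = prod_list ys * b\<^sup>2 \<and>
    set xs \<subseteq> set [q, r, s] \<and> set ys \<subseteq> set [q, r, s] \<and> length xs + length ys = length [q, r, s]"
    by (rule coprime_mult_primes[where w = w]) (use assms in \<open>simp_all add: mult_ac\<close>)
  then obtain xs ys a b where *: "u = prod_list xs * a\<^sup>2" "v = prod_list ys * b\<^sup>2"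
    "set xs \<subseteq> {q, r, s}" "set ys \<subseteq> {q, r, s}" "length xs + length ys = 3" by auto
  have short: "prod_list zs \<in> {1, q, r, s}" if zs: "length zs \<le> 1" "set zs \<subseteq> {q, r, s}" for zs
    using zs by (cases zs) auto
  have "length xs \<le> 1 \<or> length ys \<le> 1" using *(5) by linarith
  then show ?thesis using that short *(1-4) by blast
qed

context biquadratic
begin

text \<open>Here u is the trace 2 x of a unit of norm 1, so that half-integral x is included, and (u
  + 2) (u - 2) = d v^2. For odd u the factors are coprime; for even u they are 4 (t + 1) and 4 t
  with consecutive t and t + 1.\<close>

lemma norm_four_factorization:
  fixes u v :: nat
  assumes eq: "u\<^sup>2 = d * v\<^sup>2 + 4" and u: "u > 2"
  obtains D n where "D \<in> {1, p, q1, q2}" "u + 2 = D * n\<^sup>2 \<or> u - 2 = D * n\<^sup>2"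
proof (cases "odd u")
  case True
  have cop: "Rings.coprime (u + 2) (u - 2)"
  proof (rule coprimeI)
    fix c assume c: "c dvd u + 2" "c dvd u - 2"
    have four: "(u + 2) - (u - 2) = 2 * 2" using u by simp
    have div: "c dvd 2 * 2" using dvd_diff_nat[OF c] unfolding four .
    have "odd c"
    proof
      assume "even c"
      then have "even (u + 2)" using c(1) by (rule dvd_trans)
      then show False using True by simp
    qed
    then have "Rings.coprime c 2" by (simp add: coprime_right_2_iff_odd)
    then have "Rings.coprime c (2 * 2)" by (simp only: coprime_mult_right_iff)
    then show "is_unit c" using dvd_refl div by (rule coprime_common_divisor)
  qed
  have "(u + 2) * (u - 2) = d * v\<^sup>2"
  proof -
    have "u = (u - 2) + 2" using u by simp
    then obtain t where t: "u = t + 2" by blast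
    have "(t + 2)\<^sup>2 = t * (t + 4) + 4" by (simp add: power2_eq_square algebra_simps)
    then have "t * (t + 4) = d * v\<^sup>2" using eq unfolding t by linarith
    moreover have "u - 2 = t" "u + 2 = t + 4" using t by simp_all
    ultimately show ?thesis by (simp only: mult.commute[of "t + 4" t])
  qed
  moreover have "u + 2 > 0" "u - 2 > 0" using u by simp_all
  ultimately show ?thesis by (rule coprime_mult_three_primes[OF prime cop]) (rule that)
next
  case False
  then have "even u" by simp
  then obtain u' where u': "u = 2 * u'" by (rule evenE)
  have "even (d * v\<^sup>2)"
  proof -
    have "even (u\<^sup>2)" using False by simp
    then show ?thesis unfolding eq by simp
  qed
  moreover have "odd d" using d_mod4 by presburger
  ultimately have "even v" by simp
  then obtain v' where v': "v = 2 * v'" by (rule evenE)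
  have "4 * u'\<^sup>2 = 4 * (d * v'\<^sup>2 + 1)" using eq unfolding u' v' by (simp add: power2_eq_square)
  then have e: "u'\<^sup>2 = d * v'\<^sup>2 + 1" by simp
  have "v' > 0"
  proof (rule ccontr)
    assume "\<not> v' > 0"
    then have "u'\<^sup>2 = 1" using e by simp
    then have "u' = 1" by simp
    then show False using u u' by simp
  qed
  obtain t w where t: "u' = 2 * t + 1" "v' = 2 * w" "t * (t + 1) = d * w\<^sup>2" "w > 0" "t > 0"
    by (rule pell_half_factorization[OF d_mod4 e \<open>v' > 0\<close>])
  have cop: "Rings.coprime t (t + 1)" and pos: "t + 1 > 0" by simp_all
  obtain D n where Dn: "D \<in> {1, p, q1, q2}" "t = D * n\<^sup>2 \<or> t + 1 = D * n\<^sup>2"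
    by (rule coprime_mult_three_primes[OF prime cop t(3,5) pos])
  \<comment> \<open>The factor 4 between t and u - 2 is absorbed into the square.\<close>
  have sq: "4 * (D * n\<^sup>2) = D * (2 * n)\<^sup>2" by (simp add: power_mult_distrib)
  have u4: "u - 2 = 4 * t" "u + 2 = 4 * (t + 1)" unfolding u' t(1) by simp_all
  from Dn(2) have "u + 2 = D * (2 * n)\<^sup>2 \<or> u - 2 = D * (2 * n)\<^sup>2"
  proof
    assume tn: "t = D * n\<^sup>2"
    have "u - 2 = D * (2 * n)\<^sup>2" unfolding u4(1) unfolding tn by (rule sq)
    then show ?thesis ..
  next
    assume tn: "t + 1 = D * n\<^sup>2"
    have "u + 2 = D * (2 * n)\<^sup>2" unfolding u4(2) unfolding tn by (rule sq)
    then show ?thesis ..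
  qed
  then show ?thesis using that Dn(1) by blast
qed

text \<open>Norm -1 would make q1 = 3 mod 4 divide a^2 + 2^2 with a = 2 x, hence divide 2. With norm
  1, \<open>2 * x + 2\<close> or \<open>2 * x - 2\<close> is D n^2 with D among 1, p, q1, q2. The
  value D = 1 would make the unit a square in Q(sqrt d), although it is fundamental.\<close>

lemma fundamental_unit_relations:
  assumes unit: "fundamental_unit (adjoin {sqrtC d}) (x + y * sqrt (real d))"
    and half: "2 * x \<in> \<int>" "2 * y \<in> \<int>"
  obtains \<epsilon> :: complex and D n :: nat where "\<epsilon> \<in> k.ints" "inverse \<epsilon> \<in> k.ints" "\<epsilon> \<noteq> 0" "x > 1"
    "(\<epsilon> + 1) * (\<epsilon> + 1) = of_real (2 * x + 2) * \<epsilon>" "(\<epsilon> - 1) * (\<epsilon> - 1) = of_real (2 * x - 2) * \<epsilon>"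
    "D \<in> {p, q1, q2}" "2 * x + 2 = real D * (real n)\<^sup>2 \<or> 2 * x - 2 = real D * (real n)\<^sup>2"
proof -
  define KR where "KR = adjoin {sqrtC d}"
  interpret R: number_field KR unfolding KR_def by (rule number_field.intro[OF adjoin_subfield])
  have KRk: "KR \<subseteq> k.L" unfolding KR_def by (rule adjoin_minimal[OF k.L_subfield]) simp
  define e0 where "e0 = x + y * sqrt (real d)"
  define \<epsilon> where "\<epsilon> = complex_of_real e0"
  have e0: "e0 > 1" and U: "Units (ring_of_integers KR) = {s * \<epsilon> powi n | s n. s \<in> {1, -1} \<and> n \<in> (UNIV :: int set)}"
    using unit unfolding fundamental_unit_def KR_def[symmetric] e0_def[symmetric] \<epsilon>_def[symmetric] by blast+
  have eps0: "\<epsilon> \<noteq> 0" unfolding \<epsilon>_def using e0 by simp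
  have "\<epsilon> = 1 * \<epsilon> powi 1" by simp
  then have "\<epsilon> \<in> Units (ring_of_integers KR)" unfolding U by blast
  then obtain z where z: "\<epsilon> \<in> R.ints" "z \<in> R.ints" "z * \<epsilon> = 1" by (auto simp: Units_def)
  have "inverse \<epsilon> = z" using z(3) by (intro inverse_unique) (simp add: mult.commute)
  then have epsR: "\<epsilon> \<in> R.ints" "inverse \<epsilon> \<in> R.ints" using z by simp_all
  have epsk: "\<epsilon> \<in> k.ints" "inverse \<epsilon> \<in> k.ints" using epsR KRk unfolding integers_of_def by blast+
  obtain a b :: int where ab: "2 * x = of_int a" "2 * y = of_int b" using half by (auto elim!: Ints_cases)
  have xy: "x = of_int a / 2" "y = of_int b / 2" using ab by simp_all
  have form: "\<epsilon> = of_real x + of_real y * sqrtC d" unfolding \<epsilon>_def e0_def sqrtC_def by simp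
  have xyG: "of_real x \<in> gauss_rat" "of_real y \<in> gauss_rat" unfolding xy by simp_all
  have conj: "k.conj \<epsilon> = of_real x - of_real y * sqrtC d" unfolding form by (rule k.conj_eq[OF xyG])
  define N where "N = \<epsilon> * k.conj \<epsilon>"
  have "N = of_real x * of_real x - of_real y * of_real y * (sqrtC d * sqrtC d)"
    unfolding N_def conj unfolding form by (simp add: algebra_simps del: sqrtC_self k.sqrtC_square)
  then have "N = of_real (x * x - real d * (y * y))" unfolding sqrtC_self by simp
  moreover define r where "r = x * x - real d * (y * y)"
  ultimately have Nreal: "N = of_real r" by simp
  have epsL: "\<epsilon> \<in> k.L" using epsk(1) by (rule k.ints_in_L)
  have NG: "N \<in> gauss_int" unfolding N_def by (rule k.norm_gauss[OF epsk(1)])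
  have "N * (inverse \<epsilon> * k.conj (inverse \<epsilon>)) = (\<epsilon> * inverse \<epsilon>) * k.conj (\<epsilon> * inverse \<epsilon>)"
    unfolding N_def k.conj_mult[OF epsL k.ext.inverse[OF epsL]] by (rule mult_swap_middle)
  also have "\<epsilon> * inverse \<epsilon> = 1" using eps0 by simp
  also have "1 * k.conj 1 = 1" by simp
  finally have "N gdvd 1" using k.norm_gauss[OF epsk(2)] by (intro gdvdI[of "inverse \<epsilon> * k.conj (inverse \<epsilon>)"]) simp_all
  then have "N = 1 \<or> N = -1 \<or> N = \<i> \<or> N = -\<i>" by (rule gauss_units[OF NG])
  moreover have "Im N = 0" unfolding Nreal by (rule Im_complex_of_real)
  ultimately have N1: "N = 1 \<or> N = -1" by auto
  define g where "g = int d * (b * b)"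
  have four: "real_of_int (a * a - g) = 4 * r" unfolding xy r_def g_def by (simp add: field_simps)
  have "N \<noteq> -1"
  proof
    assume "N = -1"
    then have "complex_of_real r = complex_of_real (- 1)" unfolding Nreal by simp
    then have "r = -1" by (simp only: of_real_eq_iff)
    then have "real_of_int (a * a - g) = real_of_int (- 4)" unfolding four by simp
    then have "a * a - g = - 4" by (simp only: of_int_eq_iff)
    then have "a * a + 4 = g" by linarith
    moreover have "a\<^sup>2 + 2\<^sup>2 = a * a + 4" by (simp add: power2_eq_square)
    moreover have "g = int q1 * (int p * int q2 * (b * b))" unfolding g_def of_nat_mult by (simp only: mult_ac)
    ultimately have "a\<^sup>2 + 2\<^sup>2 = int q1 * (int p * int q2 * (b * b))" by (simp only:)
    then have "int q1 dvd a\<^sup>2 + 2\<^sup>2" by (rule dvdI)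
    then have "int q1 dvd 2" by (rule prime_3_mod_4_dvd_sum_squares[OF prime(2) mod4(2)])
    then have "int q1 dvd int 2" by simp
    then have "q1 dvd 2" by (simp only: of_nat_dvd_iff)
    then have "q1 = 2" using primes_dvd_imp_eq[OF prime(2) two_is_prime_nat] by blast
    then show False using mod4(2) by simp
  qed
  then have N: "N = 1" using N1 by blast
  have trace: "\<epsilon> + k.conj \<epsilon> = of_real (2 * x)" unfolding conj unfolding form by simp
  have "\<epsilon> * (of_real (2 * x) - \<epsilon>) = 1" unfolding trace[symmetric] using N unfolding N_def by simp
  then have sq: "\<epsilon> * \<epsilon> = of_real (2 * x) * \<epsilon> - 1" by (simp add: algebra_simps)
  have plus: "(\<epsilon> + 1) * (\<epsilon> + 1) = of_real (2 * x + 2) * \<epsilon>"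
    unfolding of_real_add of_real_numeral by (rule square_plus_one[OF sq])
  have minus: "(\<epsilon> - 1) * (\<epsilon> - 1) = of_real (2 * x - 2) * \<epsilon>"
    unfolding of_real_diff of_real_numeral by (rule square_minus_one[OF sq])
  \<comment> \<open>Positivity of (e0 - 1)^2 = (2 x - 2) e0 yields x > 1, so the trace exceeds 2 as
    \<open>norm_four_factorization\<close> requires.\<close>
  have "complex_of_real ((e0 - 1) * (e0 - 1)) = (\<epsilon> - 1) * (\<epsilon> - 1)" unfolding \<epsilon>_def by simp
  also have "\<dots> = complex_of_real ((2 * x - 2) * e0)" unfolding minus unfolding \<epsilon>_def by (simp only: of_real_mult)
  finally have e0_sq: "(e0 - 1) * (e0 - 1) = (2 * x - 2) * e0" by (simp only: of_real_eq_iff)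
  have "(e0 - 1) * (e0 - 1) > 0" using e0 by simp
  then have "(2 * x - 2) * e0 > 0" unfolding e0_sq .
  moreover have "e0 > 0" using e0 by simp
  ultimately have "2 * x - 2 > 0" by (rule zero_less_mult_pos2)
  then have x1: "x > 1" by simp
  then have "real_of_int a > real_of_int 2" using ab(1) by simp
  then have a2: "a > 2" by (simp only: of_int_less_iff)
  have "complex_of_real r = complex_of_real 1" using N unfolding Nreal by simp
  then have "r = 1" by (simp only: of_real_eq_iff)
  then have "real_of_int (a * a - g) = real_of_int 4" unfolding four by simp
  then have "a * a - g = 4" by (simp only: of_int_eq_iff)
  then have "a\<^sup>2 = g + 4" by (simp add: power2_eq_square)
  then have "a\<^sup>2 = int d * b\<^sup>2 + 4" unfolding g_def by (simp only: power2_eq_square)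
  then have "int ((nat a)\<^sup>2) = int (d * (nat \<bar>b\<bar>)\<^sup>2 + 4)" using a2 by simp
  then have eq4: "(nat a)\<^sup>2 = d * (nat \<bar>b\<bar>)\<^sup>2 + 4" by (simp only: of_nat_eq_iff)
  have na: "nat a > 2" using a2 by simp
  obtain D n where Dn: "D \<in> {1, p, q1, q2}" "nat a + 2 = D * n\<^sup>2 \<or> nat a - 2 = D * n\<^sup>2"
    by (rule norm_four_factorization[OF eq4 na])
  have r1: "real (nat a + 2) = 2 * x + 2" "real (nat a - 2) = 2 * x - 2" using a2 ab(1) by (simp_all add: of_nat_diff)
  from Dn(2) have D2: "2 * x + 2 = real D * (real n)\<^sup>2 \<or> 2 * x - 2 = real D * (real n)\<^sup>2"
  proof
    assume "nat a + 2 = D * n\<^sup>2"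
    then have "real (nat a + 2) = real (D * n\<^sup>2)" by (simp only:)
    then have "2 * x + 2 = real D * (real n)\<^sup>2" unfolding r1 by (simp only: of_nat_mult of_nat_power)
    then show ?thesis ..
  next
    assume "nat a - 2 = D * n\<^sup>2"
    then have "real (nat a - 2) = real (D * n\<^sup>2)" by (simp only:)
    then have "2 * x - 2 = real D * (real n)\<^sup>2" unfolding r1 by (simp only: of_nat_mult of_nat_power)
    then show ?thesis ..
  qed
  \<comment> \<open>A square root would be a unit, thus plus or minus an integral power of the
    fundamental unit, which would then equal an even power of itself. This is impossible above
    1.\<close>
  have not_square: False if g: "g \<in> KR" "g * g = \<epsilon>" for g
  proof -
    have "algebraic_int (g\<^sup>2)" unfolding power2_eq_square g(2) using epsR(1) by (simp add: integers_of_def)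
    then have "algebraic_int g" by (rule iffD1[OF algebraic_int_power2_iff])
    then have gi: "g \<in> R.ints" using g(1) by (simp add: integers_of_def)
    have "algebraic_int ((inverse g)\<^sup>2)"
      unfolding power2_eq_square inverse_mult_distrib[symmetric] g(2) using epsR(2) by (simp add: integers_of_def)
    then have "algebraic_int (inverse g)" by (rule iffD1[OF algebraic_int_power2_iff])
    then have gi': "inverse g \<in> R.ints" using R.inverse[OF g(1)] by (simp add: integers_of_def)
    have g0: "g \<noteq> 0" using g(2) eps0 by auto
    have "g \<in> Units (ring_of_integers KR)"
      unfolding Units_def using gi gi' g0 by (auto intro!: bexI[of _ "inverse g"])
    then obtain s j where sj: "g = s * \<epsilon> powi j" "s = 1 \<or> s = -1" unfolding U by blast
    have ss: "s * s = 1" using sj(2) by auto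
    have "\<epsilon> = (s * \<epsilon> powi j) * (s * \<epsilon> powi j)" unfolding sj(1)[symmetric] g(2) ..
    also have "\<dots> = (s * s) * (\<epsilon> powi j * \<epsilon> powi j)" by (rule mult_swap_middle)
    also have "\<dots> = \<epsilon> powi (j + j)" unfolding ss mult_1
      by (rule power_int_add[symmetric]) (simp add: eps0)
    finally have "complex_of_real e0 = complex_of_real (e0 powi (j + j))" unfolding \<epsilon>_def by simp
    then have e: "e0 = e0 powi (j + j)" by (simp only: of_real_eq_iff)
    show False
    proof (cases "j \<ge> 1")
      case True
      then have "e0 powi 2 \<le> e0 powi (j + j)" using e0 by (intro power_int_increasing) auto
      then have "e0 * e0 \<le> e0 * 1" using e by (simp add: power2_eq_square)
      then show False using e0 by simp
    next
      case False
      then have "e0 powi (j + j) \<le> e0 powi 0" using e0 by (intro power_int_increasing) auto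
      then show False using e e0 by simp
    qed
  qed
  have "D \<noteq> 1"
  proof
    assume D1: "D = 1"
    have "complex_of_real (2 * x + 2) = of_nat n * of_nat n \<or> complex_of_real (2 * x - 2) = of_nat n * of_nat n"
    proof -
      have "2 * x + 2 = real n * real n \<or> 2 * x - 2 = real n * real n"
        using D2 unfolding D1 by (simp add: power2_eq_square)
      then show ?thesis by (elim disjE) (simp_all only: of_real_mult of_real_of_nat_eq simp_thms)
    qed
    then obtain t :: complex where t: "t \<in> KR" "(\<epsilon> + t) * (\<epsilon> + t) = of_nat n * of_nat n * \<epsilon>"
    proof
      assume "complex_of_real (2 * x + 2) = of_nat n * of_nat n"
      then show thesis using that[OF R.one] plus by simp
    next
      assume c: "complex_of_real (2 * x - 2) = of_nat n * of_nat n"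
      have "(\<epsilon> + - 1) * (\<epsilon> + - 1) = of_nat n * of_nat n * \<epsilon>" using minus unfolding c by simp
      then show thesis by (rule that[OF R.minus[OF R.one]])
    qed
    have n0: "n \<noteq> 0" using D2 x1 by (intro notI) auto
    have "(\<epsilon> + t) / of_nat n \<in> KR" using t(1) epsR(1) unfolding integers_of_def by (intro R.divide R.add) auto
    moreover have "((\<epsilon> + t) / of_nat n) * ((\<epsilon> + t) / of_nat n) = \<epsilon>"
      unfolding times_divide_times_eq t(2) using n0 by simp
    ultimately show False by (rule not_square)
  qed
  then have "D \<in> {p, q1, q2}" using Dn(1) by blast
  then show ?thesis using that[OF epsk eps0 x1 plus minus] D2 by blast
qed

lemma adjoin_k: "adjoin {sqrtC d, \<i>} = k.L"
proof (rule adjoin_eqI[OF k.L_subfield])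
  show "{sqrtC d, \<i>} \<subseteq> k.L" by simp
  fix E assume E: "complex_subfield E" "{sqrtC d, \<i>} \<subseteq> E"
  interpret E: complex_subfield E by (rule E(1))
  show "k.L \<subseteq> E" unfolding gauss_rat_def using E(2) by (intro E.quad_ext_subset E.Rats_subset) simp_all
qed

lemma adjoin_K1: "adjoin {sqrtC p, sqrtC m, \<i>} = M.L"
proof (rule adjoin_eqI[OF M.L_subfield])
  show "{sqrtC p, sqrtC m, \<i>} \<subseteq> M.L" by simp
  fix E assume E: "complex_subfield E" "{sqrtC p, sqrtC m, \<i>} \<subseteq> E"
  interpret E: complex_subfield E by (rule E(1))
  show "M.L \<subseteq> E" unfolding gauss_rat_def using E(2) by (intro E.quad_ext_subset E.Rats_subset) simp_all
qed

end

section \<open>The extra relation between the classes and the two cases\<close>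

context biquadratic_primes
begin

text \<open>The square of (eps + t) / n is r * eps, so the ideal with square (r) is generated by it.
  In the applications t is 1 or -1.\<close>

lemma prime_class_trivial:
  assumes \<epsilon>: "\<epsilon> \<in> k.ints" "inverse \<epsilon> \<in> k.ints" "\<epsilon> \<noteq> 0"
    and I: "I \<in> nonzero_ideals k.L" "set_prod I I = scale (of_nat r) k.ints" and r: "r > 0"
    and t: "t \<in> gauss_int" "(\<epsilon> + t) * (\<epsilon> + t) = of_real c * \<epsilon>" and c: "c = real r * (real n)\<^sup>2" "c > 0"
  shows "k.cls I = \<one>\<^bsub>Cl\<^esub>"
proof (rule principal_class_of_square[OF I _ _ _ \<epsilon>])
  have n: "n \<noteq> 0" using c by (intro notI) simp
  have cC: "complex_of_real c = of_nat r * (of_nat n * of_nat n)" unfolding c(1) by (simp add: power2_eq_square)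
  show "(of_nat r :: complex) \<noteq> 0" using r by simp
  show "(\<epsilon> + t) / of_nat n \<in> k.L" using k.ints_in_L[OF \<epsilon>(1)] t(1) by (intro k.ext.divide k.ext.add) simp_all
  show "((\<epsilon> + t) / of_nat n) * ((\<epsilon> + t) / of_nat n) = of_nat r * \<epsilon>"
    unfolding times_divide_times_eq t(2) cC using n by simp
qed

text \<open>The four classes have order at most two and product one, so one further relation reduces
  them to two generators. If H1 H2 is principal, then h1 = h2 and g1 = g2; if Q1 or Q2 is principal,
  the other has the class h1 h2.\<close>

theorem capitulation_kernel_cases:
  assumes unit: "fundamental_unit (adjoin {sqrtC d}) (x + y * sqrt (real d))"
    and half: "2 * x \<in> \<int>" "2 * y \<in> \<int>"
  defines "c1 \<equiv> (\<exists>n::nat. 2 * real p * (x + 1) = real (n ^ 2)) \<or> (\<exists>n::nat. 2 * real p * (x - 1) = real (n ^ 2))"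
  shows "c1 \<Longrightarrow> capitulation_kernel k.L M.L = generate Cl {k.cls H1, k.cls Q1}"
    and "\<not> c1 \<Longrightarrow> capitulation_kernel k.L M.L = generate Cl {k.cls H1, k.cls H2}"
proof -
  obtain \<epsilon> D n where \<epsilon>: "\<epsilon> \<in> k.ints" "inverse \<epsilon> \<in> k.ints" "\<epsilon> \<noteq> 0" and x1: "x > 1"
    and pm: "(\<epsilon> + 1) * (\<epsilon> + 1) = of_real (2 * x + 2) * \<epsilon>" "(\<epsilon> - 1) * (\<epsilon> - 1) = of_real (2 * x - 2) * \<epsilon>"
    and D: "D \<in> {p, q1, q2}" "2 * x + 2 = real D * (real n)\<^sup>2 \<or> 2 * x - 2 = real D * (real n)\<^sup>2"
    by (rule fundamental_unit_relations[OF unit half])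
  define h1 h2 g1 g2 where "h1 = k.cls H1" "h2 = k.cls H2" "g1 = k.cls Q1" "g2 = k.cls Q2"
  have car: "h1 \<in> carrier Cl" "h2 \<in> carrier Cl" "g1 \<in> carrier Cl" "g2 \<in> carrier Cl"
    unfolding h1_h2_g1_g2_def using prime_class_carrier by simp_all
  have sq: "h1 \<otimes>\<^bsub>Cl\<^esub> h1 = \<one>\<^bsub>Cl\<^esub>" "h2 \<otimes>\<^bsub>Cl\<^esub> h2 = \<one>\<^bsub>Cl\<^esub>" "g1 \<otimes>\<^bsub>Cl\<^esub> g1 = \<one>\<^bsub>Cl\<^esub>" "g2 \<otimes>\<^bsub>Cl\<^esub> g2 = \<one>\<^bsub>Cl\<^esub>"
    unfolding h1_h2_g1_g2_def using prime_class_square by simp_all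
  have rel: "(h1 \<otimes>\<^bsub>Cl\<^esub> h2) \<otimes>\<^bsub>Cl\<^esub> (g1 \<otimes>\<^bsub>Cl\<^esub> g2) = \<one>\<^bsub>Cl\<^esub>"
    unfolding h1_h2_g1_g2_def by (rule product_relation)
  have inverse_eq: "a = b" if "a \<in> carrier Cl" "b \<in> carrier Cl" "a \<otimes>\<^bsub>Cl\<^esub> b = \<one>\<^bsub>Cl\<^esub>" "a \<otimes>\<^bsub>Cl\<^esub> a = \<one>\<^bsub>Cl\<^esub>" for a b
    using Cl.comm_inv_char[OF that(1,2,3)] Cl.comm_inv_char[OF that(1,1,4)] by simp
  {
    assume c1
    \<comment> \<open>Both alternatives are packed into one: t = 1 with u = 2 x + 2, or t = -1 with
      u = 2 x - 2.\<close>
    then obtain j :: nat and t :: complex and u :: real where jt: "t \<in> gauss_int"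
      "(\<epsilon> + t) * (\<epsilon> + t) = of_real u * \<epsilon>" "real p * u = real j * real j" "u > 0"
    proof (unfold c1_def, elim disjE exE)
      fix j :: nat assume "2 * real p * (x + 1) = real (j\<^sup>2)"
      then have "real p * (2 * x + 2) = real j * real j" by (simp add: power2_eq_square algebra_simps)
      then show thesis using that[of 1 "2 * x + 2" j] pm(1) x1 by simp
    next
      fix j :: nat assume "2 * real p * (x - 1) = real (j\<^sup>2)"
      then have "real p * (2 * x - 2) = real j * real j" by (simp add: power2_eq_square algebra_simps)
      then show thesis using that[of "-1" "2 * x - 2" j] pm(2) x1 by simp
    qed
    have j0: "j \<noteq> 0" using jt(3,4) gt1(1) by (intro notI) simp
    have "complex_of_real (real p * u) = of_nat j * of_nat j" unfolding jt(3) by simp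
    then have puC: "of_nat p * complex_of_real u = of_nat j * of_nat j" by simp
    have "set_prod (set_prod H1 H2) (set_prod H1 H2) = set_prod (set_prod H1 H1) (set_prod H2 H2)"
      by (simp only: set_prod_ac)
    also have "\<dots> = scale (of_nat p) k.ints" unfolding prime_squares pi_mult[symmetric] by (rule k.ints.principal_prod)
    finally have HH: "set_prod (set_prod H1 H2) (set_prod H1 H2) = scale (of_nat p) k.ints" .
    \<comment> \<open>Since p u = j^2, the square p^2 u eps / j^2 of this element is p * eps, while
      (p) is the square of H1 H2.\<close>
    define \<theta> where "\<theta> = of_nat p * (\<epsilon> + t) / of_nat j"
    have "\<theta> * \<theta> = of_nat p * (of_nat p * ((\<epsilon> + t) * (\<epsilon> + t))) / (of_nat j * of_nat j)"
      unfolding \<theta>_def times_divide_times_eq by (simp add: mult_ac)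
    also have "of_nat p * ((\<epsilon> + t) * (\<epsilon> + t)) = (of_nat j * of_nat j) * \<epsilon>"
      unfolding jt(2) puC[symmetric] by (simp only: mult.assoc)
    also have "of_nat p * ((of_nat j * of_nat j) * \<epsilon>) / (of_nat j * of_nat j) = of_nat p * \<epsilon>" using j0 by simp
    finally have "\<theta> * \<theta> = of_nat p * \<epsilon>" .
    moreover have "\<theta> \<in> k.L" unfolding \<theta>_def using k.ints_in_L[OF \<epsilon>(1)] jt(1)
      by (intro k.ext.divide k.ext.mult k.ext.add) simp_all
    moreover have "(of_nat p :: complex) \<noteq> 0" using gt1(1) by simp
    moreover note rule = principal_class_of_square[OF k.nonzero_ideals_prod[OF nonzero(1,2)] HH _ _ _ \<epsilon>]
    ultimately have "k.cls (set_prod H1 H2) = \<one>\<^bsub>Cl\<^esub>" by (intro rule)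
    then have hh: "h1 \<otimes>\<^bsub>Cl\<^esub> h2 = \<one>\<^bsub>Cl\<^esub>" unfolding h1_h2_g1_g2_def by (simp add: k.class_group_mult)
    have e1: "h1 = h2" by (rule inverse_eq[OF car(1,2) hh sq(1)])
    have gg: "g1 \<otimes>\<^bsub>Cl\<^esub> g2 = \<one>\<^bsub>Cl\<^esub>" using rel car unfolding hh by simp
    have e2: "g1 = g2" by (rule inverse_eq[OF car(3,4) gg sq(3)])
    have "h1 \<in> generate Cl {h1, g1}" "g1 \<in> generate Cl {h1, g1}" by (auto intro: generate.incl)
    then have "k.cls P \<in> generate Cl {h1, g1}" if "P \<in> {H1, H2, Q1, Q2}" for P
      using that e1 e2 unfolding h1_h2_g1_g2_def by auto
    moreover have "{h1, g1} \<subseteq> k.cls ` {H1, H2, Q1, Q2}" unfolding h1_h2_g1_g2_def by simp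
    ultimately have "capitulation_kernel k.L M.L = generate Cl {h1, g1}" by (intro kernel_eq_generate)
    then show "capitulation_kernel k.L M.L = generate Cl {k.cls H1, k.cls Q1}" unfolding h1_h2_g1_g2_def .
  next
    assume nc1: "\<not> c1"
    \<comment> \<open>For D = p, one of 2 p (x + 1) and 2 p (x - 1) would equal (p n)^2, which is
      the excluded case.\<close>
    have "D \<noteq> p"
    proof
      assume Dp: "D = p"
      have "2 * real p * (x + 1) = real ((p * n)\<^sup>2)" if "2 * x + 2 = real D * (real n)\<^sup>2"
      proof -
        have "2 * real p * (x + 1) = real p * (2 * x + 2)" by (simp add: algebra_simps)
        then show ?thesis unfolding that Dp by (simp add: power2_eq_square mult_ac)
      qed
      moreover have "2 * real p * (x - 1) = real ((p * n)\<^sup>2)" if "2 * x - 2 = real D * (real n)\<^sup>2"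
      proof -
        have "2 * real p * (x - 1) = real p * (2 * x - 2)" by (simp add: algebra_simps)
        then show ?thesis unfolding that Dp by (simp add: power2_eq_square mult_ac)
      qed
      ultimately show False using D(2) nc1 unfolding c1_def by blast
    qed
    then have "D = q1 \<or> D = q2" using D(1) by blast
    then obtain P where P: "P \<in> {Q1, Q2}" "set_prod P P = scale (of_nat D) k.ints" "P \<in> nonzero_ideals k.L" "D > 0"
    proof
      assume "D = q1"
      then show thesis using that[of Q1] prime_squares(3) gt1(2) by simp
    next
      assume "D = q2"
      then show thesis using that[of Q2] prime_squares(4) gt1(3) by simp
    qed
    have trivial: "k.cls P = \<one>\<^bsub>Cl\<^esub>"
      using D(2)
    proof
      assume D2: "2 * x + 2 = real D * (real n)\<^sup>2"
      show ?thesis by (rule prime_class_trivial[OF \<epsilon> P(3,2,4) _ pm(1) D2]) (use x1 in simp_all)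
    next
      assume D2: "2 * x - 2 = real D * (real n)\<^sup>2"
      have "(\<epsilon> + (- 1)) * (\<epsilon> + (- 1)) = of_real (2 * x - 2) * \<epsilon>" using pm(2) by simp
      then show ?thesis by (rule prime_class_trivial[OF \<epsilon> P(3,2,4) _ _ D2, rotated]) (use x1 in simp_all)
    qed
    define S where "S = generate Cl {h1, h2}"
    have hS: "h1 \<in> S" "h2 \<in> S" "h1 \<otimes>\<^bsub>Cl\<^esub> h2 \<in> S" "\<one>\<^bsub>Cl\<^esub> \<in> S"
      unfolding S_def by (auto intro: generate.incl generate.eng generate.one)
    have hhc: "h1 \<otimes>\<^bsub>Cl\<^esub> h2 \<in> carrier Cl" using car by simp
    have hhsq: "(h1 \<otimes>\<^bsub>Cl\<^esub> h2) \<otimes>\<^bsub>Cl\<^esub> (h1 \<otimes>\<^bsub>Cl\<^esub> h2) = \<one>\<^bsub>Cl\<^esub>"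
    proof -
      have "(h1 \<otimes>\<^bsub>Cl\<^esub> h2) \<otimes>\<^bsub>Cl\<^esub> (h1 \<otimes>\<^bsub>Cl\<^esub> h2) = (h1 \<otimes>\<^bsub>Cl\<^esub> h1) \<otimes>\<^bsub>Cl\<^esub> (h2 \<otimes>\<^bsub>Cl\<^esub> h2)"
        using car(1,2) by (simp add: Cl.m_ac)
      then show ?thesis unfolding sq by simp
    qed
    have "g1 = \<one>\<^bsub>Cl\<^esub> \<or> g2 = \<one>\<^bsub>Cl\<^esub>" using P(1) trivial unfolding h1_h2_g1_g2_def by auto
    then have gS: "g1 \<in> S \<and> g2 \<in> S"
    proof
      assume g: "g1 = \<one>\<^bsub>Cl\<^esub>"
      have "(h1 \<otimes>\<^bsub>Cl\<^esub> h2) \<otimes>\<^bsub>Cl\<^esub> g2 = \<one>\<^bsub>Cl\<^esub>" using rel unfolding g Cl.l_one[OF car(4)] .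
      then have "h1 \<otimes>\<^bsub>Cl\<^esub> h2 = g2" by (rule inverse_eq[OF hhc car(4) _ hhsq])
      then show ?thesis using hS g by auto
    next
      assume g: "g2 = \<one>\<^bsub>Cl\<^esub>"
      have "(h1 \<otimes>\<^bsub>Cl\<^esub> h2) \<otimes>\<^bsub>Cl\<^esub> g1 = \<one>\<^bsub>Cl\<^esub>" using rel unfolding g Cl.r_one[OF car(3)] .
      then have "h1 \<otimes>\<^bsub>Cl\<^esub> h2 = g1" by (rule inverse_eq[OF hhc car(3) _ hhsq])
      then show ?thesis using hS g by auto
    qed
    have "k.cls P \<in> generate Cl {h1, h2}" if "P \<in> {H1, H2, Q1, Q2}" for P
      using that hS(1,2) gS unfolding h1_h2_g1_g2_def S_def by blast
    moreover have "{h1, h2} \<subseteq> k.cls ` {H1, H2, Q1, Q2}" unfolding h1_h2_g1_g2_def by simp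
    ultimately have "capitulation_kernel k.L M.L = generate Cl {h1, h2}" by (intro kernel_eq_generate)
    then show "capitulation_kernel k.L M.L = generate Cl {k.cls H1, k.cls H2}" unfolding h1_h2_g1_g2_def .
  }
qed

end

theorem theorem5p3:
  fixes p q1 q2 e f :: nat and x y :: real and \<pi>1 \<pi>2 :: complex
    and k K1 H1 H2 Q1 Q2 :: "complex set"
  assumes "Factorial_Ring.prime p" "Factorial_Ring.prime q1" "Factorial_Ring.prime q2"
    and "p \<noteq> q1" "p \<noteq> q2" "q1 \<noteq> q2"
    and "[int p = 1] (mod 4)" "[- int q1 = 1] (mod 4)" "[- int q2 = 1] (mod 4)"
    and k: "k = adjoin {sqrtC (p * q1 * q2), \<i>}"
    and K1: "K1 = adjoin {sqrtC p, sqrtC (q1 * q2), \<i>}"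
    and unit: "fundamental_unit (adjoin {sqrtC (p * q1 * q2)}) (x + y * sqrt (real (p * q1 * q2)))"
    and half_integers: "2 * x \<in> \<int>" "2 * y \<in> \<int>"
    and "p = e ^ 2 + 4 * f ^ 2"
    and "\<pi>1 = of_nat e + 2 * \<i> * of_nat f" "\<pi>2 = of_nat e - 2 * \<i> * of_nat f"
    and "prime_ideal_above k \<pi>1 H1" "prime_ideal_above k \<pi>2 H2"
    and "prime_ideal_above k (of_nat q1) Q1" "prime_ideal_above k (of_nat q2) Q2"
  shows "((\<exists>n::nat. 2 * real p * (x + 1) = real (n ^ 2)) \<or>
          (\<exists>n::nat. 2 * real p * (x - 1) = real (n ^ 2)) \<longrightarrow>
            capitulation_kernel k K1 =
              generate (class_group k) {ideal_class k H1, ideal_class k Q1}) \<and>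
         (\<not> ((\<exists>n::nat. 2 * real p * (x + 1) = real (n ^ 2)) \<or>
             (\<exists>n::nat. 2 * real p * (x - 1) = real (n ^ 2))) \<longrightarrow>
            capitulation_kernel k K1 =
              generate (class_group k) {ideal_class k H1, ideal_class k H2})"
proof -
  have mod4: "p mod 4 = 1" using assms(7) unfolding cong_iff_dvd_diff by presburger
  have mod4': "q1 mod 4 = 3" using assms(8) unfolding cong_iff_dvd_diff by presburger
  have mod4'': "q2 mod 4 = 3" using assms(9) unfolding cong_iff_dvd_diff by presburger
  interpret B: biquadratic p q1 q2 e f
    by (rule biquadratic.intro) fact+
  have kL: "k = B.k.L" and K1L: "K1 = B.M.L" unfolding k K1 by (rule B.adjoin_k, rule B.adjoin_K1)
  have pis: "\<pi>1 = B.\<pi>1" "\<pi>2 = B.\<pi>2" unfolding assms(16,17) B.\<pi>1_def B.\<pi>2_def by simp_all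
  interpret B: biquadratic_primes p q1 q2 e f H1 H2 Q1 Q2
    using assms(18-21) unfolding prime_ideal_above_def kL pis
    by (intro biquadratic_primes.intro biquadratic_primes_axioms.intro B.biquadratic_axioms) blast+
  show ?thesis
    using B.capitulation_kernel_cases[OF unit half_integers] unfolding kL K1L by blast
qed

end
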